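(* Let $X$ be a diffeological space and $P\to X$ a principal $H_\sigma$-bundle, with transition functions $(g_{ij},\varepsilon_{ij}):U_{ij}\to H_\sigma$ over a good open cover $(U_i)_i$, and let $\alpha=[\varepsilon_{ij}]\in H^1(X;\mathbb Z_2)$. Choose local lifts $\widehat g_{ij}:U_{ij}\to\widehat G$ of $g_{ij}$ and put $a_{ijk}=\widehat g_{ij}\,\widehat\sigma^{\varepsilon_{ij}}(\widehat g_{jk})\,\widehat g_{ik}^{-1}$. Then the cohomology class $[a]\in H^2(X;A_\alpha)$ represented by the cocycle $(a_{ijk})$ is the class of the lifting gerbe $\mathcal G(P,\widehat H_{\widehat\sigma})$.
   Context: Let $1\to A\to\widehat G\xrightarrow{q}G\to1$ be a central extension of diffeological groups with $A$ abelian, $\sigma:\mathbb Z_2\to\operatorname{Aut}(G)$ a smooth action ($\mathbb Z_2=\{\pm1\}$), and $\widehat\sigma:\mathbb Z_2\to\operatorname{Aut}(\widehat G)$ an action with $q\circ\widehat\sigma^\varepsilon=\sigma^\varepsilon\circ q$. Put $H_\sigma=G\rtimes_\sigma\mathbb Z_2$ and $\widehat H_{\widehat\sigma}=\widehat G\rtimes_{\widehat\sigma}\mathbb Z_2$, with product $(g,\varepsilon)(g',\varepsilon')=(g\,\sigma^\varepsilon(g'),\varepsilon\varepsilon')$ (resp. $\widehat\sigma$); one has an extension $1\to A\to\widehat H_{\widehat\sigma}\to H_\sigma\to1$. Transition functions satisfy $h_{ij}h_{jk}=h_{ik}$. The cover is taken such that smooth lifts exist. Open means open for the $D$-topology. $A_\alpha$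 is the local system obtained by gluing the sheaves of smooth $A$-valued functions on the $U_i$ along $U_{ij}$ by $\widehat\sigma^{\varepsilon_{ij}}|_A$. The $a_{ijk}$ are $A$-valued and form a twisted Čech $2$-cocycle: $a_{ijk}a_{ikl}=\widehat\sigma^{\varepsilon_{ij}}(a_{jkl})a_{ijl}$; coboundaries are $b_{ij}\widehat\sigma^{\varepsilon_{ij}}(b_{jk})b_{ik}^{-1}$ with $b_{ij}:U_{ij}\to A$ smooth. The lifting gerbe $\mathcal G(P,\widehat H_{\widehat\sigma})$ is the stack over $X$ whose groupoid over an open subset $U\subset X$ has as objects principal $\widehat H_{\widehat\sigma}$-bundles $\widehat P_U\to U$ equipped with an isomorphism $\widehat P_U/A\simeq P|_U$, and as morphisms isomorphisms of $\widehat H_{\widehat\sigma}$-bundles compatible with the projection to $P|_U$. It is banded by $A_\alpha$. The class of an $A_\alpha$-banded gerbe is the standard class in $H^2(X;A_\alpha)$ obtained by choosing local objects over a cover, isomorphisms between them on double intersections, and measuring on triple intersections the failure of these isomorphisms to compose.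
   Formalization: That [a] is the only class obtained is stated when smooth maps from open subsets of X to G lift locally to Ĝ, i.e. when the lifting stack really is a gerbe; without this the class can depend on choices. That [a] arises from some choice of local objects is stated without the condition. *)

theory Defs
  imports "HOL-Analysis.Analysis" "HOL-Algebra.Coset"
begin

section \<open>Diffeological spaces\<close>

text \<open>Domains of plots are open subsets of the library's \<^const>\<open>Euclidean_space\<close>: points of
  \<open>R^m\<close> are sequences vanishing from index \<open>m\<close> on, so that \<open>m\<close> may vary inside a formula.\<close>

primrec cont_diff ::
  "nat \<Rightarrow> nat \<Rightarrow> (nat \<Rightarrow> real) set \<Rightarrow> ((nat \<Rightarrow> real) \<Rightarrow> real) \<Rightarrow> bool" where
  "cont_diff 0 m V f \<longleftrightarrow>
     continuous_map (subtopology (Euclidean_space m) V) euclideanreal f"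
| "cont_diff (Suc r) m V f \<longleftrightarrow>
     continuous_map (subtopology (Euclidean_space m) V) euclideanreal f \<and>
     (\<forall>i<m. \<exists>f'. (\<forall>x\<in>V. ((\<lambda>t. f (x(i := t))) has_real_derivative f' x) (at (x i)))
                 \<and> cont_diff r m V f')"

definition smooth_euclidean ::
  "nat \<Rightarrow> (nat \<Rightarrow> real) set \<Rightarrow> nat \<Rightarrow> (nat \<Rightarrow> real) set \<Rightarrow> ((nat \<Rightarrow> real) \<Rightarrow> (nat \<Rightarrow> real)) \<Rightarrow> bool"
  where "smooth_euclidean m V n U f \<longleftrightarrow>
     openin (Euclidean_space m) V \<and> openin (Euclidean_space n) U \<and> f \<in> V \<rightarrow> U \<and>
     (\<forall>j<n. \<forall>r. cont_diff r m V (\<lambda>x. f x j))"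

record 'a dspace =
  points :: "'a set"
  plots :: "nat \<Rightarrow> (nat \<Rightarrow> real) set \<Rightarrow> ((nat \<Rightarrow> real) \<Rightarrow> 'a) set"

text \<open>Plots are total functions of which only the values on the domain matter; the
  smooth compatibility axiom is phrased so that it includes invariance under changing
  a plot outside its domain.\<close>

definition diffeological_space :: "'a dspace \<Rightarrow> bool" where
  "diffeological_space X \<longleftrightarrow>
     (\<forall>n U p. p \<in> plots X n U \<longrightarrow> openin (Euclidean_space n) U \<and> p \<in> U \<rightarrow> points X) \<and>
     (\<forall>n U x. openin (Euclidean_space n) U \<and> x \<in> points X \<longrightarrow> (\<lambda>_. x) \<in> plots X n U) \<and>
     (\<forall>n U p. openin (Euclidean_space n) U \<and>
        (\<forall>u\<in>U. \<exists>V. openin (Euclidean_space n) V \<and> u \<in> V \<and> V \<subseteq> U \<and> p \<in> plots X n V)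
        \<longrightarrow> p \<in> plots X n U) \<and>
     (\<forall>n U p m V f p'. p \<in> plots X n U \<and> smooth_euclidean m V n U f \<and> (\<forall>v\<in>V. p' v = p (f v))
        \<longrightarrow> p' \<in> plots X m V)"

definition smooth_map :: "'a dspace \<Rightarrow> 'b dspace \<Rightarrow> ('a \<Rightarrow> 'b) \<Rightarrow> bool" where
  "smooth_map X Y f \<longleftrightarrow> f \<in> points X \<rightarrow> points Y \<and>
     (\<forall>n U p. p \<in> plots X n U \<longrightarrow> f \<circ> p \<in> plots Y n U)"

definition diffeomorphism :: "'a dspace \<Rightarrow> 'b dspace \<Rightarrow> ('a \<Rightarrow> 'b) \<Rightarrow> bool" where
  "diffeomorphism X Y f \<longleftrightarrow> bij_betw f (points X) (points Y) \<and>
     smooth_map X Y f \<and> smooth_map Y X (inv_into (points X) f)"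

definition D_open :: "'a dspace \<Rightarrow> 'a set \<Rightarrow> bool" where
  "D_open X S \<longleftrightarrow> S \<subseteq> points X \<and>
     (\<forall>n U p. p \<in> plots X n U \<longrightarrow> openin (Euclidean_space n) {u \<in> U. p u \<in> S})"

definition sub_space :: "'a dspace \<Rightarrow> 'a set \<Rightarrow> 'a dspace" where
  "sub_space X S = \<lparr>points = points X \<inter> S, plots = (\<lambda>n U. {p \<in> plots X n U. p \<in> U \<rightarrow> S})\<rparr>"

definition prod_space :: "'a dspace \<Rightarrow> 'b dspace \<Rightarrow> ('a \<times> 'b) dspace" where
  "prod_space X Y = \<lparr>points = points X \<times> points Y,
     plots = (\<lambda>n U. {p. fst \<circ> p \<in> plots X n U \<and> snd \<circ> p \<in> plots Y n U})\<rparr>"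

definition discrete_space :: "'a set \<Rightarrow> 'a dspace" where
  "discrete_space S = \<lparr>points = S,
     plots = (\<lambda>n U. {p. openin (Euclidean_space n) U \<and> p \<in> U \<rightarrow> S \<and>
       (\<forall>u\<in>U. \<exists>V. openin (Euclidean_space n) V \<and> u \<in> V \<and> V \<subseteq> U \<and> (\<forall>v\<in>V. p v = p u))})\<rparr>"

text \<open>The image of \<open>X\<close> under \<open>f\<close> with the quotient (pushforward) diffeology.\<close>

definition quotient_space :: "'a dspace \<Rightarrow> ('a \<Rightarrow> 'b) \<Rightarrow> 'b dspace" where
  "quotient_space X f = \<lparr>points = f ` points X,
     plots = (\<lambda>n U. {p. openin (Euclidean_space n) U \<and> p \<in> U \<rightarrow> f ` points X \<and>
       (\<forall>u\<in>U. \<exists>V. openin (Euclidean_space n) V \<and> u \<in> V \<and> V \<subseteq> U \<and>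
          (\<exists>r \<in> plots X n V. \<forall>v\<in>V. p v = f (r v)))})\<rparr>"

definition subduction :: "'a dspace \<Rightarrow> 'b dspace \<Rightarrow> ('a \<Rightarrow> 'b) \<Rightarrow> bool" where
  "subduction X Y f \<longleftrightarrow> quotient_space X f = Y"


section \<open>Diffeological groups and their extensions\<close>

record 'g dgroup = "'g monoid" +
  gplots :: "nat \<Rightarrow> (nat \<Rightarrow> real) set \<Rightarrow> ((nat \<Rightarrow> real) \<Rightarrow> 'g) set"

definition dsp :: "'g dgroup \<Rightarrow> 'g dspace" where
  "dsp G = \<lparr>points = carrier G, plots = gplots G\<rparr>"

definition diffeological_group :: "'g dgroup \<Rightarrow> bool" where
  "diffeological_group G \<longleftrightarrow> group G \<and> diffeological_space (dsp G) \<and>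
     smooth_map (prod_space (dsp G) (dsp G)) (dsp G) (\<lambda>(x, y). x \<otimes>\<^bsub>G\<^esub> y) \<and>
     smooth_map (dsp G) (dsp G) (\<lambda>x. inv\<^bsub>G\<^esub> x)"

text \<open>The kernel \<open>A\<close> is regarded as a subgroup of the middle group, with the subset diffeology.\<close>

definition central_extension :: "'k set \<Rightarrow> 'k dgroup \<Rightarrow> 'g dgroup \<Rightarrow> ('k \<Rightarrow> 'g) \<Rightarrow> bool" where
  "central_extension A Gh G q \<longleftrightarrow>
     diffeological_group Gh \<and> diffeological_group G \<and>
     q \<in> hom Gh G \<and> subduction (dsp Gh) (dsp G) q \<and> A = kernel Gh G q \<and>
     (\<forall>a\<in>A. \<forall>x\<in>carrier Gh. a \<otimes>\<^bsub>Gh\<^esub> x = x \<otimes>\<^bsub>Gh\<^esub> a)"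

definition Z2 :: "int set" where "Z2 = {1, -1}"

definition Z2_action :: "'g dgroup \<Rightarrow> (int \<Rightarrow> 'g \<Rightarrow> 'g) \<Rightarrow> bool" where
  "Z2_action G \<sigma> \<longleftrightarrow>
     (\<forall>e\<in>Z2. \<sigma> e \<in> iso G G \<and> diffeomorphism (dsp G) (dsp G) (\<sigma> e)) \<and>
     (\<forall>x\<in>carrier G. \<sigma> 1 x = x) \<and>
     (\<forall>e\<in>Z2. \<forall>e'\<in>Z2. \<forall>x\<in>carrier G. \<sigma> (e * e') x = \<sigma> e (\<sigma> e' x))"

definition semidirect :: "'g dgroup \<Rightarrow> (int \<Rightarrow> 'g \<Rightarrow> 'g) \<Rightarrow> ('g \<times> int) dgroup" where
  "semidirect G \<sigma> = \<lparr>carrier = carrier G \<times> Z2,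
     monoid.mult = (\<lambda>(x, e) (x', e'). (x \<otimes>\<^bsub>G\<^esub> \<sigma> e x', e * e')),
     one = (\<one>\<^bsub>G\<^esub>, 1),
     gplots = plots (prod_space (dsp G) (discrete_space Z2))\<rparr>"


section \<open>Principal bundles\<close>

record ('e, 'x, 'h) pbundle =
  total_space :: "'e dspace"
  proj :: "'e \<Rightarrow> 'x"
  act :: "'e \<Rightarrow> 'h \<Rightarrow> 'e"

abbreviation tot :: "('e, 'x, 'h) pbundle \<Rightarrow> 'e set" where
  "tot B \<equiv> points (total_space B)"

definition bundle_res :: "'x set \<Rightarrow> ('e, 'x, 'h) pbundle \<Rightarrow> ('e, 'x, 'h) pbundle" where
  "bundle_res V B = B\<lparr>total_space := sub_space (total_space B) (proj B -` V)\<rparr>"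

text \<open>Principal bundles carry right actions and are locally trivial for the D-topology.\<close>

definition principal_bundle :: "'h dgroup \<Rightarrow> 'x dspace \<Rightarrow> ('e, 'x, 'h) pbundle \<Rightarrow> bool" where
  "principal_bundle H X B \<longleftrightarrow>
     diffeological_space (total_space B) \<and>
     smooth_map (total_space B) X (proj B) \<and>
     smooth_map (prod_space (total_space B) (dsp H)) (total_space B) (\<lambda>(y, h). act B y h) \<and>
     (\<forall>y\<in>tot B. act B y \<one>\<^bsub>H\<^esub> = y) \<and>
     (\<forall>y\<in>tot B. \<forall>h\<in>carrier H. \<forall>h'\<in>carrier H.
        act B (act B y h) h' = act B y (h \<otimes>\<^bsub>H\<^esub> h')) \<and>
     (\<forall>y\<in>tot B. \<forall>h\<in>carrier H. proj B (act B y h) = proj B y) \<and>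
     (\<forall>x\<in>points X. \<exists>V \<Phi>. D_open X V \<and> x \<in> V \<and>
        diffeomorphism (prod_space (sub_space X V) (dsp H)) (total_space (bundle_res V B)) \<Phi> \<and>
        (\<forall>u\<in>V. \<forall>h\<in>carrier H. proj B (\<Phi> (u, h)) = u) \<and>
        (\<forall>u\<in>V. \<forall>h\<in>carrier H. \<forall>h'\<in>carrier H.
           \<Phi> (u, h \<otimes>\<^bsub>H\<^esub> h') = act B (\<Phi> (u, h)) h'))"

definition bundle_iso ::
  "'h dgroup \<Rightarrow> ('e, 'x, 'h) pbundle \<Rightarrow> ('f, 'x, 'h) pbundle \<Rightarrow> ('e \<Rightarrow> 'f) \<Rightarrow> bool" where
  "bundle_iso H B B' f \<longleftrightarrow>
     diffeomorphism (total_space B) (total_space B') f \<and>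
     (\<forall>y\<in>tot B. proj B' (f y) = proj B y) \<and>
     (\<forall>y\<in>tot B. \<forall>h\<in>carrier H. f (act B y h) = act B' (f y) h)"

definition orb :: "'h set \<Rightarrow> ('e, 'x, 'h) pbundle \<Rightarrow> 'e \<Rightarrow> 'e set" where
  "orb N B y = act B y ` N"

text \<open>For a surjective homomorphism \<open>r\<close> with domain \<open>Hh\<close> and kernel \<open>N\<close>: the quotient of an
  \<open>Hh\<close>-bundle by \<open>N\<close>, with the quotient diffeology and the induced action of the image group.\<close>

definition bundle_quot ::
  "'k set \<Rightarrow> 'k dgroup \<Rightarrow> ('k \<Rightarrow> 'h) \<Rightarrow> ('e, 'x, 'k) pbundle \<Rightarrow> ('e set, 'x, 'h) pbundle" where
  "bundle_quot N Hh r B = \<lparr>total_space = quotient_space (total_space B) (orb N B),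
     proj = (\<lambda>Y. the_elem (proj B ` Y)),
     act = (\<lambda>Y h. {act B y k | y k. y \<in> Y \<and> k \<in> carrier Hh \<and> r k = h})\<rparr>"

definition open_cover :: "'x dspace \<Rightarrow> 'i set \<Rightarrow> ('i \<Rightarrow> 'x set) \<Rightarrow> bool" where
  "open_cover X I U \<longleftrightarrow> (\<forall>i\<in>I. D_open X (U i)) \<and> (\<Union>i\<in>I. U i) = points X"

text \<open>\<open>h\<close> is the family of transition functions of \<open>P\<close> with respect to local sections \<open>s i\<close>.
  With right actions, the convention \<open>h i j * h j k = h i k\<close> amounts to \<open>s j = s i * h i j\<close>.\<close>

definition transition_functions ::
  "'h dgroup \<Rightarrow> 'x dspace \<Rightarrow> ('p, 'x, 'h) pbundle \<Rightarrow> 'i set \<Rightarrow> ('i \<Rightarrow> 'x set) \<Rightarrow>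
   ('i \<Rightarrow> 'x \<Rightarrow> 'p) \<Rightarrow> ('i \<Rightarrow> 'i \<Rightarrow> 'x \<Rightarrow> 'h) \<Rightarrow> bool" where
  "transition_functions H X P I U s h \<longleftrightarrow>
     (\<forall>i\<in>I. smooth_map (sub_space X (U i)) (total_space P) (s i) \<and>
             (\<forall>u\<in>U i. proj P (s i u) = u)) \<and>
     (\<forall>i\<in>I. \<forall>j\<in>I. smooth_map (sub_space X (U i \<inter> U j)) (dsp H) (h i j) \<and>
             (\<forall>u\<in>U i \<inter> U j. s j u = act P (s i u) (h i j u)))"


section \<open>Cech cohomology in degree 2\<close>

text \<open>A presheaf of abelian groups; \<open>sec_res V\<close> restricts sections to \<open>V\<close>.\<close>

record ('x, 's) ab_presheaf =
  sections :: "'x set \<Rightarrow> 's monoid"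
  sec_res :: "'x set \<Rightarrow> 's \<Rightarrow> 's"

definition cech_cocycle ::
  "('x, 's) ab_presheaf \<Rightarrow> 'i set \<Rightarrow> ('i \<Rightarrow> 'x set) \<Rightarrow> ('i \<Rightarrow> 'i \<Rightarrow> 'i \<Rightarrow> 's) \<Rightarrow> bool" where
  "cech_cocycle F I U c \<longleftrightarrow>
     (\<forall>i\<in>I. \<forall>j\<in>I. \<forall>k\<in>I. c i j k \<in> carrier (sections F (U i \<inter> U j \<inter> U k))) \<and>
     (\<forall>i\<in>I. \<forall>j\<in>I. \<forall>k\<in>I. \<forall>l\<in>I. let W = U i \<inter> U j \<inter> U k \<inter> U l in
        sec_res F W (c i j k) \<otimes>\<^bsub>sections F W\<^esub> sec_res F W (c i k l)
        = sec_res F W (c j k l) \<otimes>\<^bsub>sections F W\<^esub> sec_res F W (c i j l))"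

definition cohomologous ::
  "('x, 's) ab_presheaf \<Rightarrow> 'i set \<Rightarrow> ('i \<Rightarrow> 'x set) \<Rightarrow>
   ('i \<Rightarrow> 'i \<Rightarrow> 'i \<Rightarrow> 's) \<Rightarrow> ('i \<Rightarrow> 'i \<Rightarrow> 'i \<Rightarrow> 's) \<Rightarrow> bool" where
  "cohomologous F I U c d \<longleftrightarrow>
     (\<exists>b. (\<forall>i\<in>I. \<forall>j\<in>I. b i j \<in> carrier (sections F (U i \<inter> U j))) \<and>
       (\<forall>i\<in>I. \<forall>j\<in>I. \<forall>k\<in>I. let W = U i \<inter> U j \<inter> U k in
          c i j k = d i j k \<otimes>\<^bsub>sections F W\<^esub>
            (sec_res F W (b i j) \<otimes>\<^bsub>sections F W\<^esub> sec_res F W (b j k)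
             \<otimes>\<^bsub>sections F W\<^esub> inv\<^bsub>sections F W\<^esub> (sec_res F W (b i k)))))"

definition cech_pull ::
  "('x, 's) ab_presheaf \<Rightarrow> ('k \<Rightarrow> 'x set) \<Rightarrow> ('k \<Rightarrow> 'i) \<Rightarrow>
   ('i \<Rightarrow> 'i \<Rightarrow> 'i \<Rightarrow> 's) \<Rightarrow> 'k \<Rightarrow> 'k \<Rightarrow> 'k \<Rightarrow> 's" where
  "cech_pull F W r c = (\<lambda>k l m. sec_res F (W k \<inter> W l \<inter> W m) (c (r k) (r l) (r m)))"

text \<open>\<open>H^2(X; F)\<close> is the colimit of Cech cohomology over all open covers. Every open cover is
  refined by one indexed by points of \<open>X\<close>, so covers indexed by sets of points suffice
  to form the colimit; cocycles on covers with any other index type still have a class.\<close>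

definition cech_equiv ::
  "'x dspace \<Rightarrow> ('x, 's) ab_presheaf \<Rightarrow>
   'i set \<Rightarrow> ('i \<Rightarrow> 'x set) \<Rightarrow> ('i \<Rightarrow> 'i \<Rightarrow> 'i \<Rightarrow> 's) \<Rightarrow>
   'j set \<Rightarrow> ('j \<Rightarrow> 'x set) \<Rightarrow> ('j \<Rightarrow> 'j \<Rightarrow> 'j \<Rightarrow> 's) \<Rightarrow> bool" where
  "cech_equiv X F I U c J V d \<longleftrightarrow>
     (\<exists>(K :: 'x set) W r r'. open_cover X K W \<and>
        r \<in> K \<rightarrow> I \<and> (\<forall>k\<in>K. W k \<subseteq> U (r k)) \<and> r' \<in> K \<rightarrow> J \<and> (\<forall>k\<in>K. W k \<subseteq> V (r' k)) \<and>
        cohomologous F K W (cech_pull F W r c) (cech_pull F W r' d))"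

type_synonym ('x, 's) cech_rep = "'x set \<times> ('x \<Rightarrow> 'x set) \<times> ('x \<Rightarrow> 'x \<Rightarrow> 'x \<Rightarrow> 's)"

definition cech_class ::
  "'x dspace \<Rightarrow> ('x, 's) ab_presheaf \<Rightarrow> 'i set \<Rightarrow> ('i \<Rightarrow> 'x set) \<Rightarrow>
   ('i \<Rightarrow> 'i \<Rightarrow> 'i \<Rightarrow> 's) \<Rightarrow> ('x, 's) cech_rep set" where
  "cech_class X F I U c = {(K, W, d).
     open_cover X K W \<and> cech_cocycle F K W d \<and> cech_equiv X F I U c K W d}"

definition cech_H2 :: "'x dspace \<Rightarrow> ('x, 's) ab_presheaf \<Rightarrow> ('x, 's) cech_rep set set" where
  "cech_H2 X F = {cech_class X F K W d | (K :: 'x set) W d.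
     open_cover X K W \<and> cech_cocycle F K W d}"


section \<open>The local system\<close>

text \<open>Gluing the sheaves of smooth \<open>A\<close>-valued functions on the \<open>U i\<close>: a section over \<open>V\<close> is a
  family of smooth functions \<open>t i\<close> on \<open>V \<inter> U i\<close> with \<open>t i = \<sigma>\<^sup>\<epsilon> (t j)\<close> on overlaps, where
  \<open>\<epsilon> = \<epsilon> i j\<close> is the Z2-valued cocycle representing \<open>\<alpha>\<close>.\<close>

definition local_system ::
  "'x dspace \<Rightarrow> 'k dgroup \<Rightarrow> 'k set \<Rightarrow> (int \<Rightarrow> 'k \<Rightarrow> 'k) \<Rightarrow> 'i set \<Rightarrow> ('i \<Rightarrow> 'x set) \<Rightarrow>
   ('i \<Rightarrow> 'i \<Rightarrow> 'x \<Rightarrow> int) \<Rightarrow> ('x, 'i \<Rightarrow> 'x \<Rightarrow> 'k) ab_presheaf" where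
  "local_system X Gh A \<sigma> I U \<epsilon> = \<lparr>
     sections = (\<lambda>V. \<lparr>
       carrier = {t \<in> (\<Pi>\<^sub>E i\<in>I. (V \<inter> U i) \<rightarrow>\<^sub>E A).
          (\<forall>i\<in>I. smooth_map (sub_space X (V \<inter> U i)) (sub_space (dsp Gh) A) (t i)) \<and>
          (\<forall>i\<in>I. \<forall>j\<in>I. \<forall>u\<in>V \<inter> U i \<inter> U j. t i u = \<sigma> (\<epsilon> i j u) (t j u))},
       monoid.mult = (\<lambda>t t'. \<lambda>i\<in>I. \<lambda>u\<in>V \<inter> U i. t i u \<otimes>\<^bsub>Gh\<^esub> t' i u),
       one = (\<lambda>i\<in>I. \<lambda>u\<in>V \<inter> U i. \<one>\<^bsub>Gh\<^esub>)\<rparr>),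
     sec_res = (\<lambda>V t. \<lambda>i\<in>I. \<lambda>u\<in>V \<inter> U i. t i u)\<rparr>"

text \<open>The section over \<open>W \<subseteq> U i\<close> whose expression in the frame \<open>i\<close> is \<open>f\<close>.\<close>

definition from_frame ::
  "(int \<Rightarrow> 'k \<Rightarrow> 'k) \<Rightarrow> 'i set \<Rightarrow> ('i \<Rightarrow> 'x set) \<Rightarrow> ('i \<Rightarrow> 'i \<Rightarrow> 'x \<Rightarrow> int) \<Rightarrow>
   'i \<Rightarrow> 'x set \<Rightarrow> ('x \<Rightarrow> 'k) \<Rightarrow> 'i \<Rightarrow> 'x \<Rightarrow> 'k" where
  "from_frame \<sigma> I U \<epsilon> i W f = (\<lambda>j\<in>I. \<lambda>u\<in>W \<inter> U j. \<sigma> (\<epsilon> j i u) (f u))"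

definition twisted_cocycle ::
  "'x dspace \<Rightarrow> 'k dgroup \<Rightarrow> 'k set \<Rightarrow> (int \<Rightarrow> 'k \<Rightarrow> 'k) \<Rightarrow> 'i set \<Rightarrow> ('i \<Rightarrow> 'x set) \<Rightarrow>
   ('i \<Rightarrow> 'i \<Rightarrow> 'x \<Rightarrow> int) \<Rightarrow> ('i \<Rightarrow> 'i \<Rightarrow> 'i \<Rightarrow> 'x \<Rightarrow> 'k) \<Rightarrow> bool" where
  "twisted_cocycle X Gh A \<sigma> I U \<epsilon> a \<longleftrightarrow>
     (\<forall>i\<in>I. \<forall>j\<in>I. \<forall>k\<in>I.
        smooth_map (sub_space X (U i \<inter> U j \<inter> U k)) (sub_space (dsp Gh) A) (a i j k)) \<and>
     (\<forall>i\<in>I. \<forall>j\<in>I. \<forall>k\<in>I. \<forall>l\<in>I. \<forall>u\<in>U i \<inter> U j \<inter> U k \<inter> U l.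
        a i j k u \<otimes>\<^bsub>Gh\<^esub> a i k l u = \<sigma> (\<epsilon> i j u) (a j k l u) \<otimes>\<^bsub>Gh\<^esub> a i j l u)"

definition twisted_class ::
  "'x dspace \<Rightarrow> 'k dgroup \<Rightarrow> 'k set \<Rightarrow> (int \<Rightarrow> 'k \<Rightarrow> 'k) \<Rightarrow> 'i set \<Rightarrow> ('i \<Rightarrow> 'x set) \<Rightarrow>
   ('i \<Rightarrow> 'i \<Rightarrow> 'x \<Rightarrow> int) \<Rightarrow> ('i \<Rightarrow> 'i \<Rightarrow> 'i \<Rightarrow> 'x \<Rightarrow> 'k) \<Rightarrow>
   ('x, 'i \<Rightarrow> 'x \<Rightarrow> 'k) cech_rep set" where
  "twisted_class X Gh A \<sigma> I U \<epsilon> a = cech_class X (local_system X Gh A \<sigma> I U \<epsilon>) I U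
     (\<lambda>i j k. from_frame \<sigma> I U \<epsilon> i (U i \<inter> U j \<inter> U k) (a i j k))"


section \<open>Banded gerbes and their class\<close>

text \<open>Groupoids over the open sets with strict restriction functors, together with the maps
  from sections of the band to automorphisms. \<open>compose_mors U x y z g f\<close> is \<open>g\<close> after \<open>f\<close> for
  \<open>f : x \<rightarrow> y\<close> and \<open>g : y \<rightarrow> z\<close> over \<open>U\<close>, and \<open>mor_res V x y f\<close> restricts \<open>f : x \<rightarrow> y\<close> to \<open>V\<close>.\<close>

record ('x, 'o, 'm, 's) banded_stack =
  objs :: "'x set \<Rightarrow> 'o set"
  mors :: "'x set \<Rightarrow> 'o \<Rightarrow> 'o \<Rightarrow> 'm set"
  ident :: "'x set \<Rightarrow> 'o \<Rightarrow> 'm"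
  compose_mors :: "'x set \<Rightarrow> 'o \<Rightarrow> 'o \<Rightarrow> 'o \<Rightarrow> 'm \<Rightarrow> 'm \<Rightarrow> 'm"
  obj_res :: "'x set \<Rightarrow> 'o \<Rightarrow> 'o"
  mor_res :: "'x set \<Rightarrow> 'o \<Rightarrow> 'o \<Rightarrow> 'm \<Rightarrow> 'm"
  band :: "'x set \<Rightarrow> 'o \<Rightarrow> 's \<Rightarrow> 'm"

definition gerbe_data ::
  "'x dspace \<Rightarrow> ('x, 'o, 'm, 's) banded_stack \<Rightarrow> 'k set \<Rightarrow> ('k \<Rightarrow> 'x set) \<Rightarrow>
   ('k \<Rightarrow> 'o) \<Rightarrow> ('k \<Rightarrow> 'k \<Rightarrow> 'm) \<Rightarrow> bool" where
  "gerbe_data X \<G> K V x \<phi> \<longleftrightarrow> open_cover X K V \<and>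
     (\<forall>k\<in>K. x k \<in> objs \<G> (V k)) \<and>
     (\<forall>k\<in>K. \<forall>l\<in>K. \<phi> k l \<in>
        mors \<G> (V k \<inter> V l) (obj_res \<G> (V k \<inter> V l) (x l)) (obj_res \<G> (V k \<inter> V l) (x k)))"

text \<open>The section \<open>t\<close> of the band over \<open>V k \<inter> V l \<inter> V m\<close>, seen as an automorphism of \<open>x k\<close>, with
  \<open>\<phi> k l \<circ> \<phi> l m = t \<circ> \<phi> k m\<close>.\<close>

definition gerbe_defect ::
  "('x, 's) ab_presheaf \<Rightarrow> ('x, 'o, 'm, 's) banded_stack \<Rightarrow> ('k \<Rightarrow> 'x set) \<Rightarrow>
   ('k \<Rightarrow> 'o) \<Rightarrow> ('k \<Rightarrow> 'k \<Rightarrow> 'm) \<Rightarrow> 'k \<Rightarrow> 'k \<Rightarrow> 'k \<Rightarrow> 's" where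
  "gerbe_defect F \<G> V x \<phi> k l m =
    (let W = V k \<inter> V l \<inter> V m;
         y = (\<lambda>k. obj_res \<G> W (x k));
         \<psi> = (\<lambda>k l. mor_res \<G> W (obj_res \<G> (V k \<inter> V l) (x l))
                                  (obj_res \<G> (V k \<inter> V l) (x k)) (\<phi> k l))
     in THE t. t \<in> carrier (sections F W) \<and>
          compose_mors \<G> W (y m) (y l) (y k) (\<psi> k l) (\<psi> l m)
          = compose_mors \<G> W (y m) (y k) (y k) (band \<G> W (y k) t) (\<psi> k m))"

text \<open>All classes obtained from choices of local objects and isomorphisms; the class of a gerbe
  is well defined when this set is a singleton. As above, covers indexed by sets of points
  suffice.\<close>

definition gerbe_classes ::
  "'x dspace \<Rightarrow> ('x, 's) ab_presheaf \<Rightarrow> ('x, 'o, 'm, 's) banded_stack \<Rightarrow>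
   ('x, 's) cech_rep set set" where
  "gerbe_classes X F \<G> = {cech_class X F K V (gerbe_defect F \<G> V x \<phi>) | (K :: 'x set) V x \<phi>.
     gerbe_data X \<G> K V x \<phi>}"


section \<open>The lifting gerbe\<close>

text \<open>Objects over \<open>U\<close> are pairs \<open>(B, \<kappa>)\<close> of a principal bundle \<open>B\<close> for the extended group and an
  isomorphism \<open>\<kappa>\<close> from its quotient by \<open>A\<close> to the restriction of \<open>P\<close>. Total spaces of objects are
  sets in the type \<open>'e\<close>.\<close>

type_synonym ('e, 'x, 'k, 'p) lift_obj =
  "('e, 'x, 'k \<times> int) pbundle \<times> ('e set \<Rightarrow> 'p)"

definition lift_objs ::
  "'x dspace \<Rightarrow> 'k set \<Rightarrow> ('k \<times> int) dgroup \<Rightarrow> ('g \<times> int) dgroup \<Rightarrow> ('k \<Rightarrow> 'g) \<Rightarrow>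
   ('p, 'x, 'g \<times> int) pbundle \<Rightarrow> 'x set \<Rightarrow> ('e, 'x, 'k, 'p) lift_obj set" where
  "lift_objs X A Hh H q P U = {(B, \<kappa>). D_open X U \<and>
     principal_bundle Hh (sub_space X U) B \<and>
     bundle_iso H (bundle_quot (A \<times> {1}) Hh (map_prod q id) B) (bundle_res U P) \<kappa>}"

definition lift_mors ::
  "'k set \<Rightarrow> ('k \<times> int) dgroup \<Rightarrow> ('e, 'x, 'k, 'p) lift_obj \<Rightarrow> ('e, 'x, 'k, 'p) lift_obj \<Rightarrow>
   ('e \<Rightarrow> 'e) set" where
  "lift_mors A Hh = (\<lambda>(B, \<kappa>) (B', \<kappa>'). {f \<in> extensional (tot B).
     bundle_iso Hh B B' f \<and>
     (\<forall>y\<in>tot B. \<kappa>' (orb (A \<times> {1}) B' (f y)) = \<kappa> (orb (A \<times> {1}) B y))})"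

text \<open>The band: a section \<open>t\<close> of the local system acts on \<open>(B, \<kappa>)\<close> as the automorphism which is right
  multiplication by \<open>t i\<close> on the points of \<open>B\<close> lying over the local section \<open>s i\<close> of \<open>P\<close>.\<close>

definition lift_band ::
  "'k set \<Rightarrow> ('k \<times> int) dgroup \<Rightarrow> 'i set \<Rightarrow> ('i \<Rightarrow> 'x set) \<Rightarrow> ('i \<Rightarrow> 'x \<Rightarrow> 'p) \<Rightarrow>
   ('e, 'x, 'k, 'p) lift_obj \<Rightarrow> ('i \<Rightarrow> 'x \<Rightarrow> 'k) \<Rightarrow> 'e \<Rightarrow> 'e" where
  "lift_band A Hh I U s = (\<lambda>(B, \<kappa>) t. THE f. f \<in> lift_mors A Hh (B, \<kappa>) (B, \<kappa>) \<and>
     (\<forall>i\<in>I. \<forall>y\<in>tot B. proj B y \<in> U i \<and> \<kappa> (orb (A \<times> {1}) B y) = s i (proj B y)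
        \<longrightarrow> f y = act B y (t i (proj B y), 1)))"

definition lifting_gerbe ::
  "'x dspace \<Rightarrow> 'k set \<Rightarrow> ('k \<times> int) dgroup \<Rightarrow> ('g \<times> int) dgroup \<Rightarrow> ('k \<Rightarrow> 'g) \<Rightarrow>
   ('p, 'x, 'g \<times> int) pbundle \<Rightarrow> 'i set \<Rightarrow> ('i \<Rightarrow> 'x set) \<Rightarrow> ('i \<Rightarrow> 'x \<Rightarrow> 'p) \<Rightarrow>
   ('x, ('e, 'x, 'k, 'p) lift_obj, 'e \<Rightarrow> 'e, 'i \<Rightarrow> 'x \<Rightarrow> 'k) banded_stack" where
  "lifting_gerbe X A Hh H q P I U s = \<lparr>
     objs = lift_objs X A Hh H q P,
     mors = (\<lambda>V x y. lift_mors A Hh x y),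
     ident = (\<lambda>V x. \<lambda>y\<in>tot (fst x). y),
     compose_mors = (\<lambda>V x y z g f. compose (tot (fst x)) g f),
     obj_res = (\<lambda>V (B, \<kappa>). (bundle_res V B, \<kappa>)),
     mor_res = (\<lambda>V x y f. restrict f (tot (bundle_res V (fst x)))),
     band = (\<lambda>V x t. lift_band A Hh I U s x t)\<rparr>"

text \<open>Smooth maps from open subsets of \<open>X\<close> to the quotient group locally have smooth lifts.
  This holds precisely when any two objects of the lifting gerbe are locally isomorphic.\<close>

definition smooth_lifts_exist :: "'x dspace \<Rightarrow> 'k dgroup \<Rightarrow> 'g dgroup \<Rightarrow> ('k \<Rightarrow> 'g) \<Rightarrow> bool" where
  "smooth_lifts_exist X Gh G q \<longleftrightarrow>
     (\<forall>W f. D_open X W \<and> smooth_map (sub_space X W) (dsp G) f \<longrightarrow>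
        (\<forall>x\<in>W. \<exists>W' f'. D_open X W' \<and> x \<in> W' \<and> W' \<subseteq> W \<and>
           smooth_map (sub_space X W') (dsp Gh) f' \<and> (\<forall>u\<in>W'. q (f' u) = f u)))"

end

theory Submission
  imports Defs
begin

text \<open>The class of a gerbe is computed from local objects and isomorphisms \<open>\<phi> k l\<close> between them. The
  proof turns such a choice into functions with values in the extended group \<open>Hh\<close> and compares
  these with the given lifts of the transition functions of \<open>P\<close>.

  The pairs \<open>hh i j = (gh i j, \<epsilon> i j)\<close> are lifts to \<open>Hh\<close> of the transition functions. The subgroup \<open>A\<close>
  of \<open>Hh\<close> is normal but not central: moving \<open>c\<close> past \<open>k\<close> applies the \<open>Z2\<close>-component of \<open>k\<close> to it
  (\<open>twisted_central\<close>). Since \<open>hh i j * hh j k = a i j k * hh i k\<close>, associativity in \<open>Hh\<close> gives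
  the twisted cocycle identity (\<open>a_cocycle\<close>).

  Now suppose that local sections \<open>e p\<close> of the chosen objects are given which lie over the frames
  \<open>s i\<close> of \<open>P\<close>. Then \<open>\<phi> (e r) = e p * lam p r\<close> for functions \<open>lam p r\<close> into \<open>Hh\<close>, and these are a
  second lift of the same transition functions. By definition of the defect of the \<open>\<phi> k l\<close>, the
  functions \<open>lam\<close> fail to be a cocycle precisely by that defect (\<open>lam_cocycle_defect\<close>). Two lifts
  of one function differ by an \<open>A\<close>-valued function \<open>b\<close>, so \<open>a\<close> is the defect times the coboundary
  of \<open>b\<close>, with the twist produced by moving \<open>b\<close> past \<open>lam\<close> (\<open>a_b_defect\<close>).

  It remains to find the sections \<open>e p\<close>. For an arbitrary choice of local objects, local sections
  exist by local triviality, and smooth lifts from \<open>G\<close> to \<open>Gh\<close> move them over the frames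
  (\<open>local_frame_lift\<close>). Hence all choices give the class of \<open>a\<close>. Independently of that, the trivial
  bundles over the \<open>U i\<close> glued by left multiplication with \<open>hh i j\<close> are a choice of local objects with
  evident sections, so the class of \<open>a\<close> does occur (\<open>class_in_gerbe_classes\<close>).

  Two points need preparation. The defect is a section of the local system because two maps over
  \<open>P\<close> into one object differ by a unique such section (\<open>lift_map_difference\<close>), and this section
  acts as a smooth automorphism (\<open>band_map_mor\<close>). The comparison takes place on a refinement of
  two covers, so classes agree only because the refinement maps do not matter up to coboundaries
  (\<open>cohomologous_refinements\<close>).\<close>

section \<open>Plots\<close>

text \<open>Constants and coordinates have derivatives of all orders, so inclusions of domains are smooth; this
  is what allows plots to be restricted.\<close>

lemma cont_diff_const: "cont_diff r m V (\<lambda>_. c)"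
proof (induction r arbitrary: c)
  case (Suc r)
  have "\<exists>f'. (\<forall>x\<in>V. ((\<lambda>t. c) has_real_derivative f' x) (at (x i))) \<and> cont_diff r m V f'" for i
    by (rule exI[of _ "\<lambda>_. 0"]) (auto simp: Suc.IH)
  then show ?case by simp
qed simp

lemma cont_diff_coordinate: "cont_diff r m V (\<lambda>x. x j)"
proof -
  have cont: "continuous_map (subtopology (Euclidean_space m) V) euclideanreal (\<lambda>x. x j)"
    unfolding Euclidean_space_def
    by (intro continuous_map_from_subtopology continuous_map_product_projection) auto
  have "((\<lambda>t. (x(i := t)) j) has_real_derivative (if i = j then 1 else 0)) (at (x i))"
    for x :: "nat \<Rightarrow> real" and i
    by (auto intro!: derivative_eq_intros)
  moreover have "cont_diff k m V (\<lambda>_. if i = j then 1 else 0)" for k i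
    by (rule cont_diff_const)
  ultimately have "\<exists>f'. (\<forall>x\<in>V. ((\<lambda>t. (x(i := t)) j) has_real_derivative f' x) (at (x i)))
      \<and> cont_diff k m V f'" for k i
    by (intro exI[of _ "\<lambda>_. if i = j then 1 else 0"]) auto
  then show ?thesis
    using cont by (cases r) (simp_all only: cont_diff.simps, blast)
qed

lemma smooth_euclidean_inclusion:
  assumes "openin (Euclidean_space n) V" "openin (Euclidean_space n) U" "V \<subseteq> U"
  shows "smooth_euclidean n V n U (\<lambda>x. x)"
  using assms by (auto simp: smooth_euclidean_def cont_diff_coordinate)

lemma smooth_euclidean_preimage_open:
  assumes "smooth_euclidean m V n U f" and W: "openin (Euclidean_space n) W"
  shows "openin (Euclidean_space m) {v \<in> V. f v \<in> W}"
proof -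
  have V: "openin (Euclidean_space m) V" and U: "openin (Euclidean_space n) U" and f: "f \<in> V \<rightarrow> U"
    and c: "\<And>j. j < n \<Longrightarrow> cont_diff 0 m V (\<lambda>x. f x j)"
    using assms(1) by (simp_all only: smooth_euclidean_def)
  let ?T = "subtopology (Euclidean_space m) V"
  have ts: "topspace ?T = V"
    using openin_subset[OF V] by auto
  have "continuous_map ?T (Euclidean_space n) (\<lambda>x i. if i < n then f x i else 0)"
    using c by (simp add: continuous_map_componentwise_Euclidean_space)
  moreover have "(\<lambda>i. if i < n then f x i else 0) = f x" if "x \<in> V" for x
  proof -
    have "f x \<in> topspace (Euclidean_space n)"
      using f that openin_subset[OF U] by auto
    then show ?thesis
      by (auto simp: topspace_Euclidean_space fun_eq_iff not_less)
  qed
  ultimately have "continuous_map ?T (Euclidean_space n) f"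
    using ts by (metis (no_types, lifting) continuous_map_eq)
  then have "openin ?T {v \<in> topspace ?T. f v \<in> W}"
    using W by (rule openin_continuous_map_preimage)
  then show ?thesis
    unfolding ts by (simp add: openin_open_subtopology[OF V])
qed

lemma plot_openin:
  assumes "diffeological_space X" "p \<in> plots X n U" shows "openin (Euclidean_space n) U"
  using assms(1)[unfolded diffeological_space_def, THEN conjunct1, rule_format, OF assms(2)] by simp

lemma plot_in_points:
  assumes "diffeological_space X" "p \<in> plots X n U" "u \<in> U" shows "p u \<in> points X"
  using assms(1)[unfolded diffeological_space_def, THEN conjunct1, rule_format, OF assms(2)] assms(3)
  by auto

lemma plot_const:
  assumes "diffeological_space X" "openin (Euclidean_space n) U" "x \<in> points X"
  shows "(\<lambda>_. x) \<in> plots X n U"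
  using assms(1)[unfolded diffeological_space_def, THEN conjunct2, THEN conjunct1] assms(2,3) by simp

lemma plot_compose:
  assumes "diffeological_space X" "p \<in> plots X n U" "smooth_euclidean m V n U f"
    and "\<And>v. v \<in> V \<Longrightarrow> p' v = p (f v)"
  shows "p' \<in> plots X m V"
  using assms(1)[unfolded diffeological_space_def, THEN conjunct2, THEN conjunct2, THEN conjunct2,
      rule_format, of p n U m V f p'] assms(2-4) by simp

lemma plot_locally_plot:
  assumes "diffeological_space X" "openin (Euclidean_space n) U"
    and "\<forall>u\<in>U. \<exists>V. openin (Euclidean_space n) V \<and> u \<in> V \<and> V \<subseteq> U \<and> p \<in> plots X n V"
  shows "p \<in> plots X n U"
  using assms(1)[unfolded diffeological_space_def, THEN conjunct2, THEN conjunct2, THEN conjunct1,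
      THEN spec, THEN spec, THEN spec, THEN mp, OF conjI, OF assms(2,3)] .

lemma plot_restrict:
  assumes X: "diffeological_space X" and p: "p \<in> plots X n U"
    and V: "openin (Euclidean_space n) V" "V \<subseteq> U" and eq: "\<And>v. v \<in> V \<Longrightarrow> p' v = p v"
  shows "p' \<in> plots X n V"
  using plot_compose[OF X p smooth_euclidean_inclusion[OF V(1) plot_openin[OF X p] V(2)]] eq
  by auto

lemma plot_cong:
  assumes X: "diffeological_space X" and p: "p \<in> plots X n U"
    and eq: "\<And>v. v \<in> U \<Longrightarrow> p' v = p v"
  shows "p' \<in> plots X n U"
  using plot_restrict[OF X p plot_openin[OF X p] order_refl] eq by auto

text \<open>Smoothness is local. Throughout, a map is shown to be a plot by exhibiting, near each point of
  the domain, a plot \<open>r\<close> that agrees with it.\<close>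

lemma plot_local:
  assumes X: "diffeological_space X" and U: "openin (Euclidean_space n) U"
    and loc: "\<And>u. u \<in> U \<Longrightarrow> \<exists>V r. openin (Euclidean_space n) V \<and> u \<in> V \<and> V \<subseteq> U \<and>
      r \<in> plots X n V \<and> (\<forall>v\<in>V. p v = r v)"
  shows "p \<in> plots X n U"
proof -
  have "\<forall>u\<in>U. \<exists>V. openin (Euclidean_space n) V \<and> u \<in> V \<and> V \<subseteq> U \<and> p \<in> plots X n V"
    using loc plot_cong[OF X] by meson
  then show ?thesis
    using plot_locally_plot[OF X U] by blast
qed

lemma diffeological_spaceI:
  assumes "\<And>n U p. p \<in> plots X n U \<Longrightarrow> openin (Euclidean_space n) U"
    and "\<And>n U p u. \<lbrakk>p \<in> plots X n U; u \<in> U\<rbrakk> \<Longrightarrow> p u \<in> points X"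
    and "\<And>n U x. \<lbrakk>openin (Euclidean_space n) U; x \<in> points X\<rbrakk> \<Longrightarrow> (\<lambda>_. x) \<in> plots X n U"
    and "\<And>n U p. \<lbrakk>openin (Euclidean_space n) U;
        \<forall>u\<in>U. \<exists>V. openin (Euclidean_space n) V \<and> u \<in> V \<and> V \<subseteq> U \<and> p \<in> plots X n V\<rbrakk>
        \<Longrightarrow> p \<in> plots X n U"
    and "\<And>n U p m V f p'. \<lbrakk>p \<in> plots X n U; smooth_euclidean m V n U f; \<forall>v\<in>V. p' v = p (f v)\<rbrakk>
        \<Longrightarrow> p' \<in> plots X m V"
  shows "diffeological_space X"
  unfolding diffeological_space_def
proof (intro conjI allI impI funcsetI)
  fix n U p assume "p \<in> plots X n U" then show "openin (Euclidean_space n) U" by (rule assms(1))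
next
  fix n U p u assume "p \<in> plots X n U" "u \<in> U" then show "p u \<in> points X" by (rule assms(2))
next
  fix n U and x assume "openin (Euclidean_space n) U \<and> x \<in> points X"
  then show "(\<lambda>_. x) \<in> plots X n U" by (auto intro: assms(3))
next
  fix n U p assume "openin (Euclidean_space n) U \<and>
    (\<forall>u\<in>U. \<exists>V. openin (Euclidean_space n) V \<and> u \<in> V \<and> V \<subseteq> U \<and> p \<in> plots X n V)"
  then show "p \<in> plots X n U" by (elim conjE) (rule assms(4))
next
  fix n U p m V f p' assume "p \<in> plots X n U \<and> smooth_euclidean m V n U f \<and> (\<forall>v\<in>V. p' v = p (f v))"
  then show "p' \<in> plots X m V" by (elim conjE) (rule assms(5))
qed

lemma smooth_euclideanD:
  assumes "smooth_euclidean m V n U f"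
  shows "openin (Euclidean_space m) V" "openin (Euclidean_space n) U" "\<And>v. v \<in> V \<Longrightarrow> f v \<in> U"
  using assms by (auto simp: smooth_euclidean_def)

lemma diffeological_sub_space:
  assumes X: "diffeological_space X" shows "diffeological_space (sub_space X S)"
proof (rule diffeological_spaceI)
  fix n U p
  assume U: "openin (Euclidean_space n) U" and
    loc: "\<forall>u\<in>U. \<exists>V. openin (Euclidean_space n) V \<and> u \<in> V \<and> V \<subseteq> U \<and> p \<in> plots (sub_space X S) n V"
  have "p \<in> plots X n V" if "p \<in> plots (sub_space X S) n V" for V
    using that by (simp add: sub_space_def)
  then have "p \<in> plots X n U"
    using loc by (intro plot_locally_plot[OF X U]) meson
  moreover have "p \<in> U \<rightarrow> S"
    using loc by (auto simp: sub_space_def)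
  ultimately show "p \<in> plots (sub_space X S) n U"
    by (simp add: sub_space_def)
next
  fix n U p m V f p'
  assume p: "p \<in> plots (sub_space X S) n U" and f: "smooth_euclidean m V n U f"
    and eq: "\<forall>v\<in>V. p' v = p (f v)"
  then show "p' \<in> plots (sub_space X S) m V"
    using plot_compose[OF X _ f] smooth_euclideanD[OF f] by (auto simp: sub_space_def)
qed (use plot_openin[OF X] plot_in_points[OF X] plot_const[OF X] in \<open>auto simp: sub_space_def\<close>)

lemma diffeological_prod_space:
  assumes X: "diffeological_space X" and Y: "diffeological_space Y"
  shows "diffeological_space (prod_space X Y)"
proof (rule diffeological_spaceI)
  fix n U p
  assume U: "openin (Euclidean_space n) U" and
    loc: "\<forall>u\<in>U. \<exists>V. openin (Euclidean_space n) V \<and> u \<in> V \<and> V \<subseteq> U \<and> p \<in> plots (prod_space X Y) n V"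
  have "fst \<circ> p \<in> plots X n V" "snd \<circ> p \<in> plots Y n V" if "p \<in> plots (prod_space X Y) n V" for V
    using that by (simp_all add: prod_space_def)
  then have "fst \<circ> p \<in> plots X n U" "snd \<circ> p \<in> plots Y n U"
    using loc by (intro plot_locally_plot[OF X U] plot_locally_plot[OF Y U]; meson)+
  then show "p \<in> plots (prod_space X Y) n U"
    by (simp add: prod_space_def)
next
  fix n U p m V f p'
  assume p: "p \<in> plots (prod_space X Y) n U" and f: "smooth_euclidean m V n U f"
    and eq: "\<forall>v\<in>V. p' v = p (f v)"
  then show "p' \<in> plots (prod_space X Y) m V"
    using plot_compose[OF X _ f] plot_compose[OF Y _ f] by (auto simp: prod_space_def)
next
  fix n U p and u assume "p \<in> plots (prod_space X Y) n U" "u \<in> U"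
  then show "p u \<in> points (prod_space X Y)"
    using plot_in_points[OF X, of "fst \<circ> p"] plot_in_points[OF Y, of "snd \<circ> p"]
    by (auto simp: prod_space_def mem_Times_iff)
qed (use plot_openin[OF X] plot_const[OF X] plot_const[OF Y] in \<open>auto simp: prod_space_def comp_def\<close>)

lemma discrete_plotI:
  assumes "openin (Euclidean_space n) U" "\<And>u. u \<in> U \<Longrightarrow> p u \<in> S"
    "\<And>u. u \<in> U \<Longrightarrow> \<exists>V. openin (Euclidean_space n) V \<and> u \<in> V \<and> V \<subseteq> U \<and> (\<forall>v\<in>V. p v = p u)"
  shows "p \<in> plots (discrete_space S) n U"
  unfolding discrete_space_def
  by (simp only: dspace.select_convs mem_Collect_eq Pi_iff) (intro conjI ballI assms)

lemma discrete_plotD: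
  assumes "p \<in> plots (discrete_space S) n U"
  shows "openin (Euclidean_space n) U" "\<And>u. u \<in> U \<Longrightarrow> p u \<in> S"
    "\<And>u. u \<in> U \<Longrightarrow> \<exists>V. openin (Euclidean_space n) V \<and> u \<in> V \<and> V \<subseteq> U \<and> (\<forall>v\<in>V. p v = p u)"
  using assms unfolding discrete_space_def
  by (simp_all only: dspace.select_convs mem_Collect_eq Pi_iff)

lemma diffeological_discrete_space: "diffeological_space (discrete_space S)"
proof (rule diffeological_spaceI)
  fix n U p
  assume U: "openin (Euclidean_space n) U" and
    loc: "\<forall>u\<in>U. \<exists>V. openin (Euclidean_space n) V \<and> u \<in> V \<and> V \<subseteq> U \<and> p \<in> plots (discrete_space S) n V"
  have "\<exists>V. openin (Euclidean_space n) V \<and> u \<in> V \<and> V \<subseteq> U \<and> (\<forall>v\<in>V. p v = p u)" if "u \<in> U" for u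
  proof -
    obtain V where V: "u \<in> V" "V \<subseteq> U" "p \<in> plots (discrete_space S) n V"
      using loc \<open>u \<in> U\<close> by blast
    then obtain V' where "openin (Euclidean_space n) V'" "u \<in> V'" "V' \<subseteq> V" "\<forall>v\<in>V'. p v = p u"
      using discrete_plotD(3) by meson
    then show ?thesis using V by blast
  qed
  moreover have "p u \<in> S" if "u \<in> U" for u
  proof -
    obtain V where "u \<in> V" "p \<in> plots (discrete_space S) n V"
      using bspec[OF loc \<open>u \<in> U\<close>] by (elim exE conjE)
    then show ?thesis by (meson discrete_plotD(2))
  qed
  ultimately show "p \<in> plots (discrete_space S) n U"
    by (intro discrete_plotI U)
next
  fix n U p m V f p'
  assume p: "p \<in> plots (discrete_space S) n U" and f: "smooth_euclidean m V n U f"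
    and eq: "\<forall>v\<in>V. p' v = p (f v)"
  have "\<exists>V'. openin (Euclidean_space m) V' \<and> v \<in> V' \<and> V' \<subseteq> V \<and> (\<forall>w\<in>V'. p' w = p' v)"
    if v: "v \<in> V" for v
  proof -
    obtain W where W: "openin (Euclidean_space n) W" "f v \<in> W" "\<forall>w\<in>W. p w = p (f v)"
      using discrete_plotD(3)[OF p smooth_euclideanD(3)[OF f v]] by (elim exE conjE)
    show ?thesis
    proof (intro exI conjI ballI)
      show "openin (Euclidean_space m) {w \<in> V. f w \<in> W}"
        by (rule smooth_euclidean_preimage_open[OF f W(1)])
      fix w assume "w \<in> {w \<in> V. f w \<in> W}"
      then show "p' w = p' v"
        using W(3) eq v by (metis (mono_tags, lifting) mem_Collect_eq)
    qed (use W(2) v in blast)+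
  qed
  then show "p' \<in> plots (discrete_space S) m V"
    using discrete_plotD(2)[OF p] smooth_euclideanD[OF f] eq by (intro discrete_plotI) simp_all
next
  fix n U x assume "openin (Euclidean_space n) U" "x \<in> points (discrete_space S)"
  then show "(\<lambda>_. x) \<in> plots (discrete_space S) n U"
    by (intro discrete_plotI) (auto simp: discrete_space_def)
next
  fix n U p u assume "p \<in> plots (discrete_space S) n U" "u \<in> U"
  then show "p u \<in> points (discrete_space S)"
    using discrete_plotD(2) by (simp add: discrete_space_def)
qed (rule discrete_plotD(1))

lemma points_sub_space [simp]: "points (sub_space X S) = points X \<inter> S"
  by (simp add: sub_space_def)

lemma plots_sub_space: "p \<in> plots (sub_space X S) n U \<longleftrightarrow> p \<in> plots X n U \<and> (\<forall>u\<in>U. p u \<in> S)"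
  by (auto simp: sub_space_def)

lemma sub_space_sub_space [simp]: "sub_space (sub_space X S) T = sub_space X (S \<inter> T)"
  by (auto simp: sub_space_def fun_eq_iff)

lemma plots_quotient_space:
  "p \<in> plots (quotient_space X f) n U \<longleftrightarrow> openin (Euclidean_space n) U \<and>
     (\<forall>u\<in>U. p u \<in> f ` points X) \<and>
     (\<forall>u\<in>U. \<exists>V. openin (Euclidean_space n) V \<and> u \<in> V \<and> V \<subseteq> U \<and>
        (\<exists>r\<in>plots X n V. \<forall>v\<in>V. p v = f (r v)))"
  by (simp only: quotient_space_def dspace.select_convs mem_Collect_eq Pi_iff)

lemma points_prod_space [simp]: "points (prod_space X Y) = points X \<times> points Y"
  by (simp add: prod_space_def)

lemma plots_prod_space:
  "p \<in> plots (prod_space X Y) n U \<longleftrightarrow>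
     (\<lambda>u. fst (p u)) \<in> plots X n U \<and> (\<lambda>u. snd (p u)) \<in> plots Y n U"
  by (simp add: prod_space_def comp_def)

lemma points_dsp [simp]: "points (dsp G) = carrier G"
  by (simp add: dsp_def)

lemma smooth_mapI:
  assumes "\<And>x. x \<in> points X \<Longrightarrow> f x \<in> points Y"
    and "\<And>n U p. p \<in> plots X n U \<Longrightarrow> (\<lambda>u. f (p u)) \<in> plots Y n U"
  shows "smooth_map X Y f"
  using assms by (auto simp: smooth_map_def comp_def)

lemma smooth_map_point: "smooth_map X Y f \<Longrightarrow> x \<in> points X \<Longrightarrow> f x \<in> points Y"
  by (auto simp: smooth_map_def)

lemma smooth_map_plot: "smooth_map X Y f \<Longrightarrow> p \<in> plots X n U \<Longrightarrow> (\<lambda>u. f (p u)) \<in> plots Y n U"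
  by (auto simp: smooth_map_def comp_def)

lemma smooth_map_cong:
  assumes "diffeological_space X" "diffeological_space Y" "smooth_map X Y f"
    "\<And>x. x \<in> points X \<Longrightarrow> f' x = f x"
  shows "smooth_map X Y f'"
  using assms(3,4) plot_in_points[OF assms(1)]
  by (intro smooth_mapI) (auto simp: smooth_map_point intro: plot_cong[OF assms(2) smooth_map_plot[OF assms(3)]])

lemma diffeomorphismI:
  assumes X: "diffeological_space X" and Y: "diffeological_space Y"
    and f: "smooth_map X Y f" and f': "smooth_map Y X f'"
    and inv: "\<And>x. x \<in> points X \<Longrightarrow> f' (f x) = x" "\<And>y. y \<in> points Y \<Longrightarrow> f (f' y) = y"
  shows "diffeomorphism X Y f"
proof -
  have bij: "bij_betw f (points X) (points Y)"
    using inv smooth_map_point[OF f] smooth_map_point[OF f'] by (intro bij_betwI) auto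
  moreover have "inv_into (points X) f y = f' y" if "y \<in> points Y" for y
    using inv(2)[OF that] smooth_map_point[OF f' that] bij_betw_imp_inj_on[OF bij] by (metis inv_into_f_f)
  then have "smooth_map Y X (inv_into (points X) f)"
    by (rule smooth_map_cong[OF Y X f'])
  ultimately show ?thesis
    using f by (simp add: diffeomorphism_def)
qed

lemma discrete_plot_locally_constant:
  assumes "e \<in> plots (discrete_space S) n U" "u \<in> U"
  obtains V where "openin (Euclidean_space n) V" "u \<in> V" "V \<subseteq> U" "\<And>v. v \<in> V \<Longrightarrow> e v = e u"
  using discrete_plotD(3)[OF assms] by blast

lemma discrete_plot_map2:
  assumes "e \<in> plots (discrete_space S) n U" "e' \<in> plots (discrete_space S') n U"
    and cl: "\<And>x y. x \<in> S \<Longrightarrow> y \<in> S' \<Longrightarrow> f x y \<in> T"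
  shows "(\<lambda>u. f (e u) (e' u)) \<in> plots (discrete_space T) n U"
proof -
  have "\<exists>V. openin (Euclidean_space n) V \<and> u \<in> V \<and> V \<subseteq> U \<and> (\<forall>v\<in>V. f (e v) (e' v) = f (e u) (e' u))"
    if u: "u \<in> U" for u
  proof -
    obtain V where V: "openin (Euclidean_space n) V" "u \<in> V" "V \<subseteq> U" "\<And>v. v \<in> V \<Longrightarrow> e v = e u"
      using discrete_plot_locally_constant[OF assms(1) u] by blast
    obtain V' where V': "openin (Euclidean_space n) V'" "u \<in> V'" "V' \<subseteq> U" "\<And>v. v \<in> V' \<Longrightarrow> e' v = e' u"
      using discrete_plot_locally_constant[OF assms(2) u] by blast
    show ?thesis
    proof (intro exI[of _ "V \<inter> V'"] conjI ballI)
      fix v assume "v \<in> V \<inter> V'"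
      then show "f (e v) (e' v) = f (e u) (e' u)"
        using V(4)[of v] V'(4)[of v] by simp
    qed (use V(1-3) V'(1-3) in \<open>auto intro: openin_Int\<close>)
  qed
  moreover have "openin (Euclidean_space n) U" "e u \<in> S" "e' u \<in> S'" if "u \<in> U" for u
    using discrete_plotD(1,2)[OF assms(1)] discrete_plotD(2)[OF assms(2)] that by blast+
  moreover have "openin (Euclidean_space n) U"
    using assms(1) by (rule discrete_plotD(1))
  ultimately show ?thesis
    by (intro discrete_plotI) (use cl in \<open>blast+\<close>)
qed

section \<open>The D-topology\<close>

lemma D_open_subset: "D_open X S \<Longrightarrow> S \<subseteq> points X"
  by (simp add: D_open_def)

lemma D_open_preimage: "D_open X S \<Longrightarrow> p \<in> plots X n U \<Longrightarrow> openin (Euclidean_space n) {u \<in> U. p u \<in> S}"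
  by (simp add: D_open_def)

lemma D_open_Int:
  assumes "D_open X S" "D_open X T" shows "D_open X (S \<inter> T)"
proof -
  have "{u \<in> U. p u \<in> S \<inter> T} = {u \<in> U. p u \<in> S} \<inter> {u \<in> U. p u \<in> T}" for U and p :: "(nat \<Rightarrow> real) \<Rightarrow> _"
    by auto
  moreover have "S \<inter> T \<subseteq> points X"
    using D_open_subset[OF assms(1)] by blast
  ultimately show ?thesis
    using D_open_preimage[OF assms(1)] D_open_preimage[OF assms(2)]
    by (simp add: D_open_def openin_Int)
qed

lemma D_open_sub_space:
  assumes X: "diffeological_space X" and S: "D_open X S" and T: "D_open (sub_space X S) T"
  shows "D_open X T"
proof -
  have "openin (Euclidean_space n) {u \<in> U. p u \<in> T}" if p: "p \<in> plots X n U" for n U p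
  proof -
    let ?V = "{u \<in> U. p u \<in> S}"
    have "p \<in> plots (sub_space X S) n ?V"
      using plot_restrict[OF X p D_open_preimage[OF S p]] by (auto simp: plots_sub_space)
    moreover have "{u \<in> ?V. p u \<in> T} = {u \<in> U. p u \<in> T}"
      using D_open_subset[OF T] by auto
    ultimately show ?thesis
      using D_open_preimage[OF T] by fastforce
  qed
  then show ?thesis
    using D_open_subset[OF T] by (auto simp: D_open_def)
qed

section \<open>Diffeological groups and semidirect products\<close>

lemma plot_mult:
  assumes "diffeological_group G" "p \<in> plots (dsp G) n U" "p' \<in> plots (dsp G) n U"
  shows "(\<lambda>u. p u \<otimes>\<^bsub>G\<^esub> p' u) \<in> plots (dsp G) n U"
proof -
  have "smooth_map (prod_space (dsp G) (dsp G)) (dsp G) (\<lambda>(x, y). x \<otimes>\<^bsub>G\<^esub> y)"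
    using assms(1) by (simp add: diffeological_group_def)
  from smooth_map_plot[OF this, of "\<lambda>u. (p u, p' u)"] show ?thesis
    using assms(2,3) by (simp add: plots_prod_space)
qed

lemma plot_inv:
  assumes "diffeological_group G" "p \<in> plots (dsp G) n U"
  shows "(\<lambda>u. inv\<^bsub>G\<^esub> (p u)) \<in> plots (dsp G) n U"
  using assms smooth_map_plot by (fastforce simp: diffeological_group_def)

lemma diffeological_group_space: "diffeological_group G \<Longrightarrow> diffeological_space (dsp G)"
  by (simp add: diffeological_group_def)

lemma diffeological_group_group: "diffeological_group G \<Longrightarrow> group G"
  by (simp add: diffeological_group_def)

lemma plot_in_carrier:
  "diffeological_group G \<Longrightarrow> p \<in> plots (dsp G) n U \<Longrightarrow> u \<in> U \<Longrightarrow> p u \<in> carrier G"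
  using plot_in_points[OF diffeological_group_space] by fastforce

lemma one_Z2 [simp]: "1 \<in> Z2"
  and mult_Z2 [simp]: "e \<in> Z2 \<Longrightarrow> e' \<in> Z2 \<Longrightarrow> e * e' \<in> Z2"
  and square_Z2 [simp]: "e \<in> Z2 \<Longrightarrow> e * e = 1"
  by (auto simp: Z2_def)

lemma points_discrete_space [simp]: "points (discrete_space S) = S"
  by (simp add: discrete_space_def)

lemma (in group) inv_cancel_left [simp]:
  assumes "x \<in> carrier G" "y \<in> carrier G"
  shows "x \<otimes> (inv x \<otimes> y) = y" "inv x \<otimes> (x \<otimes> y) = y"
  using assms by (simp_all flip: m_assoc)

locale Z2_diffeological_group =
  fixes G :: "'g dgroup" and \<sigma> :: "int \<Rightarrow> 'g \<Rightarrow> 'g"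
  assumes diffeological: "diffeological_group G" and action: "Z2_action G \<sigma>"
begin

sublocale group G
  using diffeological by (rule diffeological_group_group)

lemma action_closed [simp]: "e \<in> Z2 \<Longrightarrow> x \<in> carrier G \<Longrightarrow> \<sigma> e x \<in> carrier G"
  using action by (auto simp: Z2_action_def iso_def hom_def)

lemma action_mult: "e \<in> Z2 \<Longrightarrow> x \<in> carrier G \<Longrightarrow> y \<in> carrier G \<Longrightarrow> \<sigma> e (x \<otimes>\<^bsub>G\<^esub> y) = \<sigma> e x \<otimes>\<^bsub>G\<^esub> \<sigma> e y"
  using action by (auto simp: Z2_action_def iso_def hom_def)

lemma action_hom: "e \<in> Z2 \<Longrightarrow> group_hom G G (\<sigma> e)"
  using action by (auto simp: Z2_action_def iso_def group_hom_def group_hom_axioms_def)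

lemma action_one [simp]: "e \<in> Z2 \<Longrightarrow> \<sigma> e \<one>\<^bsub>G\<^esub> = \<one>\<^bsub>G\<^esub>"
  by (rule group_hom.hom_one[OF action_hom])

lemma action_inv: "e \<in> Z2 \<Longrightarrow> x \<in> carrier G \<Longrightarrow> \<sigma> e (inv\<^bsub>G\<^esub> x) = inv\<^bsub>G\<^esub> (\<sigma> e x)"
  by (rule group_hom.hom_inv[OF action_hom])

lemma action_1 [simp]: "x \<in> carrier G \<Longrightarrow> \<sigma> 1 x = x"
  using action by (auto simp: Z2_action_def)

lemma action_action: "e \<in> Z2 \<Longrightarrow> e' \<in> Z2 \<Longrightarrow> x \<in> carrier G \<Longrightarrow> \<sigma> e (\<sigma> e' x) = \<sigma> (e * e') x"
  using action by (auto simp: Z2_action_def)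

lemma action_involution [simp]: "e \<in> Z2 \<Longrightarrow> x \<in> carrier G \<Longrightarrow> \<sigma> e (\<sigma> e x) = x"
  by (simp add: action_action)

text \<open>A plot of \<open>Z2\<close> is locally constant, so near each point only one of the two
  diffeomorphisms is applied.\<close>

lemma action_plot:
  assumes e: "e \<in> plots (discrete_space Z2) n U" and p: "p \<in> plots (dsp G) n U"
  shows "(\<lambda>u. \<sigma> (e u) (p u)) \<in> plots (dsp G) n U"
proof (rule plot_local)
  fix u assume u: "u \<in> U"
  obtain V where V: "openin (Euclidean_space n) V" "u \<in> V" "V \<subseteq> U" "\<And>v. v \<in> V \<Longrightarrow> e v = e u"
    using discrete_plot_locally_constant[OF e u] by blast
  have "smooth_map (dsp G) (dsp G) (\<sigma> (e u))"
    using action discrete_plotD(2)[OF e u] by (simp add: Z2_action_def diffeomorphism_def)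
  moreover have "p \<in> plots (dsp G) n V"
    by (rule plot_restrict[OF diffeological_group_space[OF diffeological] p V(1,3) refl])
  ultimately have "(\<lambda>v. \<sigma> (e u) (p v)) \<in> plots (dsp G) n V"
    by (rule smooth_map_plot)
  moreover have "\<sigma> (e v) (p v) = \<sigma> (e u) (p v)" if "v \<in> V" for v
    using V(4)[OF that] by simp
  ultimately show "\<exists>V r. openin (Euclidean_space n) V \<and> u \<in> V \<and> V \<subseteq> U \<and> r \<in> plots (dsp G) n V \<and>
      (\<forall>v\<in>V. \<sigma> (e v) (p v) = r v)"
    using V(1-3) by blast
qed (use diffeological_group_space[OF diffeological] discrete_plotD(1)[OF e] in auto)

abbreviation SD where "SD \<equiv> semidirect G \<sigma>"

lemma carrier_semidirect: "carrier SD = carrier G \<times> Z2"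
  and mult_semidirect [simp]: "(x, e) \<otimes>\<^bsub>SD\<^esub> (x', e') = (x \<otimes>\<^bsub>G\<^esub> \<sigma> e x', e * e')"
  and one_semidirect: "\<one>\<^bsub>SD\<^esub> = (\<one>\<^bsub>G\<^esub>, 1)"
  by (simp_all add: semidirect_def)

lemma mult_semidirect': "h \<otimes>\<^bsub>SD\<^esub> h' = (fst h \<otimes>\<^bsub>G\<^esub> \<sigma> (snd h) (fst h'), snd h * snd h')"
  by (cases h; cases h') simp

lemma dsp_semidirect: "dsp SD = prod_space (dsp G) (discrete_space Z2)"
  by (simp add: dsp_def semidirect_def prod_space_def)

lemma plots_semidirect:
  "p \<in> plots (dsp SD) n U \<longleftrightarrow>
     (\<lambda>u. fst (p u)) \<in> plots (dsp G) n U \<and> (\<lambda>u. snd (p u)) \<in> plots (discrete_space Z2) n U"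
  by (simp add: dsp_semidirect plots_prod_space)

lemma group_semidirect: "group SD"
proof (rule groupI)
  fix h assume h: "h \<in> carrier SD"
  then have "(\<sigma> (snd h) (inv\<^bsub>G\<^esub> (fst h)), snd h) \<otimes>\<^bsub>SD\<^esub> h = \<one>\<^bsub>SD\<^esub>"
    by (cases h) (simp add: carrier_semidirect one_semidirect flip: action_mult)
  then show "\<exists>y\<in>carrier SD. y \<otimes>\<^bsub>SD\<^esub> h = \<one>\<^bsub>SD\<^esub>"
    using h by (intro bexI[of _ "(\<sigma> (snd h) (inv\<^bsub>G\<^esub> (fst h)), snd h)"]) (auto simp: carrier_semidirect)
qed (auto simp: carrier_semidirect one_semidirect m_assoc action_mult action_action mult.assoc)

lemma inv_semidirect:
  assumes "x \<in> carrier G" "e \<in> Z2"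
  shows "inv\<^bsub>SD\<^esub> (x, e) = (\<sigma> e (inv\<^bsub>G\<^esub> x), e)"
  using assms by (intro group.inv_equality[OF group_semidirect])
    (simp_all add: carrier_semidirect one_semidirect flip: action_mult)

lemma diffeological_group_semidirect: "diffeological_group SD"
  unfolding diffeological_group_def
proof (intro conjI group_semidirect smooth_mapI)
  show "diffeological_space (dsp SD)"
    unfolding dsp_semidirect
    by (intro diffeological_prod_space diffeological_discrete_space
        diffeological_group_space[OF diffeological])
next
  fix h assume "h \<in> points (prod_space (dsp SD) (dsp SD))"
  then show "(case h of (x, y) \<Rightarrow> x \<otimes>\<^bsub>SD\<^esub> y) \<in> points (dsp SD)"
    by (auto simp: carrier_semidirect)
next
  fix n U p assume "p \<in> plots (prod_space (dsp SD) (dsp SD)) n U"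
  then show "(\<lambda>u. case p u of (x, y) \<Rightarrow> x \<otimes>\<^bsub>SD\<^esub> y) \<in> plots (dsp SD) n U"
    by (auto simp: plots_semidirect plots_prod_space case_prod_unfold mult_semidirect'
        intro!: plot_mult[OF diffeological] action_plot intro: discrete_plot_map2)
next
  fix h assume "h \<in> points (dsp SD)"
  then show "inv\<^bsub>SD\<^esub> h \<in> points (dsp SD)"
    using group.inv_closed[OF group_semidirect] by simp
next
  fix n U p assume p: "p \<in> plots (dsp SD) n U"
  let ?r = "\<lambda>u. (\<sigma> (snd (p u)) (inv\<^bsub>G\<^esub> (fst (p u))), snd (p u))"
  have sp: "diffeological_space (dsp SD)"
    unfolding dsp_semidirect
    by (intro diffeological_prod_space diffeological_discrete_space
        diffeological_group_space[OF diffeological])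
  have "?r \<in> plots (dsp SD) n U"
    using p by (auto simp: plots_semidirect intro!: plot_inv[OF diffeological] action_plot)
  moreover have "inv\<^bsub>SD\<^esub> (p u) = ?r u" if "u \<in> U" for u
    using plot_in_points[OF sp p that] inv_semidirect by (cases "p u") (auto simp: carrier_semidirect)
  ultimately show "(\<lambda>u. inv\<^bsub>SD\<^esub> (p u)) \<in> plots (dsp SD) n U"
    by (rule plot_cong[OF sp])
qed

end


section \<open>Principal bundles\<close>

lemma tot_bundle_res [simp]: "tot (bundle_res V B) = {y \<in> tot B. proj B y \<in> V}"
  and proj_bundle_res [simp]: "proj (bundle_res V B) = proj B"
  and act_bundle_res [simp]: "act (bundle_res V B) = act B"
  by (auto simp: bundle_res_def)

lemma plots_bundle_res:
  "p \<in> plots (total_space (bundle_res V B)) n U \<longleftrightarrow>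
     p \<in> plots (total_space B) n U \<and> (\<forall>u\<in>U. proj B (p u) \<in> V)"
  by (auto simp: bundle_res_def plots_sub_space)

lemma bundle_res_bundle_res [simp]: "bundle_res W (bundle_res V B) = bundle_res (V \<inter> W) B"
  by (simp add: bundle_res_def flip: vimage_Int)

lemma orb_bundle_res [simp]: "orb N (bundle_res V B) = orb N B"
  by (simp add: orb_def fun_eq_iff)

lemma diffeomorphism_inv_plot:
  "diffeomorphism X Y f \<Longrightarrow> p \<in> plots Y n U \<Longrightarrow> (\<lambda>u. inv_into (points X) f (p u)) \<in> plots X n U"
  by (auto simp: diffeomorphism_def intro: smooth_map_plot)

locale diffeological_principal_bundle =
  fixes H :: "'h dgroup" and X :: "'x dspace" and B :: "('e, 'x, 'h) pbundle"
  assumes diffeological: "diffeological_group H" and base: "diffeological_space X"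
    and principal: "principal_bundle H X B"
begin

sublocale H: group H
  using diffeological by (rule diffeological_group_group)

lemma total: "diffeological_space (total_space B)"
  and proj_smooth: "smooth_map (total_space B) X (proj B)"
  and act_smooth: "smooth_map (prod_space (total_space B) (dsp H)) (total_space B) (\<lambda>(y, h). act B y h)"
  and act_one: "y \<in> tot B \<Longrightarrow> act B y \<one>\<^bsub>H\<^esub> = y"
  and act_act: "y \<in> tot B \<Longrightarrow> h \<in> carrier H \<Longrightarrow> h' \<in> carrier H \<Longrightarrow>
    act B (act B y h) h' = act B y (h \<otimes>\<^bsub>H\<^esub> h')"
  and proj_act: "y \<in> tot B \<Longrightarrow> h \<in> carrier H \<Longrightarrow> proj B (act B y h) = proj B y"
  using principal unfolding principal_bundle_def by blast+

lemma proj_in: "y \<in> tot B \<Longrightarrow> proj B y \<in> points X"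
  using smooth_map_point[OF proj_smooth] .

lemma proj_plot: "p \<in> plots (total_space B) n U \<Longrightarrow> (\<lambda>u. proj B (p u)) \<in> plots X n U"
  using smooth_map_plot[OF proj_smooth] .

lemma act_in: "y \<in> tot B \<Longrightarrow> h \<in> carrier H \<Longrightarrow> act B y h \<in> tot B"
  using smooth_map_point[OF act_smooth, of "(y, h)"] by simp

lemma act_plot:
  "p \<in> plots (total_space B) n U \<Longrightarrow> h \<in> plots (dsp H) n U \<Longrightarrow>
   (\<lambda>u. act B (p u) (h u)) \<in> plots (total_space B) n U"
  using smooth_map_plot[OF act_smooth, of "\<lambda>u. (p u, h u)"] by (simp add: plots_prod_space)

lemma local_trivialisation:
  assumes "x \<in> points X"
  obtains V \<Phi> where "D_open X V" "x \<in> V"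
    "diffeomorphism (prod_space (sub_space X V) (dsp H)) (total_space (bundle_res V B)) \<Phi>"
    "\<And>u h. u \<in> V \<Longrightarrow> h \<in> carrier H \<Longrightarrow> proj B (\<Phi> (u, h)) = u"
    "\<And>u h h'. u \<in> V \<Longrightarrow> h \<in> carrier H \<Longrightarrow> h' \<in> carrier H \<Longrightarrow> \<Phi> (u, h \<otimes>\<^bsub>H\<^esub> h') = act B (\<Phi> (u, h)) h'"
proof -
  have "\<forall>x\<in>points X. \<exists>V \<Phi>. D_open X V \<and> x \<in> V \<and>
        diffeomorphism (prod_space (sub_space X V) (dsp H)) (total_space (bundle_res V B)) \<Phi> \<and>
        (\<forall>u\<in>V. \<forall>h\<in>carrier H. proj B (\<Phi> (u, h)) = u) \<and>
        (\<forall>u\<in>V. \<forall>h\<in>carrier H. \<forall>h'\<in>carrier H.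
           \<Phi> (u, h \<otimes>\<^bsub>H\<^esub> h') = act B (\<Phi> (u, h)) h')"
    using principal unfolding principal_bundle_def by (elim conjE)
  from bspec[OF this assms] show ?thesis
    by (elim exE conjE) (erule (2) that; blast)
qed

text \<open>A local trivialisation turns a plot of the total space into a plot of the group.\<close>

lemma coordinate_plot:
  assumes p: "p \<in> plots (total_space B) n U" and V: "\<And>u. u \<in> U \<Longrightarrow> proj B (p u) \<in> V"
    and diffeo: "diffeomorphism (prod_space (sub_space X V) (dsp H)) (total_space (bundle_res V B)) \<Phi>"
    and proj: "\<And>u h. u \<in> V \<Longrightarrow> h \<in> carrier H \<Longrightarrow> proj B (\<Phi> (u, h)) = u"
  obtains h where "h \<in> plots (dsp H) n U" "\<And>u. u \<in> U \<Longrightarrow> p u = \<Phi> (proj B (p u), h u)"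
proof
  let ?D = "prod_space (sub_space X V) (dsp H)"
  let ?i = "inv_into (points ?D) \<Phi>"
  have "p \<in> plots (total_space (bundle_res V B)) n U"
    using p V by (simp add: plots_bundle_res)
  then show "(\<lambda>u. snd (?i (p u))) \<in> plots (dsp H) n U"
    using diffeomorphism_inv_plot[OF diffeo] by (simp add: plots_prod_space)
  fix u assume u: "u \<in> U"
  have im: "p u \<in> \<Phi> ` points ?D"
    using diffeo plot_in_points[OF total p u] V[OF u] by (simp add: diffeomorphism_def bij_betw_def)
  obtain x k where xk: "?i (p u) = (x, k)" by fastforce
  have "\<Phi> (x, k) = p u" "x \<in> V" "k \<in> carrier H"
    using f_inv_into_f[OF im] inv_into_into[OF im] unfolding xk by simp_all
  then show "p u = \<Phi> (proj B (p u), snd (?i (p u)))"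
    unfolding xk using proj[of x k] by simp
qed

text \<open>A point is a constant plot, for instance on \<open>R^0\<close>.\<close>

lemma coordinate_point:
  assumes "y \<in> tot B" "proj B y \<in> V"
    and diffeo: "diffeomorphism (prod_space (sub_space X V) (dsp H)) (total_space (bundle_res V B)) \<Phi>"
    and proj: "\<And>u h. u \<in> V \<Longrightarrow> h \<in> carrier H \<Longrightarrow> proj B (\<Phi> (u, h)) = u"
  obtains h where "h \<in> carrier H" "y = \<Phi> (proj B y, h)"
proof -
  have "(\<lambda>_. y) \<in> plots (total_space B) 0 (topspace (Euclidean_space 0))"
    using plot_const[OF total _ assms(1)] by simp
  then obtain h where h: "h \<in> plots (dsp H) 0 (topspace (Euclidean_space 0))"
    "\<And>u. u \<in> topspace (Euclidean_space 0) \<Longrightarrow> y = \<Phi> (proj B y, h u)"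
    using coordinate_plot[OF _ _ diffeo proj] assms(2) by metis
  have "(\<lambda>_. 0) \<in> topspace (Euclidean_space 0)"
    by (simp add: topspace_Euclidean_space)
  then show ?thesis
    using h that plot_in_carrier[OF diffeological h(1)] by blast
qed

lemma act_free:
  assumes y: "y \<in> tot B" and h: "h \<in> carrier H" "h' \<in> carrier H" and eq: "act B y h = act B y h'"
  shows "h = h'"
proof -
  obtain V \<Phi> where V: "D_open X V" "proj B y \<in> V"
    and \<Phi>: "diffeomorphism (prod_space (sub_space X V) (dsp H)) (total_space (bundle_res V B)) \<Phi>"
    "\<And>u h. u \<in> V \<Longrightarrow> h \<in> carrier H \<Longrightarrow> proj B (\<Phi> (u, h)) = u"
    "\<And>u h h'. u \<in> V \<Longrightarrow> h \<in> carrier H \<Longrightarrow> h' \<in> carrier H \<Longrightarrow> \<Phi> (u, h \<otimes>\<^bsub>H\<^esub> h') = act B (\<Phi> (u, h)) h'"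
    using local_trivialisation[OF proj_in[OF y]] by metis
  obtain k where k: "k \<in> carrier H" "y = \<Phi> (proj B y, k)"
    using coordinate_point[OF y V(2) \<Phi>(1,2)] by blast
  have "\<Phi> (proj B y, k \<otimes>\<^bsub>H\<^esub> h) = \<Phi> (proj B y, k \<otimes>\<^bsub>H\<^esub> h')"
    using \<Phi>(3)[OF V(2) k(1)] h k(2) eq by simp
  moreover have "inj_on \<Phi> (points (prod_space (sub_space X V) (dsp H)))"
    using \<Phi>(1) by (simp add: diffeomorphism_def bij_betw_def)
  ultimately have "k \<otimes>\<^bsub>H\<^esub> h = k \<otimes>\<^bsub>H\<^esub> h'"
    using k(1) h V(2) proj_in[OF y] by (auto dest!: inj_onD)
  then show ?thesis
    using k(1) h by simp
qed

lemma act_transitive: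
  assumes y: "y \<in> tot B" "y' \<in> tot B" "proj B y = proj B y'"
  obtains h where "h \<in> carrier H" "y' = act B y h"
proof -
  obtain V \<Phi> where V: "D_open X V" "proj B y \<in> V"
    and \<Phi>: "diffeomorphism (prod_space (sub_space X V) (dsp H)) (total_space (bundle_res V B)) \<Phi>"
    "\<And>u h. u \<in> V \<Longrightarrow> h \<in> carrier H \<Longrightarrow> proj B (\<Phi> (u, h)) = u"
    "\<And>u h h'. u \<in> V \<Longrightarrow> h \<in> carrier H \<Longrightarrow> h' \<in> carrier H \<Longrightarrow> \<Phi> (u, h \<otimes>\<^bsub>H\<^esub> h') = act B (\<Phi> (u, h)) h'"
    using local_trivialisation[OF proj_in[OF y(1)]] by metis
  obtain k where k: "k \<in> carrier H" "y = \<Phi> (proj B y, k)"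
    using coordinate_point[OF y(1) V(2) \<Phi>(1,2)] by blast
  obtain k' where k': "k' \<in> carrier H" "y' = \<Phi> (proj B y', k')"
    using coordinate_point[OF y(2) _ \<Phi>(1,2)] V(2) y(3) by metis
  have "act B y (inv\<^bsub>H\<^esub> k \<otimes>\<^bsub>H\<^esub> k') = \<Phi> (proj B y, k \<otimes>\<^bsub>H\<^esub> (inv\<^bsub>H\<^esub> k \<otimes>\<^bsub>H\<^esub> k'))"
    using \<Phi>(3)[OF V(2) k(1), of "inv\<^bsub>H\<^esub> k \<otimes>\<^bsub>H\<^esub> k'"] k k'(1) by (simp del: H.inv_cancel_left)
  also have "\<dots> = y'"
    using k(1) k' y(3) by simp
  finally show ?thesis
    using that[of "inv\<^bsub>H\<^esub> k \<otimes>\<^bsub>H\<^esub> k'"] k(1) k'(1) by simp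
qed

definition division :: "'e \<Rightarrow> 'e \<Rightarrow> 'h" where
  "division y y' = (THE h. h \<in> carrier H \<and> y' = act B y h)"

lemma division_eq:
  assumes "y \<in> tot B" "h \<in> carrier H" "y' = act B y h" shows "division y y' = h"
  unfolding division_def using assms act_free by (intro the_equality) auto

lemma division:
  assumes "y \<in> tot B" "y' \<in> tot B" "proj B y = proj B y'"
  shows "division y y' \<in> carrier H" "act B y (division y y') = y'"
  using act_transitive[OF assms] division_eq[OF assms(1)] by metis+

text \<open>In a local trivialisation, division is \<open>(x, h), (x, h') \<mapsto> h\<inverse> h'\<close>.\<close>

lemma division_plot:
  assumes p: "p \<in> plots (total_space B) n U" and p': "p' \<in> plots (total_space B) n U"
    and same: "\<And>u. u \<in> U \<Longrightarrow> proj B (p u) = proj B (p' u)"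
  shows "(\<lambda>u. division (p u) (p' u)) \<in> plots (dsp H) n U"
proof (rule plot_local[OF diffeological_group_space[OF diffeological] plot_openin[OF total p]])
  fix u0 assume u0: "u0 \<in> U"
  have x0: "proj B (p u0) \<in> points X"
    using plot_in_points[OF total p u0] by (rule proj_in)
  obtain V \<Phi> where V: "D_open X V" "proj B (p u0) \<in> V"
    and \<Phi>: "diffeomorphism (prod_space (sub_space X V) (dsp H)) (total_space (bundle_res V B)) \<Phi>"
    "\<And>u h. u \<in> V \<Longrightarrow> h \<in> carrier H \<Longrightarrow> proj B (\<Phi> (u, h)) = u"
    "\<And>u h h'. u \<in> V \<Longrightarrow> h \<in> carrier H \<Longrightarrow> h' \<in> carrier H \<Longrightarrow> \<Phi> (u, h \<otimes>\<^bsub>H\<^esub> h') = act B (\<Phi> (u, h)) h'"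
    using local_trivialisation[OF x0] by metis
  define W where "W = {u \<in> U. proj B (p u) \<in> V}"
  have W: "openin (Euclidean_space n) W" "W \<subseteq> U" "u0 \<in> W"
    using D_open_preimage[OF V(1) proj_plot[OF p]] V(2) u0 by (auto simp: W_def)
  have pW: "p \<in> plots (total_space B) n W" "p' \<in> plots (total_space B) n W"
    using plot_restrict[OF total _ W(1,2) refl] p p' by auto
  have projW: "proj B (p u) \<in> V" "proj B (p' u) \<in> V" if "u \<in> W" for u
    using that same[of u] by (auto simp: W_def)
  obtain h where h: "h \<in> plots (dsp H) n W" "\<And>u. u \<in> W \<Longrightarrow> p u = \<Phi> (proj B (p u), h u)"
    using coordinate_plot[OF pW(1) projW(1) \<Phi>(1,2)] by blast
  obtain h' where h': "h' \<in> plots (dsp H) n W" "\<And>u. u \<in> W \<Longrightarrow> p' u = \<Phi> (proj B (p' u), h' u)"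
    using coordinate_plot[OF pW(2) projW(2) \<Phi>(1,2)] by blast
  let ?r = "\<lambda>u. inv\<^bsub>H\<^esub> (h u) \<otimes>\<^bsub>H\<^esub> h' u"
  have r: "?r \<in> plots (dsp H) n W"
    by (intro plot_mult plot_inv diffeological h(1) h'(1))
  have "division (p u) (p' u) = ?r u" if u: "u \<in> W" for u
  proof (rule division_eq)
    have c: "h u \<in> carrier H" "h' u \<in> carrier H"
      using plot_in_carrier[OF diffeological] h(1) h'(1) u by auto
    show "p u \<in> tot B"
      using plot_in_points[OF total p] u by (simp add: W_def)
    show "?r u \<in> carrier H"
      using c by simp
    have x: "proj B (p u) \<in> V" and x': "proj B (p' u) = proj B (p u)"
      using u same by (auto simp: W_def)
    have "act B (p u) (?r u) = \<Phi> (proj B (p u), h u \<otimes>\<^bsub>H\<^esub> ?r u)"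
      using \<Phi>(3)[OF x c(1), of "?r u"] h(2)[OF u] c by (simp del: H.inv_cancel_left)
    also have "\<dots> = p' u"
      using h'(2)[OF u] x' c by simp
    finally show "p' u = act B (p u) (?r u)" by simp
  qed
  then show "\<exists>V r. openin (Euclidean_space n) V \<and> u0 \<in> V \<and> V \<subseteq> U \<and> r \<in> plots (dsp H) n V \<and>
      (\<forall>v\<in>V. division (p v) (p' v) = r v)"
    using W r by blast
qed

lemma local_section:
  assumes x: "x \<in> points X"
  obtains V s where "D_open X V" "x \<in> V" "smooth_map (sub_space X V) (total_space B) s"
    "\<And>u. u \<in> V \<Longrightarrow> proj B (s u) = u"
proof -
  obtain V \<Phi> where V: "D_open X V" "x \<in> V"
    and \<Phi>: "diffeomorphism (prod_space (sub_space X V) (dsp H)) (total_space (bundle_res V B)) \<Phi>"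
    "\<And>u h. u \<in> V \<Longrightarrow> h \<in> carrier H \<Longrightarrow> proj B (\<Phi> (u, h)) = u"
    using local_trivialisation[OF x] by metis
  have sm: "smooth_map (prod_space (sub_space X V) (dsp H)) (total_space (bundle_res V B)) \<Phi>"
    using \<Phi>(1) by (simp add: diffeomorphism_def)
  have "smooth_map (sub_space X V) (total_space B) (\<lambda>u. \<Phi> (u, \<one>\<^bsub>H\<^esub>))"
  proof (rule smooth_mapI)
    fix u assume "u \<in> points (sub_space X V)"
    then show "\<Phi> (u, \<one>\<^bsub>H\<^esub>) \<in> tot B"
      using smooth_map_point[OF sm, of "(u, \<one>\<^bsub>H\<^esub>)"] by simp
  next
    fix n U p assume p: "p \<in> plots (sub_space X V) n U"
    have "(\<lambda>_. \<one>\<^bsub>H\<^esub>) \<in> plots (dsp H) n U"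
      using plot_const[OF diffeological_group_space[OF diffeological]]
        plot_openin[OF diffeological_sub_space[OF base] p] by simp
    with p show "(\<lambda>u. \<Phi> (p u, \<one>\<^bsub>H\<^esub>)) \<in> plots (total_space B) n U"
      using smooth_map_plot[OF sm, of "\<lambda>u. (p u, \<one>\<^bsub>H\<^esub>)"]
      by (simp add: plots_prod_space plots_bundle_res)
  qed
  with V \<Phi>(2) that show ?thesis by auto
qed

end

section \<open>Cech classes in degree 2\<close>

lemma (in comm_group) inv_mult_mult:
  assumes "x \<in> carrier G" "y \<in> carrier G" "z \<in> carrier G"
  shows "inv x \<otimes> inv y \<otimes> inv (inv z) = inv (x \<otimes> y \<otimes> inv z)"
  using assms by (simp add: inv_mult)

text \<open>The algebra behind the homotopy between two refinement maps: the three hypotheses are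
  instances of the cocycle identity, with common terms \<open>w\<close> and \<open>z\<close> that cancel.\<close>

lemma (in comm_group) cocycle_homotopy:
  assumes carr: "c \<in> carrier G" "d \<in> carrier G" "p1 \<in> carrier G" "p2 \<in> carrier G" "p3 \<in> carrier G"
    "q1 \<in> carrier G" "q2 \<in> carrier G" "q3 \<in> carrier G" "w \<in> carrier G" "z \<in> carrier G"
    and e1: "c \<otimes> p3 = p2 \<otimes> z" and e2: "p1 \<otimes> w = q2 \<otimes> z" and e3: "q1 \<otimes> w = d \<otimes> q3"
  shows "c = d \<otimes> ((p1 \<otimes> inv q1) \<otimes> (p2 \<otimes> inv q2) \<otimes> inv (p3 \<otimes> inv q3))"
proof -
  have "(c \<otimes> (q1 \<otimes> q2 \<otimes> p3)) \<otimes> (w \<otimes> z) = (c \<otimes> p3) \<otimes> (q1 \<otimes> w) \<otimes> (q2 \<otimes> z)"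
    using carr by (simp add: m_ac)
  also have "\<dots> = (p2 \<otimes> z) \<otimes> (d \<otimes> q3) \<otimes> (p1 \<otimes> w)"
    by (simp add: e1 e2 e3)
  also have "\<dots> = (d \<otimes> (p1 \<otimes> p2 \<otimes> q3)) \<otimes> (w \<otimes> z)"
    using carr by (simp add: m_ac)
  finally have "c \<otimes> (q1 \<otimes> q2 \<otimes> p3) = d \<otimes> (p1 \<otimes> p2 \<otimes> q3)"
    using carr by (metis m_closed right_cancel)
  then have "c = (d \<otimes> (p1 \<otimes> p2 \<otimes> q3)) \<otimes> inv (q1 \<otimes> q2 \<otimes> p3)"
    using carr inv_solve_right[of c "d \<otimes> (p1 \<otimes> p2 \<otimes> q3)" "q1 \<otimes> q2 \<otimes> p3"] by simp
  also have "\<dots> = d \<otimes> ((p1 \<otimes> inv q1) \<otimes> (p2 \<otimes> inv q2) \<otimes> inv (p3 \<otimes> inv q3))"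
    using carr by (simp add: m_ac inv_mult)
  finally show ?thesis .
qed

locale abelian_presheaf =
  fixes F :: "('x, 's) ab_presheaf"
  assumes sections_comm_group: "comm_group (sections F V)"
    and res_hom: "V \<subseteq> W \<Longrightarrow> sec_res F V \<in> hom (sections F W) (sections F V)"
    and res_res: "V \<subseteq> W \<Longrightarrow> sec_res F V (sec_res F W t) = sec_res F V t"
begin

lemma res_group_hom: "V \<subseteq> W \<Longrightarrow> group_hom (sections F W) (sections F V) (sec_res F V)"
  using sections_comm_group res_hom
  by (auto simp: group_hom_def group_hom_axioms_def comm_group_def)

lemma res_closed: "V \<subseteq> W \<Longrightarrow> t \<in> carrier (sections F W) \<Longrightarrow> sec_res F V t \<in> carrier (sections F V)"
  by (rule group_hom.hom_closed[OF res_group_hom])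

lemma res_mult: "V \<subseteq> W \<Longrightarrow> t \<in> carrier (sections F W) \<Longrightarrow> t' \<in> carrier (sections F W) \<Longrightarrow>
    sec_res F V (t \<otimes>\<^bsub>sections F W\<^esub> t') = sec_res F V t \<otimes>\<^bsub>sections F V\<^esub> sec_res F V t'"
  by (rule group_hom.hom_mult[OF res_group_hom])

lemma res_inv: "V \<subseteq> W \<Longrightarrow> t \<in> carrier (sections F W) \<Longrightarrow>
    sec_res F V (inv\<^bsub>sections F W\<^esub> t) = inv\<^bsub>sections F V\<^esub> (sec_res F V t)"
  by (rule group_hom.hom_inv[OF res_group_hom])

lemma sections_group: "group (sections F V)"
  using sections_comm_group by (simp add: comm_group_def)

lemmas mult_closed = monoid.m_closed[OF group.is_monoid[OF sections_group]]
lemmas inv_closed = group.inv_closed[OF sections_group]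

lemma cocycle_section:
  "cech_cocycle F I U c \<Longrightarrow> i \<in> I \<Longrightarrow> j \<in> I \<Longrightarrow> k \<in> I \<Longrightarrow>
     c i j k \<in> carrier (sections F (U i \<inter> U j \<inter> U k))"
  by (simp add: cech_cocycle_def)

lemma cocycle_identity:
  assumes c: "cech_cocycle F I U c" and ijkl: "i \<in> I" "j \<in> I" "k \<in> I" "l \<in> I"
    and V: "V \<subseteq> U i" "V \<subseteq> U j" "V \<subseteq> U k" "V \<subseteq> U l"
  shows "sec_res F V (c i j k) \<otimes>\<^bsub>sections F V\<^esub> sec_res F V (c i k l)
      = sec_res F V (c j k l) \<otimes>\<^bsub>sections F V\<^esub> sec_res F V (c i j l)"
proof -
  let ?W = "U i \<inter> U j \<inter> U k \<inter> U l"
  have VW: "V \<subseteq> ?W" using V by blast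
  have cl: "sec_res F ?W (c i j k) \<in> carrier (sections F ?W)"
    "sec_res F ?W (c i k l) \<in> carrier (sections F ?W)"
    "sec_res F ?W (c j k l) \<in> carrier (sections F ?W)"
    "sec_res F ?W (c i j l) \<in> carrier (sections F ?W)"
    by (rule res_closed[OF _ cocycle_section[OF c]]; use ijkl in blast)+
  have "sec_res F ?W (c i j k) \<otimes>\<^bsub>sections F ?W\<^esub> sec_res F ?W (c i k l)
      = sec_res F ?W (c j k l) \<otimes>\<^bsub>sections F ?W\<^esub> sec_res F ?W (c i j l)"
    using c ijkl unfolding cech_cocycle_def Let_def by blast
  from arg_cong[OF this, of "sec_res F V"] show ?thesis
    by (simp add: res_mult[OF VW] cl res_res[OF VW])
qed

lemma cech_cocycle_pull:
  assumes c: "cech_cocycle F I U c" and r: "r \<in> K \<rightarrow> I" and W: "\<forall>k\<in>K. W k \<subseteq> U (r k)"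
  shows "cech_cocycle F K W (cech_pull F W r c)"
  unfolding cech_cocycle_def Let_def
proof (intro conjI ballI)
  fix k l m assume klm: "k \<in> K" "l \<in> K" "m \<in> K"
  show "cech_pull F W r c k l m \<in> carrier (sections F (W k \<inter> W l \<inter> W m))"
    unfolding cech_pull_def
    by (rule res_closed[OF _ cocycle_section[OF c]]) (use klm r W in \<open>fast+\<close>)
next
  fix k l m n assume klmn: "k \<in> K" "l \<in> K" "m \<in> K" "n \<in> K"
  let ?V = "W k \<inter> W l \<inter> W m \<inter> W n"
  have sub: "?V \<subseteq> W k \<inter> W l \<inter> W m" "?V \<subseteq> W k \<inter> W m \<inter> W n" "?V \<subseteq> W l \<inter> W m \<inter> W n"
    "?V \<subseteq> W k \<inter> W l \<inter> W n" by auto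
  show "sec_res F ?V (cech_pull F W r c k l m) \<otimes>\<^bsub>sections F ?V\<^esub> sec_res F ?V (cech_pull F W r c k m n)
      = sec_res F ?V (cech_pull F W r c l m n) \<otimes>\<^bsub>sections F ?V\<^esub> sec_res F ?V (cech_pull F W r c k l n)"
    unfolding cech_pull_def sub[THEN res_res]
    by (rule cocycle_identity[OF c]) (use klmn r W in \<open>fast+\<close>)
qed

lemma pull_pull:
  assumes "\<forall>k\<in>K. W k \<subseteq> U (r k)" "k \<in> K" "l \<in> K" "m \<in> K"
  shows "cech_pull F W r (cech_pull F U r' c) k l m = cech_pull F W (r' \<circ> r) c k l m"
proof -
  have "W k \<inter> W l \<inter> W m \<subseteq> U (r k) \<inter> U (r l) \<inter> U (r m)"
    using assms by blast
  then show ?thesis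
    by (simp add: cech_pull_def res_res)
qed

lemma cohomologous_pull_pull:
  assumes "\<forall>k\<in>K. W k \<subseteq> U (r k)"
  shows "cohomologous F K W (cech_pull F W r (cech_pull F U s c)) (cech_pull F W r (cech_pull F U t d))
    \<longleftrightarrow> cohomologous F K W (cech_pull F W (s \<circ> r) c) (cech_pull F W (t \<circ> r) d)"
  unfolding cohomologous_def by (simp only: pull_pull[where U = U and r = r, OF assms] cong: ball_cong)

text \<open>The value on \<open>i j k\<close>, restricted to \<open>V\<close>, of the coboundary of the 1-cochain \<open>b\<close>.\<close>

abbreviation (input) coboundary where
  "coboundary V b i j k \<equiv> sec_res F V (b i j) \<otimes>\<^bsub>sections F V\<^esub> sec_res F V (b j k)
     \<otimes>\<^bsub>sections F V\<^esub> inv\<^bsub>sections F V\<^esub> (sec_res F V (b i k))"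

lemma cohomologousE:
  assumes "cohomologous F I U c d"
  obtains b where "\<And>i j. i \<in> I \<Longrightarrow> j \<in> I \<Longrightarrow> b i j \<in> carrier (sections F (U i \<inter> U j))"
    "\<And>i j k W. \<lbrakk>i \<in> I; j \<in> I; k \<in> I; W = U i \<inter> U j \<inter> U k\<rbrakk> \<Longrightarrow> c i j k = d i j k \<otimes>\<^bsub>sections F W\<^esub>
        coboundary W b i j k"
  using assms unfolding cohomologous_def Let_def by blast

lemma cohomologousI:
  assumes "\<And>i j. i \<in> I \<Longrightarrow> j \<in> I \<Longrightarrow> b i j \<in> carrier (sections F (U i \<inter> U j))"
    "\<And>i j k W. \<lbrakk>i \<in> I; j \<in> I; k \<in> I; W = U i \<inter> U j \<inter> U k\<rbrakk> \<Longrightarrow> c i j k = d i j k \<otimes>\<^bsub>sections F W\<^esub>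
        coboundary W b i j k"
  shows "cohomologous F I U c d"
  unfolding cohomologous_def Let_def using assms by blast

lemma cohomologous_sym:
  assumes d: "cech_cocycle F I U d" and cd: "cohomologous F I U c d"
  shows "cohomologous F I U d c"
proof -
  obtain b where b: "\<And>i j. i \<in> I \<Longrightarrow> j \<in> I \<Longrightarrow> b i j \<in> carrier (sections F (U i \<inter> U j))"
    "\<And>i j k W. \<lbrakk>i \<in> I; j \<in> I; k \<in> I; W = U i \<inter> U j \<inter> U k\<rbrakk> \<Longrightarrow> c i j k = d i j k \<otimes>\<^bsub>sections F W\<^esub>
        coboundary W b i j k"
    using cohomologousE[OF cd] by blast
  show ?thesis
  proof (rule cohomologousI[where b = "\<lambda>i j. inv\<^bsub>sections F (U i \<inter> U j)\<^esub> (b i j)"])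
    fix i j assume "i \<in> I" "j \<in> I"
    then show "inv\<^bsub>sections F (U i \<inter> U j)\<^esub> (b i j) \<in> carrier (sections F (U i \<inter> U j))"
      by (intro inv_closed b(1))
  next
    fix i j k W assume ijk: "i \<in> I" "j \<in> I" "k \<in> I" and W: "W = U i \<inter> U j \<inter> U k"
    then have sub: "W \<subseteq> U i \<inter> U j" "W \<subseteq> U j \<inter> U k" "W \<subseteq> U i \<inter> U k" by auto
    interpret S: comm_group "sections F W" by (rule sections_comm_group)
    let ?B = "coboundary W b i j k"
    have cl: "sec_res F W (b i j) \<in> carrier (sections F W)" "sec_res F W (b j k) \<in> carrier (sections F W)"
      "sec_res F W (b i k) \<in> carrier (sections F W)"
      using res_closed[OF sub(1)] res_closed[OF sub(2)] res_closed[OF sub(3)] b(1) ijk by auto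
    have dW: "d i j k \<in> carrier (sections F W)"
      unfolding W by (rule cocycle_section[OF d ijk])
    have "d i j k = c i j k \<otimes>\<^bsub>sections F W\<^esub> inv\<^bsub>sections F W\<^esub> ?B"
      unfolding b(2)[OF ijk W] using dW cl by (simp add: S.m_assoc)
    also have "inv\<^bsub>sections F W\<^esub> ?B = inv\<^bsub>sections F W\<^esub> (sec_res F W (b i j)) \<otimes>\<^bsub>sections F W\<^esub>
        inv\<^bsub>sections F W\<^esub> (sec_res F W (b j k)) \<otimes>\<^bsub>sections F W\<^esub>
        inv\<^bsub>sections F W\<^esub> (inv\<^bsub>sections F W\<^esub> (sec_res F W (b i k)))"
      using S.inv_mult_mult[OF cl] by simp
    finally show "d i j k = c i j k \<otimes>\<^bsub>sections F W\<^esub>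
      coboundary W (\<lambda>i j. inv\<^bsub>sections F (U i \<inter> U j)\<^esub> (b i j)) i j k"
      using res_inv[OF sub(1)] res_inv[OF sub(2)] res_inv[OF sub(3)] b(1) ijk by simp
  qed
qed

lemma cohomologous_trans:
  assumes e: "cech_cocycle F I U e" and cd: "cohomologous F I U c d" and de: "cohomologous F I U d e"
  shows "cohomologous F I U c e"
proof -
  obtain b where b: "\<And>i j. i \<in> I \<Longrightarrow> j \<in> I \<Longrightarrow> b i j \<in> carrier (sections F (U i \<inter> U j))"
    "\<And>i j k W. \<lbrakk>i \<in> I; j \<in> I; k \<in> I; W = U i \<inter> U j \<inter> U k\<rbrakk> \<Longrightarrow> c i j k = d i j k \<otimes>\<^bsub>sections F W\<^esub>
        coboundary W b i j k"
    using cohomologousE[OF cd] by blast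
  obtain b' where b': "\<And>i j. i \<in> I \<Longrightarrow> j \<in> I \<Longrightarrow> b' i j \<in> carrier (sections F (U i \<inter> U j))"
    "\<And>i j k W. \<lbrakk>i \<in> I; j \<in> I; k \<in> I; W = U i \<inter> U j \<inter> U k\<rbrakk> \<Longrightarrow> d i j k = e i j k \<otimes>\<^bsub>sections F W\<^esub>
        coboundary W b' i j k"
    using cohomologousE[OF de] by blast
  show ?thesis
  proof (rule cohomologousI[where b = "\<lambda>i j. b' i j \<otimes>\<^bsub>sections F (U i \<inter> U j)\<^esub> b i j"])
    fix i j assume "i \<in> I" "j \<in> I"
    then show "b' i j \<otimes>\<^bsub>sections F (U i \<inter> U j)\<^esub> b i j \<in> carrier (sections F (U i \<inter> U j))"
      by (intro mult_closed b(1) b'(1))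
  next
    fix i j k W assume ijk: "i \<in> I" "j \<in> I" "k \<in> I" and W: "W = U i \<inter> U j \<inter> U k"
    then have sub: "W \<subseteq> U i \<inter> U j" "W \<subseteq> U j \<inter> U k" "W \<subseteq> U i \<inter> U k" by auto
    interpret S: comm_group "sections F W" by (rule sections_comm_group)
    have cl: "sec_res F W (b i j) \<in> carrier (sections F W)" "sec_res F W (b j k) \<in> carrier (sections F W)"
      "sec_res F W (b i k) \<in> carrier (sections F W)"
      "sec_res F W (b' i j) \<in> carrier (sections F W)" "sec_res F W (b' j k) \<in> carrier (sections F W)"
      "sec_res F W (b' i k) \<in> carrier (sections F W)"
      using res_closed[OF sub(1)] res_closed[OF sub(2)] res_closed[OF sub(3)] b(1) b'(1) ijk by auto
    have eW: "e i j k \<in> carrier (sections F W)"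
      unfolding W by (rule cocycle_section[OF e ijk])
    show "c i j k = e i j k \<otimes>\<^bsub>sections F W\<^esub>
      coboundary W (\<lambda>i j. b' i j \<otimes>\<^bsub>sections F (U i \<inter> U j)\<^esub> b i j) i j k"
      unfolding b(2)[OF ijk W] b'(2)[OF ijk W]
      using res_mult[OF sub(1)] res_mult[OF sub(2)] res_mult[OF sub(3)] b(1) b'(1) ijk cl eW
      by (simp add: S.m_ac S.inv_mult)
  qed
qed

lemma cohomologous_pull:
  assumes d: "cech_cocycle F I U d" and cd: "cohomologous F I U c d"
    and r: "r \<in> K \<rightarrow> I" and W: "\<forall>k\<in>K. W k \<subseteq> U (r k)"
  shows "cohomologous F K W (cech_pull F W r c) (cech_pull F W r d)"
proof -
  obtain b where b: "\<And>i j. i \<in> I \<Longrightarrow> j \<in> I \<Longrightarrow> b i j \<in> carrier (sections F (U i \<inter> U j))"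
    "\<And>i j k W. \<lbrakk>i \<in> I; j \<in> I; k \<in> I; W = U i \<inter> U j \<inter> U k\<rbrakk> \<Longrightarrow> c i j k = d i j k \<otimes>\<^bsub>sections F W\<^esub>
        coboundary W b i j k"
    using cohomologousE[OF cd] by blast
  show ?thesis
  proof (rule cohomologousI[where b = "\<lambda>k l. sec_res F (W k \<inter> W l) (b (r k) (r l))"])
    fix k l assume kl: "k \<in> K" "l \<in> K"
    then have "W k \<inter> W l \<subseteq> U (r k) \<inter> U (r l)" using W by blast
    then show "sec_res F (W k \<inter> W l) (b (r k) (r l)) \<in> carrier (sections F (W k \<inter> W l))"
      by (rule res_closed) (use b(1) kl r in blast)
  next
    fix k l m V assume klm: "k \<in> K" "l \<in> K" "m \<in> K" and V: "V = W k \<inter> W l \<inter> W m"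
    have rK: "r k \<in> I" "r l \<in> I" "r m \<in> I" using klm r by auto
    let ?T = "U (r k) \<inter> U (r l) \<inter> U (r m)"
    have VT: "V \<subseteq> ?T" using klm W V by blast
    have sub: "V \<subseteq> W k \<inter> W l" "V \<subseteq> W l \<inter> W m" "V \<subseteq> W k \<inter> W m" using V by auto
    have sT: "?T \<subseteq> U (r k) \<inter> U (r l)" "?T \<subseteq> U (r l) \<inter> U (r m)" "?T \<subseteq> U (r k) \<inter> U (r m)" by auto
    note cl = res_closed[OF sT(1) b(1)[OF rK(1,2)]] res_closed[OF sT(2) b(1)[OF rK(2,3)]]
      res_closed[OF sT(3) b(1)[OF rK(1,3)]] cocycle_section[OF d rK]
    show "cech_pull F W r c k l m = cech_pull F W r d k l m \<otimes>\<^bsub>sections F V\<^esub>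
      coboundary V (\<lambda>k l. sec_res F (W k \<inter> W l) (b (r k) (r l))) k l m"
      unfolding cech_pull_def V[symmetric] b(2)[OF rK refl] sub[THEN res_res]
      by (simp add: res_mult[OF VT] res_inv[OF VT] res_res[OF VT] cl mult_closed inv_closed)
  qed
qed

text \<open>Two refinement maps \<open>r\<close> and \<open>r'\<close> pull a cocycle back to cohomologous cocycles, by the
  cochain homotopy \<open>b k l = c (r k) (r l) (r' l) - c (r k) (r' k) (r' l)\<close>.\<close>

lemma cohomologous_refinements:
  assumes c: "cech_cocycle F I U c"
    and r: "r \<in> K \<rightarrow> I" "\<forall>k\<in>K. W k \<subseteq> U (r k)" and r': "r' \<in> K \<rightarrow> I" "\<forall>k\<in>K. W k \<subseteq> U (r' k)"
  shows "cohomologous F K W (cech_pull F W r c) (cech_pull F W r' c)"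
proof -
  define b where "b k l = (let V = W k \<inter> W l in sec_res F V (c (r k) (r l) (r' l))
      \<otimes>\<^bsub>sections F V\<^esub> inv\<^bsub>sections F V\<^esub> sec_res F V (c (r k) (r' k) (r' l)))" for k l
  have cl: "sec_res F V (c i j k) \<in> carrier (sections F V)"
    if "i \<in> I" "j \<in> I" "k \<in> I" "V \<subseteq> U i" "V \<subseteq> U j" "V \<subseteq> U k" for i j k V
    by (rule res_closed[OF _ cocycle_section[OF c]]) (use that in auto)
  have rI: "r k \<in> I" "r' k \<in> I" if "k \<in> K" for k
    using that r(1) r'(1) by auto
  have sub: "V \<subseteq> U (r k)" "V \<subseteq> U (r' k)" if "k \<in> K" "V \<subseteq> W k" for k V
    using that subset_trans[OF _ bspec[OF r(2)]] subset_trans[OF _ bspec[OF r'(2)]] by blast+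
  show ?thesis
  proof (rule cohomologousI[where b = b])
    fix k l assume "k \<in> K" "l \<in> K"
    then show "b k l \<in> carrier (sections F (W k \<inter> W l))"
      unfolding b_def Let_def by (intro mult_closed inv_closed cl rI sub) auto
  next
    fix k l m V assume klm: "k \<in> K" "l \<in> K" "m \<in> K" and V: "V = W k \<inter> W l \<inter> W m"
    have VW: "V \<subseteq> W k" "V \<subseteq> W l" "V \<subseteq> W m" and
      VW2: "V \<subseteq> W k \<inter> W l" "V \<subseteq> W l \<inter> W m" "V \<subseteq> W k \<inter> W m" using V by auto
    note I = rI[OF klm(1)] rI[OF klm(2)] rI[OF klm(3)]
    note S = sub[OF klm(1) VW(1)] sub[OF klm(2) VW(2)] sub[OF klm(3) VW(3)]
    interpret S: comm_group "sections F V" by (rule sections_comm_group)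
    have res_diff: "sec_res F V (sec_res F T x \<otimes>\<^bsub>sections F T\<^esub> inv\<^bsub>sections F T\<^esub> sec_res F T y)
        = sec_res F V x \<otimes>\<^bsub>sections F V\<^esub> inv\<^bsub>sections F V\<^esub> sec_res F V y"
      if "V \<subseteq> T" "sec_res F T x \<in> carrier (sections F T)" "sec_res F T y \<in> carrier (sections F T)" for T x y
      using that by (simp add: res_mult res_inv res_res inv_closed)
    have b: "sec_res F V (b k l) = sec_res F V (c (r k) (r l) (r' l))
        \<otimes>\<^bsub>sections F V\<^esub> inv\<^bsub>sections F V\<^esub> sec_res F V (c (r k) (r' k) (r' l))"
      if "k \<in> K" "l \<in> K" "V \<subseteq> W k \<inter> W l" for k l
      unfolding b_def Let_def by (intro res_diff cl rI sub that) (use that in auto)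
    show "cech_pull F W r c k l m = cech_pull F W r' c k l m \<otimes>\<^bsub>sections F V\<^esub> coboundary V b k l m"
      unfolding b[OF klm(1,2) VW2(1)] b[OF klm(2,3) VW2(2)] b[OF klm(1,3) VW2(3)]
      unfolding cech_pull_def V[symmetric]
      by (rule S.cocycle_homotopy[of _ _ _ _ _ _ _ _ "sec_res F V (c (r k) (r' l) (r' m))"
            "sec_res F V (c (r k) (r l) (r' m))"])
        (intro cl I S cocycle_identity[OF c])+
  qed
qed

lemma common_refinement:
  assumes "open_cover X K W" "open_cover X L Z"
  obtains N k l where "open_cover X (points X) N" "k \<in> points X \<rightarrow> K" "l \<in> points X \<rightarrow> L"
    "\<forall>x\<in>points X. N x \<subseteq> W (k x)" "\<forall>x\<in>points X. N x \<subseteq> Z (l x)"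
proof -
  have "\<forall>x\<in>points X. \<exists>k\<in>K. x \<in> W k" "\<forall>x\<in>points X. \<exists>l\<in>L. x \<in> Z l"
    using assms unfolding open_cover_def by blast+
  then obtain k l where kl: "\<And>x. x \<in> points X \<Longrightarrow> k x \<in> K \<and> x \<in> W (k x)"
    "\<And>x. x \<in> points X \<Longrightarrow> l x \<in> L \<and> x \<in> Z (l x)"
    by metis
  have "open_cover X (points X) (\<lambda>x. W (k x) \<inter> Z (l x))"
    using assms kl D_open_Int D_open_subset unfolding open_cover_def by fast
  then show ?thesis
    using that[of _ k l] kl by auto
qed

lemma cech_equiv_sym:
  assumes d: "cech_cocycle F J V d" and "cech_equiv X F I U c J V d"
  shows "cech_equiv X F J V d I U c"
  using assms(2) unfolding cech_equiv_def
  by (metis cohomologous_sym cech_cocycle_pull[OF d])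

text \<open>On a common refinement the middle cocycle is pulled back along two different refinement maps,
  and the homotopy between these closes the chain.\<close>

lemma cech_equiv_trans:
  assumes c: "cech_cocycle F I U c" and d: "cech_cocycle F J V d" and e: "cech_cocycle F L Z e"
    and cd: "cech_equiv X F I U c J V d" and de: "cech_equiv X F J V d L Z e"
  shows "cech_equiv X F I U c L Z e"
proof -
  obtain K :: "'x set" and W r r' where K: "open_cover X K W" "r \<in> K \<rightarrow> I" "\<forall>k\<in>K. W k \<subseteq> U (r k)"
    "r' \<in> K \<rightarrow> J" "\<forall>k\<in>K. W k \<subseteq> V (r' k)" and 1: "cohomologous F K W (cech_pull F W r c) (cech_pull F W r' d)"
    using cd unfolding cech_equiv_def by blast
  obtain K' :: "'x set" and W' t t' where K': "open_cover X K' W'" "t \<in> K' \<rightarrow> J" "\<forall>k\<in>K'. W' k \<subseteq> V (t k)"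
    "t' \<in> K' \<rightarrow> L" "\<forall>k\<in>K'. W' k \<subseteq> Z (t' k)" and 2: "cohomologous F K' W' (cech_pull F W' t d) (cech_pull F W' t' e)"
    using de unfolding cech_equiv_def by blast
  obtain N k l where N: "open_cover X (points X) N" "k \<in> points X \<rightarrow> K" "l \<in> points X \<rightarrow> K'"
    "\<forall>x\<in>points X. N x \<subseteq> W (k x)" "\<forall>x\<in>points X. N x \<subseteq> W' (l x)"
    using common_refinement[OF K(1) K'(1)] by metis
  have rk: "r \<circ> k \<in> points X \<rightarrow> I" "\<forall>x\<in>points X. N x \<subseteq> U ((r \<circ> k) x)"
    "r' \<circ> k \<in> points X \<rightarrow> J" "\<forall>x\<in>points X. N x \<subseteq> V ((r' \<circ> k) x)"
    using K(2-5) N(2,4) by fastforce+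
  have tl: "t \<circ> l \<in> points X \<rightarrow> J" "\<forall>x\<in>points X. N x \<subseteq> V ((t \<circ> l) x)"
    "t' \<circ> l \<in> points X \<rightarrow> L" "\<forall>x\<in>points X. N x \<subseteq> Z ((t' \<circ> l) x)"
    using K'(2-5) N(3,5) by fastforce+
  have "cohomologous F (points X) N (cech_pull F N k (cech_pull F W r c)) (cech_pull F N k (cech_pull F W r' d))"
    by (rule cohomologous_pull[OF cech_cocycle_pull[OF d K(4,5)] 1 N(2,4)])
  then have A: "cohomologous F (points X) N (cech_pull F N (r \<circ> k) c) (cech_pull F N (r' \<circ> k) d)"
    by (simp only: cohomologous_pull_pull[where U = W and r = k, OF N(4)])
  have "cohomologous F (points X) N (cech_pull F N l (cech_pull F W' t d)) (cech_pull F N l (cech_pull F W' t' e))"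
    by (rule cohomologous_pull[OF cech_cocycle_pull[OF e K'(4,5)] 2 N(3,5)])
  then have C: "cohomologous F (points X) N (cech_pull F N (t \<circ> l) d) (cech_pull F N (t' \<circ> l) e)"
    by (simp only: cohomologous_pull_pull[where U = W' and r = l, OF N(5)])
  have B: "cohomologous F (points X) N (cech_pull F N (r' \<circ> k) d) (cech_pull F N (t \<circ> l) d)"
    by (rule cohomologous_refinements[OF d rk(3,4) tl(1,2)])
  have "cohomologous F (points X) N (cech_pull F N (r \<circ> k) c) (cech_pull F N (t' \<circ> l) e)"
    using cohomologous_trans[OF cech_cocycle_pull[OF e tl(3,4)]
        cohomologous_trans[OF cech_cocycle_pull[OF d tl(1,2)] A B] C] .
  then show ?thesis
    unfolding cech_equiv_def using N(1) rk(1,2) tl(3,4) by blast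
qed

lemma cech_class_eqI:
  assumes c: "cech_cocycle F I U c" and d: "cech_cocycle F J V d"
    and cd: "cech_equiv X F I U c J V d"
  shows "cech_class X F I U c = cech_class X F J V d"
proof -
  have dc: "cech_equiv X F J V d I U c"
    by (rule cech_equiv_sym[OF d cd])
  show ?thesis
    unfolding cech_class_def
    using cech_equiv_trans[OF c d _ cd] cech_equiv_trans[OF d c _ dc] by blast
qed

lemma cech_class_in_H2:
  assumes U: "open_cover X I U" and c: "cech_cocycle F I U c"
  shows "cech_class X F I U c \<in> cech_H2 X F"
proof -
  obtain N k l where N: "open_cover X (points X) N" "k \<in> points X \<rightarrow> I" "\<forall>x\<in>points X. N x \<subseteq> U (k x)"
    using common_refinement[OF U U] by metis
  have coc: "cech_cocycle F (points X) N (cech_pull F N k c)"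
    by (rule cech_cocycle_pull[OF c N(2,3)])
  have "cohomologous F (points X) N (cech_pull F N k c) (cech_pull F N k c)"
    by (rule cohomologous_refinements[OF c N(2,3) N(2,3)])
  moreover have "cech_pull F N id (cech_pull F N k c) = cech_pull F N k c"
    by (simp add: cech_pull_def fun_eq_iff res_res)
  ultimately have "cech_equiv X F I U c (points X) N (cech_pull F N k c)"
    unfolding cech_equiv_def using N(1-3) by (metis (mono_tags) id_apply order_refl Pi_I)
  from cech_class_eqI[OF c coc this] show ?thesis
    unfolding cech_H2_def using N(1) coc by blast
qed

end

section \<open>The extension of semidirect products\<close>

locale lifting_problem =
  fixes X :: "'x dspace"
    and Gh :: "'k dgroup" and G :: "'g dgroup" and A :: "'k set" and q :: "'k \<Rightarrow> 'g"
    and \<sigma> :: "int \<Rightarrow> 'g \<Rightarrow> 'g" and \<sigma>h :: "int \<Rightarrow> 'k \<Rightarrow> 'k"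
    and P :: "('p, 'x, 'g \<times> int) pbundle"
    and I :: "'i set" and U :: "'i \<Rightarrow> 'x set" and s :: "'i \<Rightarrow> 'x \<Rightarrow> 'p"
    and g :: "'i \<Rightarrow> 'i \<Rightarrow> 'x \<Rightarrow> 'g" and \<epsilon> :: "'i \<Rightarrow> 'i \<Rightarrow> 'x \<Rightarrow> int"
    and gh :: "'i \<Rightarrow> 'i \<Rightarrow> 'x \<Rightarrow> 'k"
  assumes extension: "central_extension A Gh G q"
    and action: "Z2_action G \<sigma>"
    and action_hat: "Z2_action Gh \<sigma>h"
    and compatible: "\<forall>e\<in>Z2. \<forall>x\<in>carrier Gh. q (\<sigma>h e x) = \<sigma> e (q x)"
    and space: "diffeological_space X"
    and principal: "principal_bundle (semidirect G \<sigma>) X P"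
    and cover: "open_cover X I U"
    and transition: "transition_functions (semidirect G \<sigma>) X P I U s (\<lambda>i j u. (g i j u, \<epsilon> i j u))"
    and lifts: "\<forall>i\<in>I. \<forall>j\<in>I. smooth_map (sub_space X (U i \<inter> U j)) (dsp Gh) (gh i j) \<and>
                  (\<forall>u\<in>U i \<inter> U j. q (gh i j u) = g i j u)"
begin

abbreviation H where "H \<equiv> semidirect G \<sigma>"
abbreviation Hh where "Hh \<equiv> semidirect Gh \<sigma>h"

sublocale G: Z2_diffeological_group G \<sigma>
  using extension action by unfold_locales (auto simp: central_extension_def)

sublocale Gh: Z2_diffeological_group Gh \<sigma>h
  using extension action_hat by unfold_locales (auto simp: central_extension_def)

sublocale H: group H by (rule G.group_semidirect)
sublocale Hh: group Hh by (rule Gh.group_semidirect)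

sublocale P: diffeological_principal_bundle H X P
  by unfold_locales (rule G.diffeological_group_semidirect space principal)+

lemma q_hom: "group_hom Gh G q"
  using extension Gh.is_group G.is_group
  by (simp add: central_extension_def group_hom_def group_hom_axioms_def)

lemma q_closed [simp]: "x \<in> carrier Gh \<Longrightarrow> q x \<in> carrier G"
  by (rule group_hom.hom_closed[OF q_hom])

lemma q_mult [simp]: "x \<in> carrier Gh \<Longrightarrow> y \<in> carrier Gh \<Longrightarrow> q (x \<otimes>\<^bsub>Gh\<^esub> y) = q x \<otimes>\<^bsub>G\<^esub> q y"
  by (rule group_hom.hom_mult[OF q_hom])

lemma q_action [simp]: "e \<in> Z2 \<Longrightarrow> x \<in> carrier Gh \<Longrightarrow> q (\<sigma>h e x) = \<sigma> e (q x)"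
  using compatible by blast

lemma q_quotient: "quotient_space (dsp Gh) q = dsp G"
  using extension by (simp add: central_extension_def subduction_def)

lemma q_image: "q ` carrier Gh = carrier G"
  using arg_cong[OF q_quotient, of points] by (simp add: quotient_space_def)

lemma A_iff: "a \<in> A \<longleftrightarrow> a \<in> carrier Gh \<and> q a = \<one>\<^bsub>G\<^esub>"
  using extension by (simp add: central_extension_def kernel_def)

lemma A_carrier [simp]: "a \<in> A \<Longrightarrow> a \<in> carrier Gh"
  by (simp add: A_iff)

lemma A_central: "a \<in> A \<Longrightarrow> x \<in> carrier Gh \<Longrightarrow> a \<otimes>\<^bsub>Gh\<^esub> x = x \<otimes>\<^bsub>Gh\<^esub> a"
  using extension unfolding central_extension_def by blast

lemma A_one [simp]: "\<one>\<^bsub>Gh\<^esub> \<in> A"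
  and A_mult [simp]: "a \<in> A \<Longrightarrow> b \<in> A \<Longrightarrow> a \<otimes>\<^bsub>Gh\<^esub> b \<in> A"
  and A_inv [simp]: "a \<in> A \<Longrightarrow> inv\<^bsub>Gh\<^esub> a \<in> A"
  and A_action [simp]: "a \<in> A \<Longrightarrow> e \<in> Z2 \<Longrightarrow> \<sigma>h e a \<in> A"
  by (auto simp: A_iff group_hom.hom_one[OF q_hom] group_hom.hom_inv[OF q_hom])

abbreviation \<rho> where "\<rho> \<equiv> map_prod q (id :: int \<Rightarrow> int)"

definition \<iota> :: "'k \<Rightarrow> 'k \<times> int" where "\<iota> a = (a, 1)"

lemma \<rho>_closed [simp]: "h \<in> carrier Hh \<Longrightarrow> \<rho> h \<in> carrier H"
  by (auto simp: Gh.carrier_semidirect G.carrier_semidirect)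

lemma \<rho>_mult: "h \<in> carrier Hh \<Longrightarrow> h' \<in> carrier Hh \<Longrightarrow> \<rho> (h \<otimes>\<^bsub>Hh\<^esub> h') = \<rho> h \<otimes>\<^bsub>H\<^esub> \<rho> h'"
  by (auto simp: Gh.carrier_semidirect)

lemma \<rho>_surj: assumes "k \<in> carrier H" obtains h where "h \<in> carrier Hh" "\<rho> h = k"
proof -
  obtain x e where k: "k = (x, e)" "x \<in> carrier G" "e \<in> Z2"
    using assms by (auto simp: G.carrier_semidirect)
  then obtain y where "y \<in> carrier Gh" "q y = x"
    using q_image by (metis imageE)
  then show ?thesis using k that[of "(y, e)"] by (simp add: Gh.carrier_semidirect)
qed

lemma \<iota>_carrier [simp]: "a \<in> A \<Longrightarrow> \<iota> a \<in> carrier Hh"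
  by (simp add: \<iota>_def Gh.carrier_semidirect)

lemma \<iota>_mult: "a \<in> A \<Longrightarrow> b \<in> A \<Longrightarrow> \<iota> a \<otimes>\<^bsub>Hh\<^esub> \<iota> b = \<iota> (a \<otimes>\<^bsub>Gh\<^esub> b)"
  by (simp add: \<iota>_def)

lemma \<iota>_one: "\<iota> \<one>\<^bsub>Gh\<^esub> = \<one>\<^bsub>Hh\<^esub>"
  by (simp add: \<iota>_def Gh.one_semidirect)

lemma \<iota>_inv: "a \<in> A \<Longrightarrow> inv\<^bsub>Hh\<^esub> (\<iota> a) = \<iota> (inv\<^bsub>Gh\<^esub> a)"
  by (simp add: \<iota>_def Gh.inv_semidirect)

lemma \<iota>_eq_iff [simp]: "\<iota> a = \<iota> b \<longleftrightarrow> a = b"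
  by (simp add: \<iota>_def)

lemma snd_\<iota> [simp]: "snd (\<iota> c) = 1"
  by (simp add: \<iota>_def)

lemma \<iota>_kernel: "A \<times> {1} = \<iota> ` A"
  by (auto simp: \<iota>_def)

lemma \<rho>_\<iota>: "a \<in> A \<Longrightarrow> \<rho> (\<iota> a) = \<one>\<^bsub>H\<^esub>"
  by (simp add: \<iota>_def A_iff G.one_semidirect)

lemma \<rho>_one: "\<rho> \<one>\<^bsub>Hh\<^esub> = \<one>\<^bsub>H\<^esub>"
  using \<rho>_\<iota>[OF A_one] by (simp add: \<iota>_one)

lemma \<rho>_inv: "h \<in> carrier Hh \<Longrightarrow> \<rho> (inv\<^bsub>Hh\<^esub> h) = inv\<^bsub>H\<^esub> (\<rho> h)"
  using H.inv_equality[of "\<rho> (inv\<^bsub>Hh\<^esub> h)" "\<rho> h"] by (simp flip: \<rho>_mult add: \<rho>_one del: map_prod_simp)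

text \<open>\<open>A\<close> is normal rather than central in the semidirect product: moving an element of \<open>A\<close>
  past \<open>h\<close> applies the \<open>Z2\<close>-component of \<open>h\<close>. This is the source of the twist.\<close>

lemma twisted_central:
  assumes "h \<in> carrier Hh" "a \<in> A" shows "h \<otimes>\<^bsub>Hh\<^esub> \<iota> a = \<iota> (\<sigma>h (snd h) a) \<otimes>\<^bsub>Hh\<^esub> h"
  using assms A_central[of "\<sigma>h (snd h) a" "fst h"]
  by (cases h) (simp add: \<iota>_def Gh.carrier_semidirect)

text \<open>Exactness of the extension of semidirect products, in the form in which two lifts are compared.\<close>

lemma same_image:
  assumes "h \<in> carrier Hh" "h' \<in> carrier Hh" "\<rho> h = \<rho> h'"
  obtains a where "a \<in> A" "h' = \<iota> a \<otimes>\<^bsub>Hh\<^esub> h"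
proof -
  obtain x x' e where h: "h = (x, e)" "h' = (x', e)" "x \<in> carrier Gh" "x' \<in> carrier Gh" "e \<in> Z2" "q x = q x'"
    using assms by (cases h; cases h') (auto simp: Gh.carrier_semidirect)
  have "x' \<otimes>\<^bsub>Gh\<^esub> inv\<^bsub>Gh\<^esub> x \<in> A"
    using h by (simp add: A_iff group_hom.hom_inv[OF q_hom])
  moreover have "h' = \<iota> (x' \<otimes>\<^bsub>Gh\<^esub> inv\<^bsub>Gh\<^esub> x) \<otimes>\<^bsub>Hh\<^esub> h"
    using h by (simp add: \<iota>_def Gh.m_assoc)
  ultimately show ?thesis by (rule that)
qed

lemma same_image_right:
  assumes "h \<in> carrier Hh" "h' \<in> carrier Hh" "\<rho> h = \<rho> h'"
  obtains a where "a \<in> A" "h' = h \<otimes>\<^bsub>Hh\<^esub> \<iota> a"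
proof -
  obtain a where a: "a \<in> A" "h' = \<iota> a \<otimes>\<^bsub>Hh\<^esub> h"
    using same_image[OF assms] .
  have e: "snd h \<in> Z2" using assms(1) by (auto simp: Gh.carrier_semidirect)
  have "h \<otimes>\<^bsub>Hh\<^esub> \<iota> (\<sigma>h (snd h) a) = h'"
    using twisted_central[OF assms(1), of "\<sigma>h (snd h) a"] a e by simp
  then show ?thesis using that[of "\<sigma>h (snd h) a"] a e by auto
qed

lemma plot_\<iota>:
  "p \<in> plots (dsp Gh) n V \<Longrightarrow> (\<lambda>v. \<iota> (p v)) \<in> plots (dsp Hh) n V"
  using plot_const[OF diffeological_discrete_space, of n V 1 Z2]
    plot_openin[OF diffeological_group_space[OF Gh.diffeological]]
  by (simp add: \<iota>_def Gh.plots_semidirect)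


section \<open>The twisted cocycle\<close>

lemma U_subset: "i \<in> I \<Longrightarrow> U i \<subseteq> points X"
  using cover D_open_subset by (auto simp: open_cover_def)

definition h where "h i j u = (g i j u, \<epsilon> i j u)"

lemma section_s: "i \<in> I \<Longrightarrow> smooth_map (sub_space X (U i)) (total_space P) (s i)"
  and proj_s: "i \<in> I \<Longrightarrow> u \<in> U i \<Longrightarrow> proj P (s i u) = u"
  and h_smooth: "i \<in> I \<Longrightarrow> j \<in> I \<Longrightarrow> smooth_map (sub_space X (U i \<inter> U j)) (dsp H) (h i j)"
  and s_h: "i \<in> I \<Longrightarrow> j \<in> I \<Longrightarrow> u \<in> U i \<Longrightarrow> u \<in> U j \<Longrightarrow> s j u = act P (s i u) (h i j u)"
proof -
  have "transition_functions H X P I U s h"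
    using transition by (simp add: h_def[abs_def])
  then show "i \<in> I \<Longrightarrow> smooth_map (sub_space X (U i)) (total_space P) (s i)"
    "i \<in> I \<Longrightarrow> u \<in> U i \<Longrightarrow> proj P (s i u) = u"
    "i \<in> I \<Longrightarrow> j \<in> I \<Longrightarrow> smooth_map (sub_space X (U i \<inter> U j)) (dsp H) (h i j)"
    "i \<in> I \<Longrightarrow> j \<in> I \<Longrightarrow> u \<in> U i \<Longrightarrow> u \<in> U j \<Longrightarrow> s j u = act P (s i u) (h i j u)"
    unfolding transition_functions_def by blast+
qed

lemma s_in: "i \<in> I \<Longrightarrow> u \<in> U i \<Longrightarrow> s i u \<in> tot P"
  using smooth_map_point[OF section_s] U_subset by auto

lemma h_in: "i \<in> I \<Longrightarrow> j \<in> I \<Longrightarrow> u \<in> U i \<Longrightarrow> u \<in> U j \<Longrightarrow> h i j u \<in> carrier H"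
  using smooth_map_point[OF h_smooth, of i j u] U_subset[of i] by auto

lemma h_cocycle:
  assumes "i \<in> I" "j \<in> I" "k \<in> I" "u \<in> U i" "u \<in> U j" "u \<in> U k"
  shows "h i j u \<otimes>\<^bsub>H\<^esub> h j k u = h i k u"
proof (rule P.act_free[of "s i u"])
  show "act P (s i u) (h i j u \<otimes>\<^bsub>H\<^esub> h j k u) = act P (s i u) (h i k u)"
    using assms by (simp add: s_in h_in flip: P.act_act s_h)
qed (use assms in \<open>simp_all add: s_in h_in\<close>)

lemma \<epsilon>_Z2 [simp]: "i \<in> I \<Longrightarrow> j \<in> I \<Longrightarrow> u \<in> U i \<Longrightarrow> u \<in> U j \<Longrightarrow> \<epsilon> i j u \<in> Z2"
  using h_in[of i j u] by (simp add: h_def G.carrier_semidirect)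

lemma \<epsilon>_cocycle:
  "\<lbrakk>i \<in> I; j \<in> I; k \<in> I; u \<in> U i; u \<in> U j; u \<in> U k\<rbrakk> \<Longrightarrow> \<epsilon> i j u * \<epsilon> j k u = \<epsilon> i k u"
  using h_cocycle[of i j k u] by (simp add: h_def)

lemma \<epsilon>_diagonal [simp]: "i \<in> I \<Longrightarrow> u \<in> U i \<Longrightarrow> \<epsilon> i i u = 1"
  using \<epsilon>_cocycle[of i i i u] \<epsilon>_Z2[of i i u] by (auto simp: Z2_def)

lemma \<epsilon>_plot:
  assumes "i \<in> I" "j \<in> I" "p \<in> plots X n V" "\<And>v. v \<in> V \<Longrightarrow> p v \<in> U i \<and> p v \<in> U j"
  shows "(\<lambda>v. \<epsilon> i j (p v)) \<in> plots (discrete_space Z2) n V"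
  using smooth_map_plot[OF h_smooth[OF assms(1,2)], of p n V] assms(3,4)
  by (simp add: plots_sub_space G.plots_semidirect h_def)

text \<open>The chosen lifts \<open>gh i j\<close> assemble to lifts of the transition functions to the extended
  semidirect product, and \<open>a i j k\<close> is their failure to be a cocycle.\<close>

definition hh where "hh i j u = (gh i j u, \<epsilon> i j u)"

lemma gh_in [simp]: "i \<in> I \<Longrightarrow> j \<in> I \<Longrightarrow> u \<in> U i \<Longrightarrow> u \<in> U j \<Longrightarrow> gh i j u \<in> carrier Gh"
  using lifts smooth_map_point[of "sub_space X (U i \<inter> U j)" "dsp Gh" "gh i j" u] U_subset[of i] by auto

lemma hh_in [simp]: "i \<in> I \<Longrightarrow> j \<in> I \<Longrightarrow> u \<in> U i \<Longrightarrow> u \<in> U j \<Longrightarrow> hh i j u \<in> carrier Hh"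
  by (simp add: hh_def Gh.carrier_semidirect)

lemma snd_hh [simp]: "snd (hh i j u) = \<epsilon> i j u"
  by (simp add: hh_def)

lemma \<rho>_hh: "i \<in> I \<Longrightarrow> j \<in> I \<Longrightarrow> u \<in> U i \<Longrightarrow> u \<in> U j \<Longrightarrow> \<rho> (hh i j u) = h i j u"
  using lifts by (simp add: hh_def h_def)

lemma gh_plot:
  assumes "i \<in> I" "j \<in> I" "p \<in> plots X n V" "\<And>v. v \<in> V \<Longrightarrow> p v \<in> U i \<and> p v \<in> U j"
  shows "(\<lambda>v. gh i j (p v)) \<in> plots (dsp Gh) n V"
  using smooth_map_plot[of "sub_space X (U i \<inter> U j)" "dsp Gh" "gh i j" p n V] lifts assms
  by (simp add: plots_sub_space)

lemma hh_plot:
  assumes "i \<in> I" "j \<in> I" "p \<in> plots X n V" "\<And>v. v \<in> V \<Longrightarrow> p v \<in> U i \<and> p v \<in> U j"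
  shows "(\<lambda>v. hh i j (p v)) \<in> plots (dsp Hh) n V"
  using gh_plot[OF assms] \<epsilon>_plot[OF assms] by (simp add: hh_def Gh.plots_semidirect)

definition a where
  "a i j k u = gh i j u \<otimes>\<^bsub>Gh\<^esub> \<sigma>h (\<epsilon> i j u) (gh j k u) \<otimes>\<^bsub>Gh\<^esub> inv\<^bsub>Gh\<^esub> (gh i k u)"

lemma hh_defect:
  assumes "i \<in> I" "j \<in> I" "k \<in> I" "u \<in> U i" "u \<in> U j" "u \<in> U k"
  shows "a i j k u \<in> A" "hh i j u \<otimes>\<^bsub>Hh\<^esub> hh j k u = \<iota> (a i j k u) \<otimes>\<^bsub>Hh\<^esub> hh i k u"
proof -
  show eq: "hh i j u \<otimes>\<^bsub>Hh\<^esub> hh j k u = \<iota> (a i j k u) \<otimes>\<^bsub>Hh\<^esub> hh i k u"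
    using assms by (simp add: hh_def \<iota>_def a_def \<epsilon>_cocycle Gh.m_assoc)
  have "\<rho> (hh i j u \<otimes>\<^bsub>Hh\<^esub> hh j k u) = \<rho> (hh i k u)"
    using assms h_cocycle by (simp add: \<rho>_mult \<rho>_hh)
  then obtain b where b: "b \<in> A" "hh i j u \<otimes>\<^bsub>Hh\<^esub> hh j k u = \<iota> b \<otimes>\<^bsub>Hh\<^esub> hh i k u"
    using same_image[of "hh i k u" "hh i j u \<otimes>\<^bsub>Hh\<^esub> hh j k u"] assms by (metis Hh.m_closed hh_in)
  have "a i j k u \<in> carrier Gh"
    using assms by (simp add: a_def)
  then have "\<iota> (a i j k u) \<in> carrier Hh"
    by (simp add: \<iota>_def Gh.carrier_semidirect)
  moreover have "\<iota> b \<otimes>\<^bsub>Hh\<^esub> hh i k u = \<iota> (a i j k u) \<otimes>\<^bsub>Hh\<^esub> hh i k u"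
    using b(2) eq by simp
  ultimately have "\<iota> b = \<iota> (a i j k u)"
    using Hh.right_cancel[OF hh_in[OF assms(1,3,4,6)] \<iota>_carrier[OF b(1)]] by blast
  with b(1) show "a i j k u \<in> A" by simp
qed

lemma a_plot:
  assumes "i \<in> I" "j \<in> I" "k \<in> I" "p \<in> plots X n V" "\<And>v. v \<in> V \<Longrightarrow> p v \<in> U i \<and> p v \<in> U j \<and> p v \<in> U k"
  shows "(\<lambda>v. a i j k (p v)) \<in> plots (dsp Gh) n V"
  unfolding a_def using assms
  by (intro plot_mult plot_inv Gh.action_plot Gh.diffeological gh_plot \<epsilon>_plot) auto

text \<open>Both sides measure the failure of \<open>hh i j \<otimes> hh j k \<otimes> hh k l\<close> to be \<open>hh i l\<close>, with the two
  bracketings; the action enters because \<open>hh i j\<close> has to be moved past \<open>a j k l\<close>.\<close>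

lemma a_cocycle:
  assumes I: "i \<in> I" "j \<in> I" "k \<in> I" "l \<in> I" and u: "u \<in> U i" "u \<in> U j" "u \<in> U k" "u \<in> U l"
  shows "a i j k u \<otimes>\<^bsub>Gh\<^esub> a i k l u = \<sigma>h (\<epsilon> i j u) (a j k l u) \<otimes>\<^bsub>Gh\<^esub> a i j l u"
proof -
  note D = hh_defect(2)[of _ _ _ u] and c = hh_defect(1)[of _ _ _ u]
  have "\<iota> (a i j k u) \<otimes>\<^bsub>Hh\<^esub> \<iota> (a i k l u) \<otimes>\<^bsub>Hh\<^esub> hh i l u
      = \<iota> (a i j k u) \<otimes>\<^bsub>Hh\<^esub> (hh i k u \<otimes>\<^bsub>Hh\<^esub> hh k l u)"
    using I u by (simp add: D c Hh.m_assoc)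
  also have "\<dots> = hh i j u \<otimes>\<^bsub>Hh\<^esub> (hh j k u \<otimes>\<^bsub>Hh\<^esub> hh k l u)"
    using I u D[of i j k] by (simp add: c Hh.m_assoc[symmetric] del: Gh.mult_semidirect)
  also have "\<dots> = hh i j u \<otimes>\<^bsub>Hh\<^esub> \<iota> (a j k l u) \<otimes>\<^bsub>Hh\<^esub> hh j l u"
    using I u by (simp add: D c Hh.m_assoc)
  also have "\<dots> = \<iota> (\<sigma>h (\<epsilon> i j u) (a j k l u)) \<otimes>\<^bsub>Hh\<^esub> (hh i j u \<otimes>\<^bsub>Hh\<^esub> hh j l u)"
    using I u by (simp add: twisted_central c Hh.m_assoc)
  also have "\<dots> = \<iota> (\<sigma>h (\<epsilon> i j u) (a j k l u)) \<otimes>\<^bsub>Hh\<^esub> \<iota> (a i j l u) \<otimes>\<^bsub>Hh\<^esub> hh i l u"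
    using I u by (simp add: D c Hh.m_assoc)
  finally show ?thesis
    using I u by (simp add: c \<iota>_mult)
qed

lemma smooth_into_A:
  assumes "\<And>u. u \<in> points X \<inter> V \<Longrightarrow> f u \<in> A"
    and "\<And>n W p. p \<in> plots X n W \<Longrightarrow> (\<And>w. w \<in> W \<Longrightarrow> p w \<in> V) \<Longrightarrow> (\<lambda>w. f (p w)) \<in> plots (dsp Gh) n W"
  shows "smooth_map (sub_space X V) (sub_space (dsp Gh) A) f"
  using assms plot_in_points[OF space] by (intro smooth_mapI) (auto simp: plots_sub_space)

lemma twisted_cocycle_a: "twisted_cocycle X Gh A \<sigma>h I U \<epsilon> a"
  unfolding twisted_cocycle_def
  by (intro conjI ballI smooth_into_A a_cocycle a_plot hh_defect(1)) auto


section \<open>The local system\<close>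

abbreviation F where "F \<equiv> local_system X Gh A \<sigma>h I U \<epsilon>"

lemma section_iff:
  "t \<in> carrier (sections F V) \<longleftrightarrow> t \<in> (\<Pi>\<^sub>E i\<in>I. (V \<inter> U i) \<rightarrow>\<^sub>E A) \<and>
     (\<forall>i\<in>I. smooth_map (sub_space X (V \<inter> U i)) (sub_space (dsp Gh) A) (t i)) \<and>
     (\<forall>i\<in>I. \<forall>j\<in>I. \<forall>u\<in>V \<inter> U i \<inter> U j. t i u = \<sigma>h (\<epsilon> i j u) (t j u))"
  by (simp add: local_system_def)

lemma section_in_A: "t \<in> carrier (sections F V) \<Longrightarrow> i \<in> I \<Longrightarrow> u \<in> V \<Longrightarrow> u \<in> U i \<Longrightarrow> t i u \<in> A"
  unfolding section_iff by (elim conjE) (blast dest: PiE_mem)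

lemma section_twist:
  "t \<in> carrier (sections F V) \<Longrightarrow> i \<in> I \<Longrightarrow> j \<in> I \<Longrightarrow> u \<in> V \<Longrightarrow> u \<in> U i \<Longrightarrow> u \<in> U j \<Longrightarrow>
    t i u = \<sigma>h (\<epsilon> i j u) (t j u)"
  unfolding section_iff by blast

lemma section_smooth:
  "t \<in> carrier (sections F V) \<Longrightarrow> i \<in> I \<Longrightarrow>
    smooth_map (sub_space X (V \<inter> U i)) (sub_space (dsp Gh) A) (t i)"
  unfolding section_iff by blast

lemma section_plot:
  assumes "t \<in> carrier (sections F V)" "i \<in> I" "p \<in> plots X n W" "\<And>w. w \<in> W \<Longrightarrow> p w \<in> V \<and> p w \<in> U i"
  shows "(\<lambda>w. t i (p w)) \<in> plots (dsp Gh) n W"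
  using smooth_map_plot[of "sub_space X (V \<inter> U i)" "sub_space (dsp Gh) A" "t i" p n W] section_smooth assms
  by (simp add: plots_sub_space)

lemma sectionI:
  assumes A: "\<And>i u. i \<in> I \<Longrightarrow> u \<in> V \<Longrightarrow> u \<in> U i \<Longrightarrow> f i u \<in> A"
    and p: "\<And>i n W p. i \<in> I \<Longrightarrow> p \<in> plots X n W \<Longrightarrow> (\<And>w. w \<in> W \<Longrightarrow> p w \<in> V \<and> p w \<in> U i) \<Longrightarrow>
        (\<lambda>w. f i (p w)) \<in> plots (dsp Gh) n W"
    and tw: "\<And>i j u. i \<in> I \<Longrightarrow> j \<in> I \<Longrightarrow> u \<in> V \<Longrightarrow> u \<in> U i \<Longrightarrow> u \<in> U j \<Longrightarrow> f i u = \<sigma>h (\<epsilon> i j u) (f j u)"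
  shows "(\<lambda>i\<in>I. \<lambda>u\<in>V \<inter> U i. f i u) \<in> carrier (sections F V)"
  unfolding section_iff
proof (intro conjI ballI)
  fix i assume i: "i \<in> I"
  show "smooth_map (sub_space X (V \<inter> U i)) (sub_space (dsp Gh) A) ((\<lambda>i\<in>I. \<lambda>u\<in>V \<inter> U i. f i u) i)"
  proof (rule smooth_into_A)
    fix n W r assume r: "r \<in> plots X n W" "\<And>w. w \<in> W \<Longrightarrow> r w \<in> V \<inter> U i"
    then have "(\<lambda>w. f i (r w)) \<in> plots (dsp Gh) n W"
      using p[OF i] by auto
    then show "(\<lambda>w. (\<lambda>i\<in>I. \<lambda>u\<in>V \<inter> U i. f i u) i (r w)) \<in> plots (dsp Gh) n W"
      by (rule plot_cong[OF diffeological_group_space[OF Gh.diffeological]]) (use i r in auto)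
  qed (use i A in auto)
next
  fix i j u assume "i \<in> I" "j \<in> I" "u \<in> V \<inter> U i \<inter> U j"
  then show "(\<lambda>i\<in>I. \<lambda>u\<in>V \<inter> U i. f i u) i u = \<sigma>h (\<epsilon> i j u) ((\<lambda>i\<in>I. \<lambda>u\<in>V \<inter> U i. f i u) j u)"
    using tw[of i j u] by simp
qed (use A in auto)

text \<open>The value of a section at a point in one frame determines its value in all others.\<close>

lemma section_eqI:
  assumes t: "t \<in> carrier (sections F V)" "t' \<in> carrier (sections F V)"
    and eq: "\<And>u. u \<in> V \<Longrightarrow> u \<in> points X \<Longrightarrow> \<exists>i\<in>I. u \<in> U i \<and> t i u = t' i u"
  shows "t = t'"
proof -
  have "t j u = t' j u" if j: "j \<in> I" and u: "u \<in> V \<inter> U j" for j u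
  proof -
    obtain i where "i \<in> I" "u \<in> U i" "t i u = t' i u"
      using eq[of u] u U_subset[OF j] by auto
    then show ?thesis
      using section_twist[OF t(1) j, of i u] section_twist[OF t(2) j, of i u] u by auto
  qed
  note eq' = this
  have ext: "t \<in> (\<Pi>\<^sub>E i\<in>I. (V \<inter> U i) \<rightarrow>\<^sub>E A)" "t' \<in> (\<Pi>\<^sub>E i\<in>I. (V \<inter> U i) \<rightarrow>\<^sub>E A)"
    using t unfolding section_iff by blast+
  show ?thesis
  proof (rule PiE_ext[OF ext])
    fix j assume j: "j \<in> I"
    show "t j = t' j"
      by (rule PiE_ext[OF PiE_mem[OF ext(1) j] PiE_mem[OF ext(2) j] eq'[OF j]])
  qed
qed

lemma section_mult_eq: "t \<otimes>\<^bsub>sections F V\<^esub> t' = (\<lambda>i\<in>I. \<lambda>u\<in>V \<inter> U i. t i u \<otimes>\<^bsub>Gh\<^esub> t' i u)"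
  and section_one_eq: "\<one>\<^bsub>sections F V\<^esub> = (\<lambda>i\<in>I. \<lambda>u\<in>V \<inter> U i. \<one>\<^bsub>Gh\<^esub>)"
  and section_res_eq: "sec_res F V t = (\<lambda>i\<in>I. \<lambda>u\<in>V \<inter> U i. t i u)"
  by (simp_all add: local_system_def)

lemma section_mult [simp]:
  "i \<in> I \<Longrightarrow> u \<in> V \<Longrightarrow> u \<in> U i \<Longrightarrow> (t \<otimes>\<^bsub>sections F V\<^esub> t') i u = t i u \<otimes>\<^bsub>Gh\<^esub> t' i u"
  by (simp add: section_mult_eq)

lemma section_res [simp]: "i \<in> I \<Longrightarrow> u \<in> V \<Longrightarrow> u \<in> U i \<Longrightarrow> sec_res F V t i u = t i u"
  by (simp add: section_res_eq)

lemma section_mult_closed: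
  assumes "t \<in> carrier (sections F V)" "t' \<in> carrier (sections F V)"
  shows "t \<otimes>\<^bsub>sections F V\<^esub> t' \<in> carrier (sections F V)"
  unfolding section_mult_eq
proof (rule sectionI)
  fix i j u assume "i \<in> I" "j \<in> I" "u \<in> V" "u \<in> U i" "u \<in> U j"
  then show "t i u \<otimes>\<^bsub>Gh\<^esub> t' i u = \<sigma>h (\<epsilon> i j u) (t j u \<otimes>\<^bsub>Gh\<^esub> t' j u)"
    using section_twist[of _ V i j u] section_in_A[of _ V j u] assms by (simp add: Gh.action_mult)
qed (use assms section_in_A section_plot in \<open>auto intro!: plot_mult[OF Gh.diffeological]\<close>)

lemma section_inv_closed:
  assumes "t \<in> carrier (sections F V)"
  shows "(\<lambda>i\<in>I. \<lambda>u\<in>V \<inter> U i. inv\<^bsub>Gh\<^esub> (t i u)) \<in> carrier (sections F V)"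
proof (rule sectionI)
  fix i j u assume "i \<in> I" "j \<in> I" "u \<in> V" "u \<in> U i" "u \<in> U j"
  then show "inv\<^bsub>Gh\<^esub> (t i u) = \<sigma>h (\<epsilon> i j u) (inv\<^bsub>Gh\<^esub> (t j u))"
    using section_twist[OF assms, of i j u] section_in_A[OF assms, of j u] by (simp add: Gh.action_inv)
qed (use assms section_in_A section_plot in \<open>auto intro!: plot_inv[OF Gh.diffeological]\<close>)

lemma section_one_closed: "\<one>\<^bsub>sections F V\<^esub> \<in> carrier (sections F V)"
  unfolding section_one_eq
  by (rule sectionI) (auto intro: plot_const[OF diffeological_group_space[OF Gh.diffeological]]
      plot_openin[OF space])

lemma section_res_closed:
  assumes "V \<subseteq> W" "t \<in> carrier (sections F W)" shows "sec_res F V t \<in> carrier (sections F V)"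
  unfolding section_res_eq
  by (rule sectionI) (use assms in \<open>auto intro: section_in_A section_plot section_twist\<close>)

lemma cover_point: "u \<in> points X \<Longrightarrow> \<exists>i\<in>I. u \<in> U i"
  using cover by (auto simp: open_cover_def)

lemma sections_comm_group: "comm_group (sections F V)"
proof (rule comm_groupI)
  fix t t' t'' assume t: "t \<in> carrier (sections F V)" "t' \<in> carrier (sections F V)" "t'' \<in> carrier (sections F V)"
  show "t \<otimes>\<^bsub>sections F V\<^esub> t' \<otimes>\<^bsub>sections F V\<^esub> t'' = t \<otimes>\<^bsub>sections F V\<^esub> (t' \<otimes>\<^bsub>sections F V\<^esub> t'')"
    by (rule section_eqI)
      (use cover_point t in \<open>fastforce simp: section_in_A Gh.m_assoc intro: section_mult_closed\<close>)+
next
  fix t t' assume t: "t \<in> carrier (sections F V)" "t' \<in> carrier (sections F V)"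
  show "t \<otimes>\<^bsub>sections F V\<^esub> t' = t' \<otimes>\<^bsub>sections F V\<^esub> t"
    by (rule section_eqI)
      (use cover_point t in \<open>fastforce simp: section_in_A A_central intro: section_mult_closed\<close>)+
next
  fix t assume t: "t \<in> carrier (sections F V)"
  show "\<one>\<^bsub>sections F V\<^esub> \<otimes>\<^bsub>sections F V\<^esub> t = t"
    by (rule section_eqI)
      (use cover_point t section_one_closed in \<open>fastforce simp: section_in_A section_one_eq intro: section_mult_closed\<close>)+
  have "(\<lambda>i\<in>I. \<lambda>u\<in>V \<inter> U i. inv\<^bsub>Gh\<^esub> (t i u)) \<otimes>\<^bsub>sections F V\<^esub> t = \<one>\<^bsub>sections F V\<^esub>"
    by (rule section_eqI)
      (use cover_point t section_one_closed section_inv_closed[OF t] in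
        \<open>fastforce simp: section_in_A section_one_eq intro: section_mult_closed\<close>)+
  then show "\<exists>y\<in>carrier (sections F V). y \<otimes>\<^bsub>sections F V\<^esub> t = \<one>\<^bsub>sections F V\<^esub>"
    using section_inv_closed[OF t] by blast
qed (rule section_mult_closed section_one_closed; assumption)+

lemma section_inv [simp]:
  assumes t: "t \<in> carrier (sections F V)" and "i \<in> I" "u \<in> V" "u \<in> U i"
  shows "(inv\<^bsub>sections F V\<^esub> t) i u = inv\<^bsub>Gh\<^esub> (t i u)"
proof -
  interpret S: comm_group "sections F V" by (rule sections_comm_group)
  have "(inv\<^bsub>sections F V\<^esub> t) i u \<otimes>\<^bsub>Gh\<^esub> t i u = \<one>\<^bsub>sections F V\<^esub> i u"
    using S.l_inv[OF t] section_mult[OF assms(2-4)] by metis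
  then show ?thesis
    using assms section_in_A[of "inv\<^bsub>sections F V\<^esub> t" V i u] section_in_A[OF assms]
    by (intro Gh.inv_equality[symmetric]) (simp_all add: section_one_eq)
qed

sublocale abelian_presheaf F
proof (rule abelian_presheaf.intro)
  show "comm_group (sections F V)" for V by (rule sections_comm_group)
next
  fix V W :: "'x set" assume "V \<subseteq> W"
  then show "sec_res F V \<in> hom (sections F W) (sections F V)"
    by (intro homI section_res_closed)
      (auto simp: section_res_eq section_mult_eq fun_eq_iff restrict_def)
next
  fix V W :: "'x set" and t assume "V \<subseteq> W"
  then show "sec_res F V (sec_res F W t) = sec_res F V t"
    by (auto simp: section_res_eq fun_eq_iff restrict_def)
qed

lemma from_frame_section:
  assumes i: "i \<in> I" and W: "W \<subseteq> U i" and A: "\<And>u. u \<in> W \<Longrightarrow> f u \<in> A"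
    and p: "\<And>n V p. p \<in> plots X n V \<Longrightarrow> (\<And>v. v \<in> V \<Longrightarrow> p v \<in> W) \<Longrightarrow> (\<lambda>v. f (p v)) \<in> plots (dsp Gh) n V"
  shows "from_frame \<sigma>h I U \<epsilon> i W f \<in> carrier (sections F W)"
  unfolding from_frame_def
proof (rule sectionI)
  fix j k u assume j: "j \<in> I" "k \<in> I" "u \<in> W" "u \<in> U j" "u \<in> U k"
  then have "u \<in> U i" using W by auto
  then show "\<sigma>h (\<epsilon> j i u) (f u) = \<sigma>h (\<epsilon> j k u) (\<sigma>h (\<epsilon> k i u) (f u))"
    using i j A[of u] by (simp add: Gh.action_action \<epsilon>_cocycle)
qed (use assms in \<open>auto intro!: Gh.action_plot \<epsilon>_plot\<close>)

lemma from_frame_apply: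
  "j \<in> I \<Longrightarrow> u \<in> W \<Longrightarrow> u \<in> U j \<Longrightarrow> from_frame \<sigma>h I U \<epsilon> i W f j u = \<sigma>h (\<epsilon> j i u) (f u)"
  by (simp add: from_frame_def)

definition a_sec where "a_sec i j k = from_frame \<sigma>h I U \<epsilon> i (U i \<inter> U j \<inter> U k) (a i j k)"

lemma a_sec_in:
  "i \<in> I \<Longrightarrow> j \<in> I \<Longrightarrow> k \<in> I \<Longrightarrow> a_sec i j k \<in> carrier (sections F (U i \<inter> U j \<inter> U k))"
  unfolding a_sec_def by (rule from_frame_section) (auto intro: hh_defect(1) a_plot)

lemma a_sec_cocycle: "cech_cocycle F I U a_sec"
  unfolding cech_cocycle_def Let_def
proof (intro conjI ballI a_sec_in)
  fix i j k l assume I: "i \<in> I" "j \<in> I" "k \<in> I" "l \<in> I"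
  let ?W = "U i \<inter> U j \<inter> U k \<inter> U l"
  have in_W: "sec_res F ?W (a_sec i' j' k') \<in> carrier (sections F ?W)"
    if "i' \<in> I" "j' \<in> I" "k' \<in> I" "?W \<subseteq> U i' \<inter> U j' \<inter> U k'" for i' j' k'
    by (rule section_res_closed[OF that(4) a_sec_in[OF that(1-3)]])
  show "sec_res F ?W (a_sec i j k) \<otimes>\<^bsub>sections F ?W\<^esub> sec_res F ?W (a_sec i k l)
      = sec_res F ?W (a_sec j k l) \<otimes>\<^bsub>sections F ?W\<^esub> sec_res F ?W (a_sec i j l)"
  proof (rule section_eqI)
    fix u assume "u \<in> ?W"
    then show "\<exists>i'\<in>I. u \<in> U i' \<and>
      (sec_res F ?W (a_sec i j k) \<otimes>\<^bsub>sections F ?W\<^esub> sec_res F ?W (a_sec i k l)) i' u =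
      (sec_res F ?W (a_sec j k l) \<otimes>\<^bsub>sections F ?W\<^esub> sec_res F ?W (a_sec i j l)) i' u"
      using I by (intro bexI[of _ i]) (simp_all add: a_sec_def from_frame_apply a_cocycle hh_defect(1))
  qed (use I in \<open>auto intro!: section_mult_closed in_W\<close>)
qed

end

section \<open>Local objects of the lifting gerbe\<close>

context lifting_problem begin

abbreviation (input) pt where "pt \<kappa> B y \<equiv> \<kappa> (orb (A \<times> {1}) B y)"

end

text \<open>The properties of an object of the lifting gerbe that the comparison uses. They pass
  directly from \<open>V\<close> to its subsets, since none of them mentions local trivialisations or the diffeology
  of the quotient by \<open>A\<close>. The quotient enters only through the map \<open>pt\<close> to \<open>P\<close> that it induces:
  \<open>pt\<close> is equivariant, and plots of \<open>P\<close> lift locally along it.\<close>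

locale local_lift = lifting_problem X Gh G A q \<sigma> \<sigma>h P I U s g \<epsilon> gh
  for X :: "'x dspace" and Gh :: "'k dgroup" and G :: "'g dgroup" and A q \<sigma> \<sigma>h
    and P :: "('p, 'x, 'g \<times> int) pbundle" and I :: "'i set" and U s g \<epsilon> gh +
  fixes V :: "'x set" and B :: "('e, 'x, 'k \<times> int) pbundle" and \<kappa> :: "'e set \<Rightarrow> 'p"
  assumes base_subset: "V \<subseteq> points X"
    and total: "diffeological_space (total_space B)"
    and act_in: "\<And>y k. y \<in> tot B \<Longrightarrow> k \<in> carrier Hh \<Longrightarrow> act B y k \<in> tot B"
    and act_plot: "\<And>n W p k. p \<in> plots (total_space B) n W \<Longrightarrow> k \<in> plots (dsp Hh) n W \<Longrightarrow>
      (\<lambda>w. act B (p w) (k w)) \<in> plots (total_space B) n W"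
    and act_one: "\<And>y. y \<in> tot B \<Longrightarrow> act B y \<one>\<^bsub>Hh\<^esub> = y"
    and act_act: "\<And>y k k'. y \<in> tot B \<Longrightarrow> k \<in> carrier Hh \<Longrightarrow> k' \<in> carrier Hh \<Longrightarrow>
      act B (act B y k) k' = act B y (k \<otimes>\<^bsub>Hh\<^esub> k')"
    and act_free: "\<And>y k k'. y \<in> tot B \<Longrightarrow> k \<in> carrier Hh \<Longrightarrow> k' \<in> carrier Hh \<Longrightarrow>
      act B y k = act B y k' \<Longrightarrow> k = k'"
    and act_transitive: "\<And>y y'. y \<in> tot B \<Longrightarrow> y' \<in> tot B \<Longrightarrow> proj B y = proj B y' \<Longrightarrow>
      \<exists>k\<in>carrier Hh. y' = act B y k"
    and division_plot: "\<And>n W p p'. p \<in> plots (total_space B) n W \<Longrightarrow> p' \<in> plots (total_space B) n W \<Longrightarrow>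
      (\<And>w. w \<in> W \<Longrightarrow> proj B (p w) = proj B (p' w)) \<Longrightarrow>
      \<exists>k\<in>plots (dsp Hh) n W. \<forall>w\<in>W. p' w = act B (p w) (k w)"
    and proj_in: "\<And>y. y \<in> tot B \<Longrightarrow> proj B y \<in> V"
    and pt_in: "\<And>y. y \<in> tot B \<Longrightarrow> pt \<kappa> B y \<in> tot P"
    and proj_pt: "\<And>y. y \<in> tot B \<Longrightarrow> proj P (pt \<kappa> B y) = proj B y"
    and pt_act: "\<And>y k. y \<in> tot B \<Longrightarrow> k \<in> carrier Hh \<Longrightarrow> pt \<kappa> B (act B y k) = act P (pt \<kappa> B y) (\<rho> k)"
    and pt_plot: "\<And>n W p. p \<in> plots (total_space B) n W \<Longrightarrow>
      (\<lambda>w. pt \<kappa> B (p w)) \<in> plots (total_space P) n W"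
    and pt_lift: "\<And>n W p w. p \<in> plots (total_space P) n W \<Longrightarrow> (\<And>w. w \<in> W \<Longrightarrow> proj P (p w) \<in> V) \<Longrightarrow>
      w \<in> W \<Longrightarrow> \<exists>W' r. openin (Euclidean_space n) W' \<and> w \<in> W' \<and> W' \<subseteq> W \<and>
        r \<in> plots (total_space B) n W' \<and> (\<forall>v\<in>W'. pt \<kappa> B (r v) = p v)"

context lifting_problem begin

abbreviation (input) lifts_over where
  "lifts_over V B \<kappa> \<equiv> local_lift X Gh G A q \<sigma> \<sigma>h P I U s g \<epsilon> gh V B \<kappa>"

text \<open>The action of \<open>\<rho> k\<close> on the quotient is induced by that of \<open>k\<close>, because \<open>A\<close> is normal.\<close>

lemma orb_act:
  assumes B: "diffeological_principal_bundle Hh Y B" and y: "y \<in> tot B" and k: "k \<in> carrier Hh"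
  shows "act (bundle_quot (A \<times> {1}) Hh \<rho> B) (orb (A \<times> {1}) B y) (\<rho> k) = orb (A \<times> {1}) B (act B y k)"
proof -
  interpret B: diffeological_principal_bundle Hh Y B by (rule B)
  have "{act B y' k' | y' k'. y' \<in> orb (A \<times> {1}) B y \<and> k' \<in> carrier Hh \<and> \<rho> k' = \<rho> k}
      = {act B y (\<iota> b \<otimes>\<^bsub>Hh\<^esub> k') | b k'. b \<in> A \<and> k' \<in> carrier Hh \<and> \<rho> k' = \<rho> k}"
  proof (rule Collect_cong)
    fix z
    have "z = act B (act B y (\<iota> b)) k' \<longleftrightarrow> z = act B y (\<iota> b \<otimes>\<^bsub>Hh\<^esub> k')" if "b \<in> A" "k' \<in> carrier Hh" for b k'
      using y that by (simp add: B.act_act)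
    then show "(\<exists>y' k'. z = act B y' k' \<and> y' \<in> orb (A \<times> {1}) B y \<and> k' \<in> carrier Hh \<and> \<rho> k' = \<rho> k)
      \<longleftrightarrow> (\<exists>b k'. z = act B y (\<iota> b \<otimes>\<^bsub>Hh\<^esub> k') \<and> b \<in> A \<and> k' \<in> carrier Hh \<and> \<rho> k' = \<rho> k)"
      unfolding orb_def \<iota>_kernel by blast
  qed
  also have "\<dots> = {act B y (k \<otimes>\<^bsub>Hh\<^esub> \<iota> c) | c. c \<in> A}"
  proof (intro equalityI subsetI)
    fix z assume "z \<in> {act B y (\<iota> b \<otimes>\<^bsub>Hh\<^esub> k') | b k'. b \<in> A \<and> k' \<in> carrier Hh \<and> \<rho> k' = \<rho> k}"
    then obtain b k' where b: "z = act B y (\<iota> b \<otimes>\<^bsub>Hh\<^esub> k')" "b \<in> A" "k' \<in> carrier Hh" "\<rho> k' = \<rho> k"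
      by blast
    have "\<rho> k = \<rho> (\<iota> b \<otimes>\<^bsub>Hh\<^esub> k')"
      using b(4) \<rho>_closed[OF k] by (simp only: \<rho>_mult[OF \<iota>_carrier[OF b(2)] b(3)] \<rho>_\<iota>[OF b(2)] H.l_one)
    then obtain c where "c \<in> A" "\<iota> b \<otimes>\<^bsub>Hh\<^esub> k' = k \<otimes>\<^bsub>Hh\<^esub> \<iota> c"
      using same_image_right[OF k Hh.m_closed[OF \<iota>_carrier[OF b(2)] b(3)]] by blast
    then show "z \<in> {act B y (k \<otimes>\<^bsub>Hh\<^esub> \<iota> c) | c. c \<in> A}"
      using b(1) by auto
  next
    fix z assume "z \<in> {act B y (k \<otimes>\<^bsub>Hh\<^esub> \<iota> c) | c. c \<in> A}"
    then obtain c where c: "z = act B y (k \<otimes>\<^bsub>Hh\<^esub> \<iota> c)" "c \<in> A" by blast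
    have e: "snd k \<in> Z2" using k by (auto simp: Gh.carrier_semidirect)
    then show "z \<in> {act B y (\<iota> b \<otimes>\<^bsub>Hh\<^esub> k') | b k'. b \<in> A \<and> k' \<in> carrier Hh \<and> \<rho> k' = \<rho> k}"
      using c k twisted_central[OF k c(2)] by (metis (mono_tags, lifting) A_action mem_Collect_eq)
  qed
  also have "\<dots> = orb (A \<times> {1}) B (act B y k)"
    using y k by (simp add: orb_def \<iota>_kernel image_image B.act_act Setcompr_eq_image)
  finally show ?thesis
    by (simp add: bundle_quot_def)
qed

text \<open>Lifting of plots along \<open>pt\<close> is where the quotient diffeology is used: a plot of \<open>P\<close> becomes a plot
  of the quotient under the inverse of \<open>\<kappa>\<close>, and plots of the quotient lift locally by definition.\<close>

lemma local_lift_object: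
  assumes obj: "(B, \<kappa>) \<in> lift_objs X A Hh H q P V"
  shows "lifts_over V B \<kappa>"
proof -
  let ?Q = "bundle_quot (A \<times> {1}) Hh \<rho> B"
  have V: "D_open X V" and pB: "principal_bundle Hh (sub_space X V) B"
    and iso: "bundle_iso H ?Q (bundle_res V P) \<kappa>"
    using obj by (auto simp: lift_objs_def)
  interpret B: diffeological_principal_bundle Hh "sub_space X V" B
    by unfold_locales (rule Gh.diffeological_group_semidirect diffeological_sub_space[OF space] pB)+
  have dpb: "diffeological_principal_bundle Hh (sub_space X V) B" by unfold_locales
  have diff: "diffeomorphism (total_space ?Q) (total_space (bundle_res V P)) \<kappa>"
    using iso by (simp add: bundle_iso_def)
  have totQ: "tot ?Q = orb (A \<times> {1}) B ` tot B"
    by (simp add: bundle_quot_def quotient_space_def)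
  have bij: "bij_betw \<kappa> (tot ?Q) (tot (bundle_res V P))"
    using diff by (simp add: diffeomorphism_def)
  have in_Q: "orb (A \<times> {1}) B y \<in> tot ?Q" if "y \<in> tot B" for y
    using that totQ by simp
  have projQ: "proj ?Q (orb (A \<times> {1}) B y) = proj B y" if "y \<in> tot B" for y
  proof -
    have "proj B ` orb (A \<times> {1}) B y = {proj B y}"
    proof (intro equalityI subsetI)
      fix u assume "u \<in> {proj B y}"
      then have "u = proj B (act B y (\<iota> \<one>\<^bsub>Gh\<^esub>))"
        using that A_one by (simp add: B.proj_act)
      then show "u \<in> proj B ` orb (A \<times> {1}) B y"
        unfolding orb_def \<iota>_kernel using A_one by blast
    qed (use that in \<open>auto simp: orb_def \<iota>_kernel B.proj_act\<close>)
    then show ?thesis by (simp add: bundle_quot_def)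
  qed
  show ?thesis
  proof unfold_locales
    show "V \<subseteq> points X" by (rule D_open_subset[OF V])
    show "diffeological_space (total_space B)" by (rule B.total)
  next
    fix y k assume y: "y \<in> tot B" and k: "k \<in> carrier Hh"
    show "act B y k \<in> tot B" by (rule B.act_in[OF y k])
    have "\<kappa> (act ?Q (orb (A \<times> {1}) B y) (\<rho> k)) = act (bundle_res V P) (pt \<kappa> B y) (\<rho> k)"
      using iso in_Q[OF y] \<rho>_closed[OF k] by (simp add: bundle_iso_def)
    then show "pt \<kappa> B (act B y k) = act P (pt \<kappa> B y) (\<rho> k)"
      by (simp add: orb_act[OF dpb y k])
  next
    fix n W p k assume "p \<in> plots (total_space B) n W" "k \<in> plots (dsp Hh) n W"
    then show "(\<lambda>w. act B (p w) (k w)) \<in> plots (total_space B) n W" by (rule B.act_plot)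
  next
    fix y assume y: "y \<in> tot B"
    show "act B y \<one>\<^bsub>Hh\<^esub> = y" by (rule B.act_one[OF y])
    show "proj B y \<in> V" using B.proj_in[OF y] by simp
    have "pt \<kappa> B y \<in> tot (bundle_res V P)"
      using bij_betw_apply[OF bij in_Q[OF y]] .
    then show "pt \<kappa> B y \<in> tot P" by simp
    have "proj (bundle_res V P) (pt \<kappa> B y) = proj ?Q (orb (A \<times> {1}) B y)"
      using iso in_Q[OF y] by (simp add: bundle_iso_def)
    then show "proj P (pt \<kappa> B y) = proj B y"
      by (simp add: projQ[OF y])
  next
    fix y k k' assume "y \<in> tot B" "k \<in> carrier Hh" "k' \<in> carrier Hh"
    then show "act B (act B y k) k' = act B y (k \<otimes>\<^bsub>Hh\<^esub> k')" by (rule B.act_act)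
  next
    fix y k k' assume "y \<in> tot B" "k \<in> carrier Hh" "k' \<in> carrier Hh" "act B y k = act B y k'"
    then show "k = k'" by (rule B.act_free)
  next
    fix y y' assume "y \<in> tot B" "y' \<in> tot B" "proj B y = proj B y'"
    then show "\<exists>k\<in>carrier Hh. y' = act B y k" by (metis B.act_transitive)
  next
    fix n W p p' assume p: "p \<in> plots (total_space B) n W" "p' \<in> plots (total_space B) n W"
      "\<And>w. w \<in> W \<Longrightarrow> proj B (p w) = proj B (p' w)"
    have "\<forall>w\<in>W. p' w = act B (p w) (B.division (p w) (p' w))"
      using B.division(2) plot_in_points[OF B.total] p by metis
    then show "\<exists>k\<in>plots (dsp Hh) n W. \<forall>w\<in>W. p' w = act B (p w) (k w)"
      by (rule bexI[OF _ B.division_plot[OF p]])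
  next
    fix n W p assume p: "p \<in> plots (total_space B) n W"
    have "(\<lambda>w. orb (A \<times> {1}) B (p w)) \<in> plots (total_space ?Q) n W"
      using p plot_in_points[OF B.total p] plot_openin[OF B.total p]
      by (auto simp: bundle_quot_def quotient_space_def intro!: exI[of _ W] bexI[of _ p])
    moreover have "smooth_map (total_space ?Q) (total_space (bundle_res V P)) \<kappa>"
      using diff by (simp add: diffeomorphism_def)
    ultimately show "(\<lambda>w. pt \<kappa> B (p w)) \<in> plots (total_space P) n W"
      using smooth_map_plot plots_bundle_res by blast
  next
    fix n W p w assume p: "p \<in> plots (total_space P) n W" and V: "\<And>w. w \<in> W \<Longrightarrow> proj P (p w) \<in> V"
      and w: "w \<in> W"
    let ?i = "inv_into (tot ?Q) \<kappa>"
    have pV: "p \<in> plots (total_space (bundle_res V P)) n W"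
      using p V by (simp add: plots_bundle_res)
    then have "(\<lambda>w. ?i (p w)) \<in> plots (total_space ?Q) n W"
      by (rule diffeomorphism_inv_plot[OF diff])
    then have "\<forall>w\<in>W. \<exists>W'. openin (Euclidean_space n) W' \<and> w \<in> W' \<and> W' \<subseteq> W \<and>
        (\<exists>r\<in>plots (total_space B) n W'. \<forall>v\<in>W'. ?i (p v) = orb (A \<times> {1}) B (r v))"
      unfolding bundle_quot_def quotient_space_def by simp
    then obtain W' r where W': "openin (Euclidean_space n) W'" "w \<in> W'" "W' \<subseteq> W"
      and r: "r \<in> plots (total_space B) n W'" "\<And>v. v \<in> W' \<Longrightarrow> ?i (p v) = orb (A \<times> {1}) B (r v)"
      using w by meson
    have "pt \<kappa> B (r v) = p v" if v: "v \<in> W'" for v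
    proof -
      have "p v \<in> tot (bundle_res V P)"
        using plot_in_points[OF P.total p] V W'(3) v by auto
      then have "\<kappa> (?i (p v)) = p v"
        using bij by (simp add: bij_betw_inv_into_right)
      then show ?thesis by (simp add: r(2)[OF v])
    qed
    then show "\<exists>W' r. openin (Euclidean_space n) W' \<and> w \<in> W' \<and> W' \<subseteq> W \<and>
        r \<in> plots (total_space B) n W' \<and> (\<forall>v\<in>W'. pt \<kappa> B (r v) = p v)"
      using W' r(1) by blast
  qed
qed

lemma local_lift_restrict:
  assumes "lifts_over V B \<kappa>" and W: "W \<subseteq> V"
  shows "lifts_over W (bundle_res W B) \<kappa>"
proof -
  interpret L: local_lift X Gh G A q \<sigma> \<sigma>h P I U s g \<epsilon> gh V B \<kappa> by (rule assms(1))
  have proj_act: "proj B (act B y k) = proj B y" if "y \<in> tot B" "k \<in> carrier Hh" for y k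
    using L.proj_pt[OF L.act_in[OF that]] L.proj_pt[OF that(1)] L.pt_in[OF that(1)] that
    by (simp add: L.pt_act P.proj_act)
  show ?thesis
  proof unfold_locales
    show "W \<subseteq> points X" using W L.base_subset by blast
    show "diffeological_space (total_space (bundle_res W B))"
      by (simp add: bundle_res_def diffeological_sub_space L.total)
  next
    fix n Z p p' assume p: "p \<in> plots (total_space (bundle_res W B)) n Z"
      "p' \<in> plots (total_space (bundle_res W B)) n Z"
      "\<And>w. w \<in> Z \<Longrightarrow> proj (bundle_res W B) (p w) = proj (bundle_res W B) (p' w)"
    then show "\<exists>k\<in>plots (dsp Hh) n Z. \<forall>w\<in>Z. p' w = act (bundle_res W B) (p w) (k w)"
      using L.division_plot[of p n Z p'] by (simp add: plots_bundle_res)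
  next
    fix n Z p w assume p: "p \<in> plots (total_space P) n Z" "\<And>w. w \<in> Z \<Longrightarrow> proj P (p w) \<in> W" "w \<in> Z"
    obtain W' r where W': "openin (Euclidean_space n) W'" "w \<in> W'" "W' \<subseteq> Z"
        "r \<in> plots (total_space B) n W'" "\<forall>v\<in>W'. pt \<kappa> B (r v) = p v"
      using L.pt_lift[OF p(1) subsetD[OF W p(2)] p(3)] by blast
    have "proj B (r v) \<in> W" if "v \<in> W'" for v
      using L.proj_pt[OF plot_in_points[OF L.total W'(4) that]] p(2)[of v] W'(3,5) that by auto
    then show "\<exists>W' r. openin (Euclidean_space n) W' \<and> w \<in> W' \<and> W' \<subseteq> Z \<and>
        r \<in> plots (total_space (bundle_res W B)) n W' \<and> (\<forall>v\<in>W'. pt \<kappa> (bundle_res W B) (r v) = p v)"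
      using W' by (intro exI[of _ W'] exI[of _ r]) (simp add: plots_bundle_res)
  next
    fix n Z p k assume p: "p \<in> plots (total_space (bundle_res W B)) n Z" and k: "k \<in> plots (dsp Hh) n Z"
    have "proj B (act B (p w) (k w)) = proj B (p w)" if "w \<in> Z" for w
      using p k that by (intro proj_act plot_in_points[OF L.total]
          plot_in_carrier[OF Gh.diffeological_group_semidirect]) (auto simp: plots_bundle_res)
    then show "(\<lambda>w. act (bundle_res W B) (p w) (k w)) \<in> plots (total_space (bundle_res W B)) n Z"
      using p k by (simp add: plots_bundle_res L.act_plot)
  next
    fix n Z p assume p: "p \<in> plots (total_space (bundle_res W B)) n Z"
    then show "(\<lambda>w. pt \<kappa> (bundle_res W B) (p w)) \<in> plots (total_space P) n Z"
      by (simp add: plots_bundle_res L.pt_plot)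
  qed (auto simp: L.act_in proj_act L.act_one L.act_act L.pt_in L.proj_pt L.pt_act
      dest: L.act_free L.act_transitive)
qed

end

context local_lift begin

lemma proj_act: "y \<in> tot B \<Longrightarrow> k \<in> carrier Hh \<Longrightarrow> proj B (act B y k) = proj B y"
  using proj_pt[of "act B y k"] proj_pt[of y] pt_in[of y] by (simp add: act_in pt_act P.proj_act)

lemma proj_plot:
  assumes p: "p \<in> plots (total_space B) n W" shows "(\<lambda>w. proj B (p w)) \<in> plots X n W"
  using plot_cong[OF space P.proj_plot[OF pt_plot[OF p]]] proj_pt plot_in_points[OF total p] by simp

lemma pt_surj:
  assumes z: "z \<in> tot P" "proj P z \<in> V"
  obtains y where "y \<in> tot B" "pt \<kappa> B y = z" "proj B y = proj P z"
proof -
  have p: "(\<lambda>_. z) \<in> plots (total_space P) 0 (topspace (Euclidean_space 0))"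
    by (rule plot_const[OF P.total _ z(1)]) simp
  have "(\<lambda>_. 0) \<in> topspace (Euclidean_space 0)"
    by (simp add: topspace_Euclidean_space)
  from pt_lift[OF p z(2) this] obtain W r where "(\<lambda>_. 0) \<in> W" "r \<in> plots (total_space B) 0 W"
    "\<forall>v\<in>W. pt \<kappa> B (r v) = z"
    by blast
  then show ?thesis
    using that[of "r (\<lambda>_. 0)"] plot_in_points[OF total] proj_pt by metis
qed

lemma pt_fibre:
  assumes y: "y \<in> tot B" "y' \<in> tot B" "pt \<kappa> B y = pt \<kappa> B y'"
  obtains c where "c \<in> A" "y' = act B y (\<iota> c)"
proof -
  have "proj B y = proj B y'"
    using y proj_pt by metis
  then obtain k where k: "k \<in> carrier Hh" "y' = act B y k"
    using act_transitive y by blast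
  have "act P (pt \<kappa> B y) \<one>\<^bsub>H\<^esub> = act P (pt \<kappa> B y) (\<rho> k)"
    using pt_act[OF y(1) k(1)] y k(2) by (simp add: P.act_one pt_in)
  then have "\<rho> \<one>\<^bsub>Hh\<^esub> = \<rho> k"
    using P.act_free[OF pt_in[OF y(1)] H.one_closed \<rho>_closed[OF k(1)]] by (simp add: \<rho>_one)
  then obtain c where "c \<in> A" "k = \<iota> c \<otimes>\<^bsub>Hh\<^esub> \<one>\<^bsub>Hh\<^esub>"
    using same_image[OF Hh.one_closed k(1)] by metis
  then show ?thesis
    using that[of c] k(2) by simp
qed

end

section \<open>The band\<close>

context local_lift begin

text \<open>The \<open>Z2\<close>-component of the position of \<open>y\<close> relative to the frame \<open>s i\<close>.\<close>

definition frame_sign :: "'i \<Rightarrow> 'e \<Rightarrow> int" where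
  "frame_sign i y = snd (P.division (s i (proj B y)) (pt \<kappa> B y))"

lemma frame_division:
  assumes "i \<in> I" "y \<in> tot B" "proj B y \<in> U i"
  shows "P.division (s i (proj B y)) (pt \<kappa> B y) \<in> carrier H"
    "act P (s i (proj B y)) (P.division (s i (proj B y)) (pt \<kappa> B y)) = pt \<kappa> B y"
  using assms by (simp_all add: P.division s_in pt_in proj_s proj_pt)

lemma frame_sign_eqI:
  assumes "i \<in> I" "y \<in> tot B" "proj B y \<in> U i" "k \<in> carrier H" "pt \<kappa> B y = act P (s i (proj B y)) k"
  shows "frame_sign i y = snd k"
  using P.division_eq[OF s_in assms(4,5)] assms by (simp add: frame_sign_def)

lemma frame_sign_Z2 [simp]: "i \<in> I \<Longrightarrow> y \<in> tot B \<Longrightarrow> proj B y \<in> U i \<Longrightarrow> frame_sign i y \<in> Z2"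
  using frame_division(1)[of i y] by (auto simp: frame_sign_def G.carrier_semidirect)

lemma frame_sign_act:
  assumes "i \<in> I" "y \<in> tot B" "proj B y \<in> U i" "k \<in> carrier Hh"
  shows "frame_sign i (act B y k) = frame_sign i y * snd k"
proof -
  let ?d = "P.division (s i (proj B y)) (pt \<kappa> B y)"
  note d = frame_division[OF assms(1-3)]
  have "pt \<kappa> B (act B y k) = act P (act P (s i (proj B y)) ?d) (\<rho> k)"
    using pt_act[OF assms(2,4)] d(2) by simp
  also have "\<dots> = act P (s i (proj B y)) (?d \<otimes>\<^bsub>H\<^esub> \<rho> k)"
    by (rule P.act_act) (use assms d in \<open>simp_all add: s_in\<close>)
  finally have "pt \<kappa> B (act B y k) = act P (s i (proj B (act B y k))) (?d \<otimes>\<^bsub>H\<^esub> \<rho> k)"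
    using assms by (simp add: proj_act)
  moreover have "?d \<otimes>\<^bsub>H\<^esub> \<rho> k \<in> carrier H"
    by (rule H.m_closed[OF d(1) \<rho>_closed[OF assms(4)]])
  ultimately have "frame_sign i (act B y k) = snd (?d \<otimes>\<^bsub>H\<^esub> \<rho> k)"
    using assms by (intro frame_sign_eqI) (simp_all add: act_in proj_act)
  then show ?thesis
    by (simp add: frame_sign_def G.mult_semidirect' snd_map_prod)
qed

lemma frame_sign_change:
  assumes "i \<in> I" "j \<in> I" "y \<in> tot B" "proj B y \<in> U i" "proj B y \<in> U j"
  shows "frame_sign i y = \<epsilon> i j (proj B y) * frame_sign j y"
proof -
  let ?u = "proj B y" and ?d = "P.division (s j (proj B y)) (pt \<kappa> B y)"
  note d = frame_division[OF assms(2,3,5)]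
  have "pt \<kappa> B y = act P (act P (s i ?u) (h i j ?u)) ?d"
    using d(2) s_h[OF assms(1,2,4,5)] by simp
  also have "\<dots> = act P (s i ?u) (h i j ?u \<otimes>\<^bsub>H\<^esub> ?d)"
    by (rule P.act_act) (use assms d in \<open>simp_all add: s_in h_in\<close>)
  finally have "frame_sign i y = snd (h i j ?u \<otimes>\<^bsub>H\<^esub> ?d)"
    using assms d(1) by (intro frame_sign_eqI H.m_closed) (simp_all add: h_in)
  then show ?thesis
    by (simp add: frame_sign_def G.mult_semidirect' h_def)
qed

lemma frame_sign_frame:
  assumes "i \<in> I" "y \<in> tot B" "proj B y \<in> U i" "pt \<kappa> B y = s i (proj B y)"
  shows "frame_sign i y = 1"
proof -
  have "pt \<kappa> B y = act P (s i (proj B y)) \<one>\<^bsub>H\<^esub>"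
    using assms by (simp add: P.act_one s_in)
  from frame_sign_eqI[OF assms(1-3) H.one_closed this] show ?thesis
    by (simp add: G.one_semidirect)
qed

lemma frame_sign_plot:
  assumes i: "i \<in> I" and p: "p \<in> plots (total_space B) n W" and U: "\<And>w. w \<in> W \<Longrightarrow> proj B (p w) \<in> U i"
  shows "(\<lambda>w. frame_sign i (p w)) \<in> plots (discrete_space Z2) n W"
proof -
  have "(\<lambda>w. s i (proj B (p w))) \<in> plots (total_space P) n W"
    using smooth_map_plot[OF section_s[OF i], of "\<lambda>w. proj B (p w)"] proj_plot[OF p] U
    by (simp add: plots_sub_space)
  moreover have "proj P (s i (proj B (p w))) = proj P (pt \<kappa> B (p w))" if "w \<in> W" for w
    using that i U plot_in_points[OF total p] by (simp add: proj_s proj_pt)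
  ultimately have "(\<lambda>w. P.division (s i (proj B (p w))) (pt \<kappa> B (p w))) \<in> plots (dsp H) n W"
    by (intro P.division_plot pt_plot p)
  then show ?thesis
    by (simp add: G.plots_semidirect frame_sign_def)
qed

text \<open>The element of \<open>A\<close> by which a section of the local system moves a point \<open>y\<close>: its value in
  any frame, transported to \<open>y\<close> by the sign of \<open>y\<close> relative to that frame.\<close>

definition displacement :: "('i \<Rightarrow> 'x \<Rightarrow> 'k) \<Rightarrow> 'e \<Rightarrow> 'k" where
  "displacement t y =
     (let i = (SOME i. i \<in> I \<and> proj B y \<in> U i) in \<sigma>h (frame_sign i y) (t i (proj B y)))"

text \<open>Changing the frame from \<open>i\<close> to \<open>j\<close> changes the sign by \<open>\<epsilon> i j\<close> and the value of the section by the
  action of \<open>\<epsilon> i j\<close>; the two changes cancel.\<close>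

lemma displacement_eq:
  assumes t: "t \<in> carrier (sections F V)" and y: "y \<in> tot B" and i: "i \<in> I" "proj B y \<in> U i"
  shows "displacement t y = \<sigma>h (frame_sign i y) (t i (proj B y))"
proof -
  define j where "j = (SOME i. i \<in> I \<and> proj B y \<in> U i)"
  have j: "j \<in> I" "proj B y \<in> U j"
    using someI[of "\<lambda>i. i \<in> I \<and> proj B y \<in> U i" i] i by (auto simp: j_def)
  have A: "t i (proj B y) \<in> A" "t j (proj B y) \<in> A"
    using section_in_A[OF t] i j proj_in[OF y] by auto
  have "\<sigma>h (frame_sign j y) (t j (proj B y)) = \<sigma>h (frame_sign i y * \<epsilon> i j (proj B y)) (t j (proj B y))"
  proof -
    have "frame_sign i y * \<epsilon> i j (proj B y) = (\<epsilon> i j (proj B y) * \<epsilon> i j (proj B y)) * frame_sign j y"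
      using frame_sign_change[OF i(1) j(1) y i(2) j(2)] by simp
    then show ?thesis using i j by simp
  qed
  also have "\<dots> = \<sigma>h (frame_sign i y) (t i (proj B y))"
    using i j y A section_twist[OF t i(1) j(1) proj_in[OF y] i(2) j(2)] by (simp add: Gh.action_action)
  finally show ?thesis
    by (simp add: displacement_def Let_def flip: j_def)
qed

lemma frame_exists: assumes "y \<in> tot B" obtains i where "i \<in> I" "proj B y \<in> U i"
  using cover_point[of "proj B y"] proj_in[OF assms] base_subset by auto

lemma displacement_in_A:
  assumes t: "t \<in> carrier (sections F V)" and y: "y \<in> tot B" shows "displacement t y \<in> A"
proof -
  obtain i where i: "i \<in> I" "proj B y \<in> U i" using frame_exists[OF y] .
  then show ?thesis
    using displacement_eq[OF t y i] section_in_A[OF t i(1) proj_in[OF y] i(2)] y by simp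
qed

lemma displacement_act:
  assumes t: "t \<in> carrier (sections F V)" and y: "y \<in> tot B" and k: "k \<in> carrier Hh"
  shows "displacement t (act B y k) = \<sigma>h (snd k) (displacement t y)"
proof -
  obtain i where i: "i \<in> I" "proj B y \<in> U i" using frame_exists[OF y] .
  have e: "snd k \<in> Z2" using k by (auto simp: Gh.carrier_semidirect)
  have A: "t i (proj B y) \<in> A"
    by (rule section_in_A[OF t i(1) proj_in[OF y] i(2)])
  have "displacement t (act B y k) = \<sigma>h (frame_sign i (act B y k)) (t i (proj B y))"
    using displacement_eq[OF t act_in[OF y k] i(1)] i(2) y k by (simp add: proj_act)
  also have "\<dots> = \<sigma>h (snd k * frame_sign i y) (t i (proj B y))"
    using frame_sign_act[OF i(1) y i(2) k] by (simp add: mult.commute)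
  also have "\<dots> = \<sigma>h (snd k) (displacement t y)"
    using displacement_eq[OF t y i] i y e A by (simp add: Gh.action_action)
  finally show ?thesis .
qed

lemma displacement_plot:
  assumes t: "t \<in> carrier (sections F V)" and p: "p \<in> plots (total_space B) n W"
  shows "(\<lambda>w. displacement t (p w)) \<in> plots (dsp Gh) n W"
proof (rule plot_local[OF diffeological_group_space[OF Gh.diffeological] plot_openin[OF total p]])
  fix w assume w: "w \<in> W"
  obtain i where i: "i \<in> I" "proj B (p w) \<in> U i"
    using frame_exists[OF plot_in_points[OF total p w]] .
  let ?W = "{w \<in> W. proj B (p w) \<in> U i}"
  have "D_open X (U i)" using cover i by (simp add: open_cover_def)
  then have W: "openin (Euclidean_space n) ?W" "?W \<subseteq> W"
    using D_open_preimage[OF _ proj_plot[OF p]] by auto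
  have p': "p \<in> plots (total_space B) n ?W"
    by (rule plot_restrict[OF total p W refl])
  have "(\<lambda>w. t i (proj B (p w))) \<in> plots (dsp Gh) n ?W"
    by (rule section_plot[OF t i(1) proj_plot[OF p']]) (use proj_in plot_in_points[OF total p] in auto)
  moreover have "(\<lambda>w. frame_sign i (p w)) \<in> plots (discrete_space Z2) n ?W"
    by (rule frame_sign_plot[OF i(1) p']) simp
  ultimately have "(\<lambda>w. \<sigma>h (frame_sign i (p w)) (t i (proj B (p w)))) \<in> plots (dsp Gh) n ?W"
    by (intro Gh.action_plot)
  moreover have "\<forall>v\<in>?W. displacement t (p v) = \<sigma>h (frame_sign i (p v)) (t i (proj B (p v)))"
    using displacement_eq[OF t _ i(1)] plot_in_points[OF total p] by simp
  ultimately show "\<exists>V r. openin (Euclidean_space n) V \<and> w \<in> V \<and> V \<subseteq> W \<and> r \<in> plots (dsp Gh) n V \<and>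
      (\<forall>v\<in>V. displacement t (p v) = r v)"
    using W w i(2) by (intro exI[of _ ?W] exI[of _ "\<lambda>v. \<sigma>h (frame_sign i (p v)) (t i (proj B (p v)))"]) simp
qed

definition band_map :: "('i \<Rightarrow> 'x \<Rightarrow> 'k) \<Rightarrow> 'e \<Rightarrow> 'e" where
  "band_map t = (\<lambda>y\<in>tot B. act B y (\<iota> (displacement t y)))"

lemma band_map_smooth:
  assumes t: "t \<in> carrier (sections F V)"
  shows "smooth_map (total_space B) (total_space B) (band_map t)"
proof (rule smooth_mapI)
  fix y assume "y \<in> tot B"
  then show "band_map t y \<in> tot B"
    using displacement_in_A[OF t] by (simp add: band_map_def act_in)
next
  fix n W p assume p: "p \<in> plots (total_space B) n W"
  show "(\<lambda>w. band_map t (p w)) \<in> plots (total_space B) n W"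
    by (rule plot_cong[OF total act_plot[OF p plot_\<iota>[OF displacement_plot[OF t p]]]])
      (simp add: band_map_def plot_in_points[OF total p])
qed

lemma band_map_inverse:
  assumes t: "t \<in> carrier (sections F V)" and t': "t' \<in> carrier (sections F V)"
    and inv: "\<And>i u. i \<in> I \<Longrightarrow> u \<in> V \<Longrightarrow> u \<in> U i \<Longrightarrow> t i u \<otimes>\<^bsub>Gh\<^esub> t' i u = \<one>\<^bsub>Gh\<^esub>" and y: "y \<in> tot B"
  shows "band_map t' (band_map t y) = y"
proof -
  obtain i where i: "i \<in> I" "proj B y \<in> U i" using frame_exists[OF y] .
  have A: "t i (proj B y) \<in> A" "t' i (proj B y) \<in> A"
    using section_in_A[OF _ i(1) proj_in[OF y] i(2)] t t' by auto
  have c: "displacement t y \<in> A" "displacement t' y \<in> A"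
    using displacement_in_A t t' y by auto
  have "displacement t y \<otimes>\<^bsub>Gh\<^esub> displacement t' y = \<one>\<^bsub>Gh\<^esub>"
    using displacement_eq[OF t y i] displacement_eq[OF t' y i] A i y
      inv[OF i(1) proj_in[OF y] i(2)] by (simp flip: Gh.action_mult)
  moreover have "displacement t' (act B y (\<iota> (displacement t y))) = displacement t' y"
    using displacement_act[OF t' y \<iota>_carrier[OF c(1)]] c by simp
  ultimately show ?thesis
    using y c by (simp add: band_map_def act_in act_act \<iota>_mult \<iota>_one act_one)
qed

text \<open>Equivariance is the rule \<open>twisted_central\<close>, and the inverse is given by the inverse section.\<close>

lemma band_map_mor:
  assumes t: "t \<in> carrier (sections F V)" shows "band_map t \<in> lift_mors A Hh (B, \<kappa>) (B, \<kappa>)"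
proof -
  let ?t' = "inv\<^bsub>sections F V\<^esub> t"
  have t': "?t' \<in> carrier (sections F V)"
    by (rule inv_closed[OF t])
  have "diffeomorphism (total_space B) (total_space B) (band_map t)"
    by (rule diffeomorphismI[OF total total band_map_smooth[OF t] band_map_smooth[OF t']])
      (rule band_map_inverse; use t t' section_in_A[OF t] in simp)+
  moreover have "proj B (band_map t y) = proj B y" if "y \<in> tot B" for y
    using that displacement_in_A[OF t] by (simp add: band_map_def proj_act)
  moreover have "band_map t (act B y k) = act B (band_map t y) k" if y: "y \<in> tot B" and k: "k \<in> carrier Hh" for y k
  proof -
    have e: "snd k \<in> Z2" using k by (auto simp: Gh.carrier_semidirect)
    note c = displacement_in_A[OF t y]
    show ?thesis
      using y k c e twisted_central[OF k, of "\<sigma>h (snd k) (displacement t y)"]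
      by (simp add: band_map_def act_in act_act displacement_act[OF t])
  qed
  moreover have "pt \<kappa> B (band_map t y) = pt \<kappa> B y" if y: "y \<in> tot B" for y
    using y displacement_in_A[OF t y] by (simp add: band_map_def pt_act \<rho>_\<iota> P.act_one pt_in)
  ultimately show ?thesis
    by (simp add: lift_mors_def bundle_iso_def) (simp add: band_map_def)
qed

lemma band_map_frame:
  assumes t: "t \<in> carrier (sections F V)" and "i \<in> I" "y \<in> tot B" "proj B y \<in> U i"
    "pt \<kappa> B y = s i (proj B y)"
  shows "band_map t y = act B y (\<iota> (t i (proj B y)))"
  using displacement_eq[OF t assms(3,2,4)] assms frame_sign_frame[OF assms(2-5)]
    section_in_A[OF t assms(2) proj_in[OF assms(3)] assms(4)]
  by (simp add: band_map_def)

lemma frame_point: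
  assumes "i \<in> I" "y \<in> tot B" "proj B y \<in> U i"
  obtains y0 k where "y0 \<in> tot B" "k \<in> carrier Hh" "proj B y0 = proj B y" "pt \<kappa> B y0 = s i (proj B y0)"
    "y = act B y0 k"
proof -
  obtain y0 where y0: "y0 \<in> tot B" "pt \<kappa> B y0 = s i (proj B y)" "proj B y0 = proj B y"
    using pt_surj[OF s_in[OF assms(1,3)]] proj_in[OF assms(2)] by (auto simp: proj_s[OF assms(1,3)])
  obtain k where "k \<in> carrier Hh" "y = act B y0 k"
    using act_transitive[OF y0(1) assms(2) y0(3)] by blast
  then show ?thesis using that y0 by simp
qed

text \<open>An equivariant map is determined by its values on the points over the frames, so at most one
  automorphism fits the description of the band.\<close>

lemma lift_band_eq:
  assumes t: "t \<in> carrier (sections F V)"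
  shows "lift_band A Hh I U s (B, \<kappa>) t = band_map t"
  unfolding lift_band_def split
proof (rule the_equality)
  show "band_map t \<in> lift_mors A Hh (B, \<kappa>) (B, \<kappa>) \<and>
    (\<forall>i\<in>I. \<forall>y\<in>tot B. proj B y \<in> U i \<and> pt \<kappa> B y = s i (proj B y) \<longrightarrow>
      band_map t y = act B y (t i (proj B y), 1))"
    using band_map_mor[OF t] band_map_frame[OF t] by (simp add: \<iota>_def)
next
  fix f assume f: "f \<in> lift_mors A Hh (B, \<kappa>) (B, \<kappa>) \<and>
    (\<forall>i\<in>I. \<forall>y\<in>tot B. proj B y \<in> U i \<and> pt \<kappa> B y = s i (proj B y) \<longrightarrow>
      f y = act B y (t i (proj B y), 1))"
  have equi: "f' (act B y k) = act B (f' y) k"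
    if "f' \<in> lift_mors A Hh (B, \<kappa>) (B, \<kappa>)" "y \<in> tot B" "k \<in> carrier Hh" for f' y k
    using that by (simp add: lift_mors_def bundle_iso_def)
  show "f = band_map t"
  proof (rule extensionalityI[of _ "tot B"])
    show "f \<in> extensional (tot B)" using f by (simp add: lift_mors_def)
    show "band_map t \<in> extensional (tot B)" by (simp add: band_map_def)
    fix y assume y: "y \<in> tot B"
    obtain i where i: "i \<in> I" "proj B y \<in> U i" using frame_exists[OF y] .
    obtain y0 k where y0: "y0 \<in> tot B" "k \<in> carrier Hh" "proj B y0 = proj B y" "pt \<kappa> B y0 = s i (proj B y0)"
      "y = act B y0 k"
      using frame_point[OF i(1) y i(2)] .
    have "f y0 = band_map t y0"
      using f band_map_frame[OF t i(1) y0(1) _ y0(4)] i y0 by (simp add: \<iota>_def)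
    then show "f y = band_map t y"
      using equi[of f] equi[OF band_map_mor[OF t]] f y0 by simp
  qed
qed

end


section \<open>Comparing maps between local objects\<close>

context lifting_problem begin

text \<open>What remains of a morphism of lifts when invertibility is dropped. This is stable under
  composition and restriction, and it suffices for the comparison of two maps.\<close>

definition lift_map ::
  "('e, 'x, 'k \<times> int) pbundle \<Rightarrow> ('e set \<Rightarrow> 'p) \<Rightarrow> ('e, 'x, 'k \<times> int) pbundle \<Rightarrow> ('e set \<Rightarrow> 'p) \<Rightarrow>
    ('e \<Rightarrow> 'e) \<Rightarrow> bool" where
  "lift_map B \<kappa> B' \<kappa>' f \<longleftrightarrow> smooth_map (total_space B) (total_space B') f \<and>
     (\<forall>y\<in>tot B. proj B' (f y) = proj B y) \<and>
     (\<forall>y\<in>tot B. \<forall>k\<in>carrier Hh. f (act B y k) = act B' (f y) k) \<and>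
     (\<forall>y\<in>tot B. pt \<kappa>' B' (f y) = pt \<kappa> B y)"

lemma lift_mapD:
  assumes "lift_map B \<kappa> B' \<kappa>' f"
  shows "smooth_map (total_space B) (total_space B') f"
    and "\<And>y. y \<in> tot B \<Longrightarrow> f y \<in> tot B'"
    and "\<And>y. y \<in> tot B \<Longrightarrow> proj B' (f y) = proj B y"
    and "\<And>y k. y \<in> tot B \<Longrightarrow> k \<in> carrier Hh \<Longrightarrow> f (act B y k) = act B' (f y) k"
    and "\<And>y. y \<in> tot B \<Longrightarrow> pt \<kappa>' B' (f y) = pt \<kappa> B y"
  using assms by (auto simp: lift_map_def intro: smooth_map_point)

lemma lift_mors_lift_map: "f \<in> lift_mors A Hh (B, \<kappa>) (B', \<kappa>') \<Longrightarrow> lift_map B \<kappa> B' \<kappa>' f"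
  by (simp add: lift_mors_def bundle_iso_def lift_map_def diffeomorphism_def)

text \<open>Two maps over \<open>P\<close> into the same object differ by a unique section of the local system: this is
  why the lifting gerbe is banded by it.\<close>

lemma lift_map_difference:
  fixes B B' :: "('e, 'x, 'k \<times> int) pbundle"
  assumes "lifts_over V B \<kappa>"
    and "lifts_over V B' \<kappa>'"
    and f: "lift_map B \<kappa> B' \<kappa>' f" and f': "lift_map B \<kappa> B' \<kappa>' f'"
  shows "\<exists>!t. t \<in> carrier (sections F V) \<and>
      (\<forall>i\<in>I. \<forall>y\<in>tot B. proj B y \<in> U i \<and> pt \<kappa> B y = s i (proj B y) \<longrightarrow>
        f y = act B' (f' y) (\<iota> (t i (proj B y))))"
proof -
  interpret L: local_lift X Gh G A q \<sigma> \<sigma>h P I U s g \<epsilon> gh V B \<kappa> by (rule assms(1))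
  interpret L': local_lift X Gh G A q \<sigma> \<sigma>h P I U s g \<epsilon> gh V B' \<kappa>' by (rule assms(2))
  note f = lift_mapD[OF f] and f' = lift_mapD[OF f']
  \<comment> \<open>Both maps preserve \<open>pt\<close>, so they differ at \<open>y\<close> by an element \<open>c y\<close> of \<open>A\<close>.\<close>
  define c where "c y = (THE c. c \<in> A \<and> f y = act B' (f' y) (\<iota> c))" for y
  have c_eq: "c y = b" if y: "y \<in> tot B" and b: "b \<in> A" "f y = act B' (f' y) (\<iota> b)" for y b
    unfolding c_def
  proof (rule the_equality)
    fix b' assume b': "b' \<in> A \<and> f y = act B' (f' y) (\<iota> b')"
    then have "\<iota> b' = \<iota> b"
      using b f'(2)[OF y] by (intro L'.act_free[of "f' y"]) auto
    then show "b' = b" by simp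
  qed (use b in simp)
  have c: "c y \<in> A" "f y = act B' (f' y) (\<iota> (c y))" if y: "y \<in> tot B" for y
  proof -
    have "pt \<kappa>' B' (f' y) = pt \<kappa>' B' (f y)"
      using f(5)[OF y] f'(5)[OF y] by simp
    then obtain b where "b \<in> A" "f y = act B' (f' y) (\<iota> b)"
      using L'.pt_fibre[OF f'(2)[OF y] f(2)[OF y]] by blast
    then show "c y \<in> A" "f y = act B' (f' y) (\<iota> (c y))"
      using c_eq[OF y] by auto
  qed
  have c_act: "c (act B y k) = \<sigma>h (snd k) (c y)" if y: "y \<in> tot B" and k: "k \<in> carrier Hh" for y k
  proof (rule c_eq)
    have e: "snd k \<in> Z2" using k by (auto simp: Gh.carrier_semidirect)
    show "act B y k \<in> tot B" by (rule L.act_in[OF y k])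
    show "\<sigma>h (snd k) (c y) \<in> A" using c(1)[OF y] e by simp
    have "f (act B y k) = act B' (f' y) (\<iota> (c y) \<otimes>\<^bsub>Hh\<^esub> k)"
      using f(4)[OF y k] c[OF y] f'(2)[OF y] k L'.act_act by simp
    also have "\<iota> (c y) \<otimes>\<^bsub>Hh\<^esub> k = k \<otimes>\<^bsub>Hh\<^esub> \<iota> (\<sigma>h (snd k) (c y))"
      using twisted_central[OF k, of "\<sigma>h (snd k) (c y)"] c(1)[OF y] e by simp
    also have "act B' (f' y) \<dots> = act B' (f' (act B y k)) (\<iota> (\<sigma>h (snd k) (c y)))"
      using f'(4)[OF y k] f'(2)[OF y] k c(1)[OF y] e by (simp add: L'.act_act)
    finally show "f (act B y k) = act B' (f' (act B y k)) (\<iota> (\<sigma>h (snd k) (c y)))" .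
  qed
  have c_plot: "(\<lambda>w. c (p w)) \<in> plots (dsp Gh) n W" if p: "p \<in> plots (total_space B) n W" for p n W
  proof -
    have in_B: "p w \<in> tot B" if "w \<in> W" for w
      using plot_in_points[OF L.total p that] .
    obtain k where k: "k \<in> plots (dsp Hh) n W" "\<forall>w\<in>W. f (p w) = act B' (f' (p w)) (k w)"
      using L'.division_plot[OF smooth_map_plot[OF f'(1) p] smooth_map_plot[OF f(1) p]] in_B f(3) f'(3)
      by auto
    have "k w = \<iota> (c (p w))" if "w \<in> W" for w
      using k(2) that c[OF in_B[OF that]] f'(2)[OF in_B[OF that]]
        plot_in_carrier[OF Gh.diffeological_group_semidirect k(1) that]
      by (intro L'.act_free[of "f' (p w)"]) auto
    then have ck: "c (p w) = fst (k w)" if "w \<in> W" for w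
      using that by (simp add: \<iota>_def)
    have "(\<lambda>w. fst (k w)) \<in> plots (dsp Gh) n W"
      using k(1) by (simp add: Gh.plots_semidirect)
    from plot_cong[OF diffeological_group_space[OF Gh.diffeological] this ck] show ?thesis .
  qed
  have frame: "\<exists>y. y \<in> tot B \<and> pt \<kappa> B y = s i u \<and> proj B y = u" if "i \<in> I" "u \<in> V" "u \<in> U i" for i u
    using L.pt_surj[OF s_in[OF that(1,3)]] that by (auto simp: proj_s[OF that(1,3)])
  \<comment> \<open>The value of the section in the frame \<open>i\<close> is \<open>c\<close> at any point over \<open>s i\<close>; by \<open>c_act\<close> the choice
    does not matter, which is also what makes the value smooth.\<close>
  define y where "y i u = (SOME y. y \<in> tot B \<and> pt \<kappa> B y = s i u \<and> proj B y = u)" for i u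
  have y: "y i u \<in> tot B" "pt \<kappa> B (y i u) = s i u" "proj B (y i u) = u" if "i \<in> I" "u \<in> V" "u \<in> U i" for i u
    using someI_ex[OF frame[OF that]] by (auto simp: y_def)
  have c_y: "c z = c (y i u)" if iu: "i \<in> I" "u \<in> V" "u \<in> U i" and z: "z \<in> tot B" "pt \<kappa> B z = s i u" for i u z
  proof -
    obtain b where b: "b \<in> A" "z = act B (y i u) (\<iota> b)"
      using L.pt_fibre[OF y(1)[OF iu] z(1)] y(2)[OF iu] z(2) by metis
    then show ?thesis
      using c_act[OF y(1)[OF iu] \<iota>_carrier[OF b(1)]] c(1)[OF y(1)[OF iu]] by (simp add: \<iota>_def)
  qed
  define t where "t = (\<lambda>i\<in>I. \<lambda>u\<in>V \<inter> U i. c (y i u))"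
  have t: "t \<in> carrier (sections F V)"
    unfolding t_def
  proof (rule sectionI)
    fix i u assume "i \<in> I" "u \<in> V" "u \<in> U i"
    then show "c (y i u) \<in> A" using c(1) y(1) by simp
  next
    fix i n W p assume i: "i \<in> I" and p: "p \<in> plots X n W" and W: "\<And>w. w \<in> W \<Longrightarrow> p w \<in> V \<and> p w \<in> U i"
    show "(\<lambda>w. c (y i (p w))) \<in> plots (dsp Gh) n W"
    proof (rule plot_local[OF diffeological_group_space[OF Gh.diffeological] plot_openin[OF space p]])
      fix w assume w: "w \<in> W"
      have sp: "(\<lambda>w. s i (p w)) \<in> plots (total_space P) n W"
        using smooth_map_plot[OF section_s[OF i], of p] p W by (simp add: plots_sub_space)
      obtain W' r where W': "openin (Euclidean_space n) W'" "w \<in> W'" "W' \<subseteq> W" "r \<in> plots (total_space B) n W'"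
        "\<forall>v\<in>W'. pt \<kappa> B (r v) = s i (p v)"
        using L.pt_lift[OF sp _ w] W by (auto simp: proj_s[OF i])
      have "c (y i (p v)) = c (r v)" if v: "v \<in> W'" for v
        using c_y[OF i, of "p v" "r v"] W W'(3,5) plot_in_points[OF L.total W'(4) v] v by auto
      then show "\<exists>V r. openin (Euclidean_space n) V \<and> w \<in> V \<and> V \<subseteq> W \<and> r \<in> plots (dsp Gh) n V \<and>
          (\<forall>v\<in>V. c (y i (p v)) = r v)"
        using W' c_plot[OF W'(4)] by blast
    qed
  next
    fix i j u assume ij: "i \<in> I" "j \<in> I" and u: "u \<in> V" "u \<in> U i" "u \<in> U j"
    obtain k where k: "k \<in> carrier Hh" "\<rho> k = h i j u"
      using \<rho>_surj[OF h_in[OF ij u(2,3)]] .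
    note yi = y[OF ij(1) u(1,2)]
    have e: "snd k = \<epsilon> i j u"
      using k(2) by (metis h_def id_apply snd_conv snd_map_prod)
    have "pt \<kappa> B (act B (y i u) k) = s j u"
      using L.pt_act[OF yi(1) k(1)] yi(2) k(2) s_h[OF ij u(2,3)] by simp
    then have "c (y j u) = \<sigma>h (\<epsilon> i j u) (c (y i u))"
      using c_y[OF ij(2) u(1,3) L.act_in[OF yi(1) k(1)]] c_act[OF yi(1) k(1)] e by simp
    then show "c (y i u) = \<sigma>h (\<epsilon> i j u) (c (y j u))"
      using ij u c(1)[OF yi(1)] by simp
  qed
  show ?thesis
  proof (intro ex1I conjI ballI impI)
    show "t \<in> carrier (sections F V)" by (rule t)
    fix i z assume i: "i \<in> I" and z: "z \<in> tot B" "proj B z \<in> U i \<and> pt \<kappa> B z = s i (proj B z)"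
    have "t i (proj B z) = c z"
      using c_y[OF i L.proj_in[OF z(1)] _ z(1)] z L.proj_in[OF z(1)] i by (simp add: t_def)
    then show "f z = act B' (f' z) (\<iota> (t i (proj B z)))"
      using c(2)[OF z(1)] by simp
  next
    fix t' assume t': "t' \<in> carrier (sections F V) \<and> (\<forall>i\<in>I. \<forall>y\<in>tot B.
      proj B y \<in> U i \<and> pt \<kappa> B y = s i (proj B y) \<longrightarrow> f y = act B' (f' y) (\<iota> (t' i (proj B y))))"
    show "t' = t"
    proof (rule section_eqI[OF conjunct1[OF t'] t])
      fix u assume u: "u \<in> V" "u \<in> points X"
      obtain i where i: "i \<in> I" "u \<in> U i" using cover_point[OF u(2)] by blast
      note yi = y[OF i(1) u(1) i(2)]
      have "c (y i u) = t' i u"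
        using t' i yi section_in_A[of t' V i u] u by (intro c_eq) auto
      then show "\<exists>i\<in>I. u \<in> U i \<and> t' i u = t i u"
        using i u by (intro bexI[of _ i]) (simp_all add: t_def)
    qed
  qed
qed

end

section \<open>The cocycle of a choice of local objects\<close>

context lifting_problem begin

lemma lift_map_restrict:
  assumes "lifts_over V B \<kappa>"
    and "lifts_over V B' \<kappa>'"
    and f: "lift_map B \<kappa> B' \<kappa>' f"
  shows "lift_map (bundle_res W B) \<kappa> (bundle_res W B') \<kappa>' (restrict f (tot (bundle_res W B)))"
proof -
  interpret L: local_lift X Gh G A q \<sigma> \<sigma>h P I U s g \<epsilon> gh V B \<kappa> by (rule assms(1))
  interpret L': local_lift X Gh G A q \<sigma> \<sigma>h P I U s g \<epsilon> gh V B' \<kappa>' by (rule assms(2))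
  note f = lift_mapD[OF f]
  have "smooth_map (total_space (bundle_res W B)) (total_space (bundle_res W B'))
      (restrict f (tot (bundle_res W B)))"
  proof (rule smooth_mapI)
    fix n Z p assume "p \<in> plots (total_space (bundle_res W B)) n Z"
    then have p: "p \<in> plots (total_space B) n Z" "\<forall>z\<in>Z. proj B (p z) \<in> W"
      by (simp_all add: plots_bundle_res)
    have in_B: "p z \<in> tot B" if "z \<in> Z" for z
      by (rule plot_in_points[OF L.total p(1) that])
    have "(\<lambda>z. restrict f (tot (bundle_res W B)) (p z)) \<in> plots (total_space B') n Z"
      by (rule plot_cong[OF L'.total smooth_map_plot[OF f(1) p(1)]]) (use p(2) in_B in simp)
    then show "(\<lambda>z. restrict f (tot (bundle_res W B)) (p z)) \<in> plots (total_space (bundle_res W B')) n Z"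
      using p(2) in_B f(3) by (simp add: plots_bundle_res)
  qed (simp add: f)
  then show ?thesis
    unfolding lift_map_def by (simp add: f L.act_in L.proj_act)
qed

lemma lift_map_compose:
  assumes "lifts_over V B \<kappa>"
    and "lifts_over V B'' \<kappa>''"
    and f: "lift_map B \<kappa> B' \<kappa>' f" and f': "lift_map B' \<kappa>' B'' \<kappa>'' f'"
  shows "lift_map B \<kappa> B'' \<kappa>'' (compose (tot B) f' f)"
proof -
  interpret L: local_lift X Gh G A q \<sigma> \<sigma>h P I U s g \<epsilon> gh V B \<kappa> by (rule assms(1))
  interpret L'': local_lift X Gh G A q \<sigma> \<sigma>h P I U s g \<epsilon> gh V B'' \<kappa>'' by (rule assms(2))
  note f = lift_mapD[OF f] and f' = lift_mapD[OF f']
  have "smooth_map (total_space B) (total_space B'') (\<lambda>y. f' (f y))"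
    by (intro smooth_mapI smooth_map_plot[OF f'(1)] smooth_map_plot[OF f(1)]) (simp_all add: f f')
  then have "smooth_map (total_space B) (total_space B'') (compose (tot B) f' f)"
    by (rule smooth_map_cong[OF L.total L''.total]) (simp add: compose_def)
  then show ?thesis
    unfolding lift_map_def by (simp add: compose_def f f' L.act_in)
qed

text \<open>Maps over \<open>P\<close> are equivariant, so they are determined on the points over the frames \<open>s i\<close>.\<close>

lemma lift_map_eqI:
  assumes "lifts_over V B \<kappa>"
    and f: "lift_map B \<kappa> B' \<kappa>' f" "f \<in> extensional (tot B)"
    and f': "lift_map B \<kappa> B' \<kappa>' f'" "f' \<in> extensional (tot B)"
    and eq: "\<And>i y. i \<in> I \<Longrightarrow> y \<in> tot B \<Longrightarrow> proj B y \<in> U i \<Longrightarrow> pt \<kappa> B y = s i (proj B y) \<Longrightarrow> f y = f' y"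
  shows "f = f'"
proof (rule extensionalityI[OF f(2) f'(2)])
  interpret L: local_lift X Gh G A q \<sigma> \<sigma>h P I U s g \<epsilon> gh V B \<kappa> by (rule assms(1))
  fix y assume y: "y \<in> tot B"
  obtain i where i: "i \<in> I" "proj B y \<in> U i" using L.frame_exists[OF y] .
  obtain y0 k where y0: "y0 \<in> tot B" "k \<in> carrier Hh" "proj B y0 = proj B y" "pt \<kappa> B y0 = s i (proj B y0)"
    "y = act B y0 k"
    using L.frame_point[OF i(1) y i(2)] .
  have "f y0 = f' y0"
    using eq[OF i(1) y0(1) _ y0(4)] i y0(3) by simp
  then show "f y = f' y"
    using lift_mapD(4)[OF f(1) y0(1,2)] lift_mapD(4)[OF f'(1) y0(1,2)] y0(5) by simp
qed

text \<open>This translates \<open>lift_map_difference\<close> into the equation of morphisms by which the defect of a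
  choice of local objects is defined.\<close>

lemma band_difference_iff:
  assumes L: "lifts_over V B \<kappa>"
    and L': "lifts_over V B' \<kappa>'"
    and f: "lift_map B \<kappa> B' \<kappa>' f" "f \<in> extensional (tot B)" and f': "lift_map B \<kappa> B' \<kappa>' f'"
    and t: "t \<in> carrier (sections F V)"
  shows "f = compose (tot B) (lift_band A Hh I U s (B', \<kappa>') t) f' \<longleftrightarrow>
    (\<forall>i\<in>I. \<forall>y\<in>tot B. proj B y \<in> U i \<and> pt \<kappa> B y = s i (proj B y) \<longrightarrow>
      f y = act B' (f' y) (\<iota> (t i (proj B y))))"
    (is "f = ?g \<longleftrightarrow> ?R")
proof -
  interpret L': local_lift X Gh G A q \<sigma> \<sigma>h P I U s g \<epsilon> gh V B' \<kappa>' by (rule L')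
  have band: "lift_map B' \<kappa>' B' \<kappa>' (L'.band_map t)"
    by (rule lift_mors_lift_map[OF L'.band_map_mor[OF t]])
  have g: "lift_map B \<kappa> B' \<kappa>' ?g" "?g \<in> extensional (tot B)"
    unfolding L'.lift_band_eq[OF t] by (rule lift_map_compose[OF L L' f' band]) simp
  have val: "?g y = act B' (f' y) (\<iota> (t i (proj B y)))"
    if "i \<in> I" "y \<in> tot B" "proj B y \<in> U i" "pt \<kappa> B y = s i (proj B y)" for i y
    using L'.band_map_frame[OF t that(1) lift_mapD(2)[OF f' that(2)]] that
      lift_mapD(3,5)[OF f' that(2)] L'.lift_band_eq[OF t] by (simp add: compose_def)
  show ?thesis
  proof
    assume "f = ?g" then show ?R using val by metis
  next
    assume R: ?R
    show "f = ?g"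
      by (rule lift_map_eqI[OF L f g]) (use R val in auto)
  qed
qed

end

locale gerbe_choice = lifting_problem X Gh G A q \<sigma> \<sigma>h P I U s g \<epsilon> gh
  for X :: "'x dspace" and Gh :: "'k dgroup" and G :: "'g dgroup" and A q \<sigma> \<sigma>h
    and P :: "('p, 'x, 'g \<times> int) pbundle" and I :: "'i set" and U s g \<epsilon> gh +
  fixes K :: "'l set" and V :: "'l \<Rightarrow> 'x set" and x :: "'l \<Rightarrow> ('e, 'x, 'k, 'p) lift_obj"
    and \<phi> :: "'l \<Rightarrow> 'l \<Rightarrow> 'e \<Rightarrow> 'e"
  assumes data: "gerbe_data X (lifting_gerbe X A Hh H q P I U s) K V x \<phi>"
begin

abbreviation B where "B k \<equiv> fst (x k)"
abbreviation \<kappa> where "\<kappa> k \<equiv> snd (x k)"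
abbreviation lp where "lp k \<equiv> pt (\<kappa> k) (B k)"

lemma object: "k \<in> K \<Longrightarrow> (B k, \<kappa> k) \<in> lift_objs X A Hh H q P (V k)"
  using data by (simp add: gerbe_data_def lifting_gerbe_def)

lemma local_lift: "k \<in> K \<Longrightarrow> lifts_over (V k) (B k) (\<kappa> k)"
  by (rule local_lift_object[OF object])

lemma local_lift_on: "k \<in> K \<Longrightarrow> W \<subseteq> V k \<Longrightarrow>
    lifts_over W (bundle_res W (B k)) (\<kappa> k)"
  by (rule local_lift_restrict[OF local_lift])

lemma \<phi>_lift_map:
  assumes "k \<in> K" "l \<in> K"
  shows "lift_map (bundle_res (V k \<inter> V l) (B l)) (\<kappa> l) (bundle_res (V k \<inter> V l) (B k)) (\<kappa> k) (\<phi> k l)"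
proof -
  have "\<phi> k l \<in> lift_mors A Hh (bundle_res (V k \<inter> V l) (B l), \<kappa> l) (bundle_res (V k \<inter> V l) (B k), \<kappa> k)"
    using data assms by (simp add: gerbe_data_def lifting_gerbe_def case_prod_unfold)
  then show ?thesis by (rule lift_mors_lift_map)
qed

lemma \<phi>:
  assumes "k \<in> K" "l \<in> K" "y \<in> tot (B l)" "proj (B l) y \<in> V k"
  shows "\<phi> k l y \<in> tot (B k)" "proj (B k) (\<phi> k l y) = proj (B l) y" "lp k (\<phi> k l y) = lp l y"
    and "c \<in> carrier Hh \<Longrightarrow> \<phi> k l (act (B l) y c) = act (B k) (\<phi> k l y) c"
proof -
  interpret L: local_lift X Gh G A q \<sigma> \<sigma>h P I U s g \<epsilon> gh "V l" "B l" "\<kappa> l"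
    by (rule local_lift[OF assms(2)])
  have y: "y \<in> tot (bundle_res (V k \<inter> V l) (B l))"
    using assms L.proj_in by simp
  note m = lift_mapD[OF \<phi>_lift_map[OF assms(1,2)]]
  show "\<phi> k l y \<in> tot (B k)" "proj (B k) (\<phi> k l y) = proj (B l) y" "lp k (\<phi> k l y) = lp l y"
    using m(2)[OF y] m(3)[OF y] m(5)[OF y] by simp_all
  show "\<phi> k l (act (B l) y c) = act (B k) (\<phi> k l y) c" if "c \<in> carrier Hh"
    using m(4)[OF y that] by simp
qed

abbreviation defect where
  "defect \<equiv> gerbe_defect F (lifting_gerbe X A Hh H q P I U s) V x \<phi>"

text \<open>The defect is defined by a definite description; on a point over a frame it can be read off, and
  all later computations use only this. The restrictions to the triple intersection disappear here.\<close>

lemma defect: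
  assumes klm: "k \<in> K" "l \<in> K" "m \<in> K"
  shows "defect k l m \<in> carrier (sections F (V k \<inter> V l \<inter> V m))"
    and "\<lbrakk>i \<in> I; y \<in> tot (B m); proj (B m) y \<in> V k; proj (B m) y \<in> V l; proj (B m) y \<in> U i;
      lp m y = s i (proj (B m) y)\<rbrakk> \<Longrightarrow>
      \<phi> k l (\<phi> l m y) = act (B k) (\<phi> k m y) (\<iota> (defect k l m i (proj (B m) y)))"
proof -
  let ?W = "V k \<inter> V l \<inter> V m"
  define \<psi> where "\<psi> a b = restrict (\<phi> a b) (tot (bundle_res ?W (bundle_res (V a \<inter> V b) (B b))))" for a b
  have res: "bundle_res ?W (bundle_res (V a \<inter> V b) (B c)) = bundle_res ?W (B c)"
    if "?W \<subseteq> V a \<inter> V b" for a b c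
  proof -
    have "V a \<inter> V b \<inter> ?W = ?W" using that by blast
    then show ?thesis by (simp only: bundle_res_bundle_res)
  qed
  have \<psi>: "lift_map (bundle_res ?W (B b)) (\<kappa> b) (bundle_res ?W (B a)) (\<kappa> a) (\<psi> a b)"
    if "a \<in> K" "b \<in> K" "?W \<subseteq> V a" "?W \<subseteq> V b" for a b
  proof -
    have sub: "?W \<subseteq> V a \<inter> V b" using that by blast
    have "lift_map (bundle_res ?W (bundle_res (V a \<inter> V b) (B b))) (\<kappa> b)
        (bundle_res ?W (bundle_res (V a \<inter> V b) (B a))) (\<kappa> a) (\<psi> a b)"
      unfolding \<psi>_def
      by (rule lift_map_restrict[OF local_lift_on local_lift_on \<phi>_lift_map]) (use that in auto)
    then show ?thesis
      by (simp only: res[OF sub])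
  qed
  have L: "lifts_over ?W (bundle_res ?W (B c)) (\<kappa> c)"
    if "c \<in> K" "?W \<subseteq> V c" for c
    by (rule local_lift_on[OF that])
  note Lm = L[OF klm(3) Int_lower2] and Lk = L[OF klm(1), OF le_infI1, OF Int_lower1]
  let ?f = "compose (tot (bundle_res ?W (B m))) (\<psi> k l) (\<psi> l m)"
  have f: "lift_map (bundle_res ?W (B m)) (\<kappa> m) (bundle_res ?W (B k)) (\<kappa> k) ?f"
    by (rule lift_map_compose[OF Lm Lk \<psi> \<psi>]) (use klm in auto)
  have f': "lift_map (bundle_res ?W (B m)) (\<kappa> m) (bundle_res ?W (B k)) (\<kappa> k) (\<psi> k m)"
    by (rule \<psi>) (use klm in auto)
  have fe: "?f \<in> extensional (tot (bundle_res ?W (B m)))" by simp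
  let ?R = "\<lambda>t. \<forall>i\<in>I. \<forall>y\<in>tot (bundle_res ?W (B m)). proj (bundle_res ?W (B m)) y \<in> U i \<and>
      pt (\<kappa> m) (bundle_res ?W (B m)) y = s i (proj (bundle_res ?W (B m)) y) \<longrightarrow>
      ?f y = act (bundle_res ?W (B k)) (\<psi> k m y) (\<iota> (t i (proj (bundle_res ?W (B m)) y)))"
  have "defect k l m = (THE t. t \<in> carrier (sections F ?W) \<and>
      ?f = compose (tot (bundle_res ?W (B m))) (lift_band A Hh I U s (bundle_res ?W (B k), \<kappa> k) t) (\<psi> k m))"
    unfolding gerbe_defect_def Let_def lifting_gerbe_def banded_stack.select_convs
    by (simp only: case_prod_unfold fst_conv snd_conv \<psi>_def)
  also have "\<dots> = (THE t. t \<in> carrier (sections F ?W) \<and> ?R t)"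
    using band_difference_iff[OF Lm Lk f fe f'] by (intro arg_cong[where f = The] ext) blast
  finally have eq: "defect k l m = (THE t. t \<in> carrier (sections F ?W) \<and> ?R t)" .
  from theI'[OF lift_map_difference[OF Lm Lk f f']]
  have t: "defect k l m \<in> carrier (sections F ?W)" "?R (defect k l m)"
    unfolding eq by blast+
  show "defect k l m \<in> carrier (sections F ?W)" by (rule t(1))
  assume y: "i \<in> I" "y \<in> tot (B m)" "proj (B m) y \<in> V k" "proj (B m) y \<in> V l" "proj (B m) y \<in> U i"
    "lp m y = s i (proj (B m) y)"
  interpret L: local_lift X Gh G A q \<sigma> \<sigma>h P I U s g \<epsilon> gh "V m" "B m" "\<kappa> m"
    by (rule local_lift[OF klm(3)])
  have ym: "proj (B m) y \<in> V m" by (rule L.proj_in[OF y(2)])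
  have "?f y = act (B k) (\<psi> k m y) (\<iota> (defect k l m i (proj (B m) y)))"
    using t(2) y ym by simp
  moreover have "\<psi> k m y = \<phi> k m y" "\<psi> l m y = \<phi> l m y" "\<psi> k l (\<phi> l m y) = \<phi> k l (\<phi> l m y)"
    using y ym \<phi>[OF klm(2,3) y(2,4)] by (simp_all add: \<psi>_def)
  ultimately show "\<phi> k l (\<phi> l m y) = act (B k) (\<phi> k m y) (\<iota> (defect k l m i (proj (B m) y)))"
    using y ym by (simp add: compose_def)
qed

lemma defect_in_A:
  "\<lbrakk>k \<in> K; l \<in> K; m \<in> K; i \<in> I; u \<in> V k; u \<in> V l; u \<in> V m; u \<in> U i\<rbrakk> \<Longrightarrow> defect k l m i u \<in> A"
  using section_in_A[OF defect(1)] by blast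

text \<open>Both products compare \<open>\<phi> k l \<circ> \<phi> l m \<circ> \<phi> m n\<close> with \<open>\<phi> k n\<close> on a point over a frame. No twist
  appears because the isomorphisms \<open>\<phi>\<close> commute with the action of the structure group.\<close>

lemma defect_cocycle: "cech_cocycle F K V defect"
  unfolding cech_cocycle_def Let_def
proof (intro conjI ballI defect(1))
  fix k l m n assume K: "k \<in> K" "l \<in> K" "m \<in> K" "n \<in> K"
  let ?W = "V k \<inter> V l \<inter> V m \<inter> V n"
  have in_W: "sec_res F ?W (defect k' l' m') \<in> carrier (sections F ?W)"
    if "k' \<in> K" "l' \<in> K" "m' \<in> K" "?W \<subseteq> V k' \<inter> V l' \<inter> V m'" for k' l' m'
    by (rule section_res_closed[OF that(4) defect(1)[OF that(1-3)]])
  show "sec_res F ?W (defect k l m) \<otimes>\<^bsub>sections F ?W\<^esub> sec_res F ?W (defect k m n)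
      = sec_res F ?W (defect l m n) \<otimes>\<^bsub>sections F ?W\<^esub> sec_res F ?W (defect k l n)"
  proof (rule section_eqI)
    fix u assume u: "u \<in> ?W" "u \<in> points X"
    obtain i where i: "i \<in> I" "u \<in> U i" using cover_point[OF u(2)] by blast
    interpret Ln: local_lift X Gh G A q \<sigma> \<sigma>h P I U s g \<epsilon> gh "V n" "B n" "\<kappa> n"
      by (rule local_lift[OF K(4)])
    interpret Lk: local_lift X Gh G A q \<sigma> \<sigma>h P I U s g \<epsilon> gh "V k" "B k" "\<kappa> k"
      by (rule local_lift[OF K(1)])
    obtain z where z: "z \<in> tot (B n)" "lp n z = s i u" "proj (B n) z = u"
      using Ln.pt_surj[OF s_in[OF i]] u by (auto simp: proj_s[OF i])
    have c: "defect k l m i u \<in> A" "defect k m n i u \<in> A" "defect l m n i u \<in> A" "defect k l n i u \<in> A"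
      using defect_in_A K i u by auto
    have mz: "\<phi> m n z \<in> tot (B m)" "proj (B m) (\<phi> m n z) = u" "lp m (\<phi> m n z) = s i u"
      using \<phi>[OF K(3,4) z(1)] z u by auto
    have kz: "\<phi> k n z \<in> tot (B k)" and lz: "\<phi> l n z \<in> tot (B l)" "proj (B l) (\<phi> l n z) = u"
      using \<phi>[OF K(1,4) z(1)] \<phi>[OF K(2,4) z(1)] z u by auto
    have "\<phi> k l (\<phi> l m (\<phi> m n z)) = act (B k) (\<phi> k m (\<phi> m n z)) (\<iota> (defect k l m i u))"
      using defect(2)[OF K(1-3) i(1) mz(1)] mz u i by simp
    also have "\<dots> = act (B k) (act (B k) (\<phi> k n z) (\<iota> (defect k m n i u))) (\<iota> (defect k l m i u))"
      using defect(2)[OF K(1,3,4) i(1) z(1)] z u i by simp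
    also have "\<dots> = act (B k) (\<phi> k n z) (\<iota> (defect k m n i u \<otimes>\<^bsub>Gh\<^esub> defect k l m i u))"
      using kz c by (simp add: Lk.act_act \<iota>_mult)
    finally have 1: "\<phi> k l (\<phi> l m (\<phi> m n z))
        = act (B k) (\<phi> k n z) (\<iota> (defect k m n i u \<otimes>\<^bsub>Gh\<^esub> defect k l m i u))" .
    have "\<phi> k l (\<phi> l m (\<phi> m n z)) = \<phi> k l (act (B l) (\<phi> l n z) (\<iota> (defect l m n i u)))"
      using defect(2)[OF K(2-4) i(1) z(1)] z u i by simp
    also have "\<dots> = act (B k) (\<phi> k l (\<phi> l n z)) (\<iota> (defect l m n i u))"
      using \<phi>(4)[OF K(1,2) lz(1)] lz u c by simp
    also have "\<dots> = act (B k) (act (B k) (\<phi> k n z) (\<iota> (defect k l n i u))) (\<iota> (defect l m n i u))"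
      using defect(2)[OF K(1,2,4) i(1) z(1)] z u i by simp
    also have "\<dots> = act (B k) (\<phi> k n z) (\<iota> (defect k l n i u \<otimes>\<^bsub>Gh\<^esub> defect l m n i u))"
      using kz c by (simp add: Lk.act_act \<iota>_mult)
    finally have "\<iota> (defect k m n i u \<otimes>\<^bsub>Gh\<^esub> defect k l m i u)
        = \<iota> (defect k l n i u \<otimes>\<^bsub>Gh\<^esub> defect l m n i u)"
      using 1 c by (intro Lk.act_free[OF kz]) auto
    then have "defect k l m i u \<otimes>\<^bsub>Gh\<^esub> defect k m n i u = defect l m n i u \<otimes>\<^bsub>Gh\<^esub> defect k l n i u"
      using c by (simp add: A_central)
    then show "\<exists>i\<in>I. u \<in> U i \<and>
      (sec_res F ?W (defect k l m) \<otimes>\<^bsub>sections F ?W\<^esub> sec_res F ?W (defect k m n)) i u =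
      (sec_res F ?W (defect l m n) \<otimes>\<^bsub>sections F ?W\<^esub> sec_res F ?W (defect k l n)) i u"
      using i u by (intro bexI[of _ i]) simp_all
  qed (use K in \<open>auto intro!: section_mult_closed in_W\<close>)
qed

end

text \<open>Local sections \<open>e p\<close> of the chosen objects that lift the frames \<open>s (fr p)\<close>. With respect to
  them the isomorphisms \<open>\<phi>\<close> are given by functions \<open>lam p r\<close> into the extended group, which are a
  second lift of the transition functions of \<open>P\<close>.\<close>

locale gerbe_sections = gerbe_choice X Gh G A q \<sigma> \<sigma>h P I U s g \<epsilon> gh K V x \<phi>
  for X :: "'x dspace" and Gh :: "'k dgroup" and G :: "'g dgroup" and A q \<sigma> \<sigma>h
    and P :: "('p, 'x, 'g \<times> int) pbundle" and I :: "'i set" and U s g \<epsilon> gh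
    and K :: "'l set" and V :: "'l \<Rightarrow> 'x set" and x :: "'l \<Rightarrow> ('e, 'x, 'k, 'p) lift_obj"
    and \<phi> :: "'l \<Rightarrow> 'l \<Rightarrow> 'e \<Rightarrow> 'e" +
  fixes L :: "'x set" and W :: "'x \<Rightarrow> 'x set" and ob :: "'x \<Rightarrow> 'l" and fr :: "'x \<Rightarrow> 'i"
    and e :: "'x \<Rightarrow> 'x \<Rightarrow> 'e"
  assumes cover_W: "open_cover X L W"
    and ob: "ob \<in> L \<rightarrow> K" "\<forall>p\<in>L. W p \<subseteq> V (ob p)"
    and fr: "fr \<in> L \<rightarrow> I" "\<forall>p\<in>L. W p \<subseteq> U (fr p)"
    and e_smooth: "\<And>p. p \<in> L \<Longrightarrow> smooth_map (sub_space X (W p)) (total_space (B (ob p))) (e p)"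
    and e_frame: "\<And>p u. p \<in> L \<Longrightarrow> u \<in> W p \<Longrightarrow> lp (ob p) (e p u) = s (fr p) u"
begin

lemma W_point: "p \<in> L \<Longrightarrow> u \<in> W p \<Longrightarrow> u \<in> points X"
  using cover_W by (auto simp: open_cover_def)

lemma ob_K [simp]: "p \<in> L \<Longrightarrow> ob p \<in> K" and fr_I [simp]: "p \<in> L \<Longrightarrow> fr p \<in> I"
  and W_V [simp]: "p \<in> L \<Longrightarrow> u \<in> W p \<Longrightarrow> u \<in> V (ob p)" and W_U [simp]: "p \<in> L \<Longrightarrow> u \<in> W p \<Longrightarrow> u \<in> U (fr p)"
  using ob fr by auto

lemma e_in: "p \<in> L \<Longrightarrow> u \<in> W p \<Longrightarrow> e p u \<in> tot (B (ob p))"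
  using smooth_map_point[OF e_smooth, of p u] W_point by auto

lemma proj_e: assumes "p \<in> L" "u \<in> W p" shows "proj (B (ob p)) (e p u) = u"
proof -
  interpret Lp: local_lift X Gh G A q \<sigma> \<sigma>h P I U s g \<epsilon> gh "V (ob p)" "B (ob p)" "\<kappa> (ob p)"
    using assms by (intro local_lift) simp
  show ?thesis
    using Lp.proj_pt[OF e_in[OF assms]] assms by (simp add: e_frame proj_s)
qed

lemma \<phi>_e:
  assumes "p \<in> L" "r \<in> L" "u \<in> W p" "u \<in> W r"
  shows "\<phi> (ob p) (ob r) (e r u) \<in> tot (B (ob p))" "proj (B (ob p)) (\<phi> (ob p) (ob r) (e r u)) = u"
    "lp (ob p) (\<phi> (ob p) (ob r) (e r u)) = s (fr r) u"
  using \<phi>(1-3)[of "ob p" "ob r" "e r u"] assms by (simp_all add: e_in proj_e e_frame)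

definition lam :: "'x \<Rightarrow> 'x \<Rightarrow> 'x \<Rightarrow> 'k \<times> int" where
  "lam p r u = (THE k. k \<in> carrier Hh \<and> \<phi> (ob p) (ob r) (e r u) = act (B (ob p)) (e p u) k)"

lemma lam:
  assumes "p \<in> L" "r \<in> L" "u \<in> W p" "u \<in> W r"
  shows "lam p r u \<in> carrier Hh" "\<phi> (ob p) (ob r) (e r u) = act (B (ob p)) (e p u) (lam p r u)"
    and "\<rho> (lam p r u) = h (fr p) (fr r) u"
proof -
  interpret Lp: local_lift X Gh G A q \<sigma> \<sigma>h P I U s g \<epsilon> gh "V (ob p)" "B (ob p)" "\<kappa> (ob p)"
    using assms by (intro local_lift) simp
  note ep = e_in[OF assms(1,3)]
  obtain k where k: "k \<in> carrier Hh" "\<phi> (ob p) (ob r) (e r u) = act (B (ob p)) (e p u) k"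
    using Lp.act_transitive[OF ep \<phi>_e(1)[OF assms]] \<phi>_e(2)[OF assms] proj_e[OF assms(1,3)] by auto
  have "lam p r u = k"
    unfolding lam_def using k Lp.act_free[OF ep] by (intro the_equality) auto
  then show *: "lam p r u \<in> carrier Hh" "\<phi> (ob p) (ob r) (e r u) = act (B (ob p)) (e p u) (lam p r u)"
    using k by auto
  have "act P (s (fr p) u) (\<rho> (lam p r u)) = s (fr r) u"
    using Lp.pt_act[OF ep *(1)] \<phi>_e(3)[OF assms] *(2) e_frame[OF assms(1,3)] by simp
  then have "act P (s (fr p) u) (\<rho> (lam p r u)) = act P (s (fr p) u) (h (fr p) (fr r) u)"
    using s_h[of "fr p" "fr r" u] assms by simp
  then show "\<rho> (lam p r u) = h (fr p) (fr r) u"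
    using assms *(1) by (intro P.act_free[OF s_in[of "fr p" u]]) (simp_all add: h_in)
qed

lemma lam_plot:
  assumes "p \<in> L" "r \<in> L" and c: "c \<in> plots X n Z" "\<And>z. z \<in> Z \<Longrightarrow> c z \<in> W p \<and> c z \<in> W r"
  shows "(\<lambda>z. lam p r (c z)) \<in> plots (dsp Hh) n Z"
proof -
  interpret Lp: local_lift X Gh G A q \<sigma> \<sigma>h P I U s g \<epsilon> gh "V (ob p)" "B (ob p)" "\<kappa> (ob p)"
    using assms by (intro local_lift) simp
  have ep: "(\<lambda>z. e p (c z)) \<in> plots (total_space (B (ob p))) n Z"
    using smooth_map_plot[OF e_smooth[OF assms(1)]] c by (simp add: plots_sub_space)
  have "(\<lambda>z. e r (c z)) \<in> plots (total_space (bundle_res (V (ob p) \<inter> V (ob r)) (B (ob r)))) n Z"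
    using smooth_map_plot[OF e_smooth[OF assms(2)]] c assms(1,2) by (simp add: plots_sub_space plots_bundle_res proj_e)
  then have "(\<lambda>z. \<phi> (ob p) (ob r) (e r (c z)))
      \<in> plots (total_space (bundle_res (V (ob p) \<inter> V (ob r)) (B (ob p)))) n Z"
    by (rule smooth_map_plot[OF lift_mapD(1)[OF \<phi>_lift_map], rotated 2]) (use assms in simp_all)
  then have "(\<lambda>z. \<phi> (ob p) (ob r) (e r (c z))) \<in> plots (total_space (B (ob p))) n Z"
    by (simp add: plots_bundle_res)
  from Lp.division_plot[OF ep this] obtain k where k: "k \<in> plots (dsp Hh) n Z"
    "\<forall>z\<in>Z. \<phi> (ob p) (ob r) (e r (c z)) = act (B (ob p)) (e p (c z)) (k z)"
    using c(2) assms(1,2) by (auto simp: proj_e \<phi>_e)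
  have "lam p r (c z) = k z" if z: "z \<in> Z" for z
  proof -
    note W = assms(1,2) conjunct1[OF c(2)[OF z]] conjunct2[OF c(2)[OF z]]
    show ?thesis
      using lam(1,2)[OF W] k(2) z plot_in_carrier[OF Gh.diffeological_group_semidirect k(1) z]
      by (intro Lp.act_free[OF e_in[OF W(1,3)]]) auto
  qed
  from plot_cong[OF diffeological_group_space[OF Gh.diffeological_group_semidirect] k(1) this]
  show ?thesis .
qed

text \<open>The two lifts \<open>hh\<close> and \<open>lam\<close> of the transition functions differ by \<open>A\<close>-valued functions \<open>b\<close>.\<close>

definition b where "b p r u = fst (hh (fr p) (fr r) u \<otimes>\<^bsub>Hh\<^esub> inv\<^bsub>Hh\<^esub> (lam p r u))"

lemma b:
  assumes "p \<in> L" "r \<in> L" "u \<in> W p" "u \<in> W r"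
  shows "b p r u \<in> A" "hh (fr p) (fr r) u = \<iota> (b p r u) \<otimes>\<^bsub>Hh\<^esub> lam p r u"
proof -
  have hh: "hh (fr p) (fr r) u \<in> carrier Hh" "\<rho> (hh (fr p) (fr r) u) = h (fr p) (fr r) u"
    using assms by (simp_all add: \<rho>_hh)
  obtain c where c: "c \<in> A" "hh (fr p) (fr r) u = \<iota> c \<otimes>\<^bsub>Hh\<^esub> lam p r u"
    using same_image[OF lam(1)[OF assms] hh(1)] lam(3)[OF assms] hh(2) by metis
  have "b p r u = fst (\<iota> c)"
    unfolding b_def c(2) using c(1) lam(1)[OF assms] by (simp add: Hh.m_assoc)
  then show "b p r u \<in> A" "hh (fr p) (fr r) u = \<iota> (b p r u) \<otimes>\<^bsub>Hh\<^esub> lam p r u"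
    using c by (simp_all add: \<iota>_def)
qed

lemma b_plot:
  assumes "p \<in> L" "r \<in> L" and c: "c \<in> plots X n Z" "\<And>z. z \<in> Z \<Longrightarrow> c z \<in> W p \<and> c z \<in> W r"
  shows "(\<lambda>z. b p r (c z)) \<in> plots (dsp Gh) n Z"
proof -
  have "(\<lambda>z. hh (fr p) (fr r) (c z) \<otimes>\<^bsub>Hh\<^esub> inv\<^bsub>Hh\<^esub> (lam p r (c z))) \<in> plots (dsp Hh) n Z"
    by (intro plot_mult plot_inv Gh.diffeological_group_semidirect hh_plot lam_plot)
      (use assms in auto)
  then show ?thesis
    by (simp add: b_def Gh.plots_semidirect)
qed

text \<open>The defect is evaluated at \<open>e m u\<close>, hence in the frame of \<open>m\<close>; moving it past \<open>lam p m\<close> turns this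
  into its value in the frame of \<open>p\<close>.\<close>

lemma lam_cocycle_defect:
  assumes p: "p \<in> L" "r \<in> L" "m \<in> L" and u: "u \<in> W p" "u \<in> W r" "u \<in> W m"
  shows "lam p r u \<otimes>\<^bsub>Hh\<^esub> lam r m u = \<iota> (defect (ob p) (ob r) (ob m) (fr p) u) \<otimes>\<^bsub>Hh\<^esub> lam p m u"
proof -
  interpret Lp: local_lift X Gh G A q \<sigma> \<sigma>h P I U s g \<epsilon> gh "V (ob p)" "B (ob p)" "\<kappa> (ob p)"
    using p by (intro local_lift) simp
  let ?t = "defect (ob p) (ob r) (ob m)"
  note lpr = lam[OF p(1,2) u(1,2)] and lrm = lam[OF p(2,3) u(2,3)] and lpm = lam[OF p(1,3) u(1,3)]
  have t: "?t (fr m) u \<in> A" using p u by (simp add: defect_in_A)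
  have "act (B (ob p)) (e p u) (lam p r u \<otimes>\<^bsub>Hh\<^esub> lam r m u)
      = act (B (ob p)) (\<phi> (ob p) (ob r) (e r u)) (lam r m u)"
    using lpr lrm Lp.act_act[OF e_in[OF p(1) u(1)]] by simp
  also have "\<dots> = \<phi> (ob p) (ob r) (\<phi> (ob r) (ob m) (e m u))"
    using \<phi>(4)[of "ob p" "ob r" "e r u" "lam r m u"] p u lrm by (simp add: e_in proj_e)
  also have "\<dots> = act (B (ob p)) (\<phi> (ob p) (ob m) (e m u)) (\<iota> (?t (fr m) u))"
    using defect(2)[of "ob p" "ob r" "ob m" "fr m" "e m u"] p u by (simp add: e_in proj_e e_frame)
  also have "\<dots> = act (B (ob p)) (e p u) (lam p m u \<otimes>\<^bsub>Hh\<^esub> \<iota> (?t (fr m) u))"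
    using lpm t Lp.act_act[OF e_in[OF p(1) u(1)]] by simp
  finally have "lam p r u \<otimes>\<^bsub>Hh\<^esub> lam r m u = lam p m u \<otimes>\<^bsub>Hh\<^esub> \<iota> (?t (fr m) u)"
    using lpr lrm lpm t by (intro Lp.act_free[OF e_in[OF p(1) u(1)]]) auto
  also have "\<dots> = \<iota> (\<sigma>h (snd (lam p m u)) (?t (fr m) u)) \<otimes>\<^bsub>Hh\<^esub> lam p m u"
    by (rule twisted_central[OF lpm(1) t])
  also have "snd (lam p m u) = \<epsilon> (fr p) (fr m) u"
    using lpm(3) by (metis h_def id_apply snd_conv snd_map_prod)
  also have "\<sigma>h (\<epsilon> (fr p) (fr m) u) (?t (fr m) u) = ?t (fr p) u"
    using section_twist[OF defect(1)[of "ob p" "ob r" "ob m"], of "fr p" "fr m" u] p u by simp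
  finally show ?thesis .
qed

text \<open>Substituting \<open>hh = \<iota> b \<otimes> lam\<close> into \<open>hh p r \<otimes> hh r m = \<iota> a \<otimes> hh p m\<close>; the action appears when
  \<open>b r m\<close> is moved past \<open>lam p r\<close>.\<close>

lemma a_b_defect:
  assumes p: "p \<in> L" "r \<in> L" "m \<in> L" and u: "u \<in> W p" "u \<in> W r" "u \<in> W m"
  shows "a (fr p) (fr r) (fr m) u = defect (ob p) (ob r) (ob m) (fr p) u \<otimes>\<^bsub>Gh\<^esub>
    (b p r u \<otimes>\<^bsub>Gh\<^esub> \<sigma>h (\<epsilon> (fr p) (fr r) u) (b r m u) \<otimes>\<^bsub>Gh\<^esub> inv\<^bsub>Gh\<^esub> (b p m u))"
proof -
  let ?t = "defect (ob p) (ob r) (ob m) (fr p) u" and ?e = "\<epsilon> (fr p) (fr r) u"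
  let ?a = "a (fr p) (fr r) (fr m) u"
  have t: "?t \<in> A" using p u by (simp add: defect_in_A)
  have aA: "?a \<in> A" using p u by (simp add: hh_defect(1))
  have eZ: "?e \<in> Z2" using p u by simp
  note bpr = b[OF p(1,2) u(1,2)] and brm = b[OF p(2,3) u(2,3)] and bpm = b[OF p(1,3) u(1,3)]
  note lpr = lam[OF p(1,2) u(1,2)] and lrm = lam[OF p(2,3) u(2,3)] and lpm = lam[OF p(1,3) u(1,3)]
  have sl: "snd (lam p r u) = ?e"
    using lpr(3) by (metis h_def id_apply snd_conv snd_map_prod)
  have sb: "\<sigma>h ?e (b r m u) \<in> A" using brm(1) eZ by simp
  have "\<iota> (?a \<otimes>\<^bsub>Gh\<^esub> b p m u) \<otimes>\<^bsub>Hh\<^esub> lam p m u = \<iota> ?a \<otimes>\<^bsub>Hh\<^esub> hh (fr p) (fr m) u"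
    using aA bpm lpm(1) by (simp add: Hh.m_assoc flip: \<iota>_mult)
  also have "\<dots> = hh (fr p) (fr r) u \<otimes>\<^bsub>Hh\<^esub> hh (fr r) (fr m) u"
    using hh_defect(2)[of "fr p" "fr r" "fr m" u] p u by simp
  also have "\<dots> = \<iota> (b p r u) \<otimes>\<^bsub>Hh\<^esub> (lam p r u \<otimes>\<^bsub>Hh\<^esub> \<iota> (b r m u)) \<otimes>\<^bsub>Hh\<^esub> lam r m u"
    using bpr brm lpr(1) lrm(1) by (simp add: Hh.m_assoc)
  also have "lam p r u \<otimes>\<^bsub>Hh\<^esub> \<iota> (b r m u) = \<iota> (\<sigma>h ?e (b r m u)) \<otimes>\<^bsub>Hh\<^esub> lam p r u"
    using twisted_central[OF lpr(1) brm(1)] sl by simp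
  also have "\<iota> (b p r u) \<otimes>\<^bsub>Hh\<^esub> (\<iota> (\<sigma>h ?e (b r m u)) \<otimes>\<^bsub>Hh\<^esub> lam p r u) \<otimes>\<^bsub>Hh\<^esub> lam r m u
      = \<iota> (b p r u) \<otimes>\<^bsub>Hh\<^esub> \<iota> (\<sigma>h ?e (b r m u)) \<otimes>\<^bsub>Hh\<^esub> (lam p r u \<otimes>\<^bsub>Hh\<^esub> lam r m u)"
    using bpr(1) sb lpr(1) lrm(1) by (simp add: Hh.m_assoc)
  also have "\<dots> = \<iota> (b p r u \<otimes>\<^bsub>Gh\<^esub> \<sigma>h ?e (b r m u) \<otimes>\<^bsub>Gh\<^esub> ?t) \<otimes>\<^bsub>Hh\<^esub> lam p m u"
    using bpr(1) sb t lpm(1) by (simp add: lam_cocycle_defect[OF p u] Hh.m_assoc flip: \<iota>_mult)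
  finally have "?a \<otimes>\<^bsub>Gh\<^esub> b p m u = b p r u \<otimes>\<^bsub>Gh\<^esub> \<sigma>h ?e (b r m u) \<otimes>\<^bsub>Gh\<^esub> ?t"
    using aA bpr(1) bpm(1) sb t lpm(1) by simp
  also have "\<dots> = ?t \<otimes>\<^bsub>Gh\<^esub> (b p r u \<otimes>\<^bsub>Gh\<^esub> \<sigma>h ?e (b r m u))"
    using bpr(1) sb t by (simp add: A_central[OF t])
  finally have "?a = ?t \<otimes>\<^bsub>Gh\<^esub> (b p r u \<otimes>\<^bsub>Gh\<^esub> \<sigma>h ?e (b r m u)) \<otimes>\<^bsub>Gh\<^esub> inv\<^bsub>Gh\<^esub> (b p m u)"
    using aA bpr(1) bpm(1) sb t
    by (intro Gh.inv_solve_right[THEN iffD2]) simp_all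
  then show ?thesis
    using bpr(1) bpm(1) sb t by (simp add: Gh.m_assoc)
qed

lemma cech_equiv_defect: "cech_equiv X F I U a_sec K V defect"
proof -
  define bs where "bs p r = from_frame \<sigma>h I U \<epsilon> (fr p) (W p \<inter> W r) (b p r)" for p r
  have bs: "bs p r \<in> carrier (sections F (W p \<inter> W r))" if "p \<in> L" "r \<in> L" for p r
    unfolding bs_def using that b(1) b_plot by (intro from_frame_section) auto
  have "cohomologous F L W (cech_pull F W fr a_sec) (cech_pull F W ob defect)"
  proof (rule cohomologousI[OF bs])
    fix p r m Z assume p: "p \<in> L" "r \<in> L" "m \<in> L" and Z: "Z = W p \<inter> W r \<inter> W m"
    have sub: "Z \<subseteq> W p \<inter> W r" "Z \<subseteq> W r \<inter> W m" "Z \<subseteq> W p \<inter> W m" using Z by auto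
    have cl: "sec_res F Z (bs p r) \<in> carrier (sections F Z)" "sec_res F Z (bs r m) \<in> carrier (sections F Z)"
      "sec_res F Z (bs p m) \<in> carrier (sections F Z)"
      using res_closed[OF sub(1) bs[OF p(1,2)]] res_closed[OF sub(2) bs[OF p(2,3)]]
        res_closed[OF sub(3) bs[OF p(1,3)]] by auto
    have pa: "cech_pull F W fr a_sec p r m \<in> carrier (sections F Z)"
      using cocycle_section[OF cech_cocycle_pull[OF a_sec_cocycle fr] p] Z by simp
    have pd: "cech_pull F W ob defect p r m \<in> carrier (sections F Z)"
      using cocycle_section[OF cech_cocycle_pull[OF defect_cocycle ob] p] Z by simp
    show "cech_pull F W fr a_sec p r m = cech_pull F W ob defect p r m \<otimes>\<^bsub>sections F Z\<^esub>
       coboundary Z bs p r m"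
    proof (rule section_eqI[OF pa])
      fix u assume u: "u \<in> Z"
      then have W: "u \<in> W p" "u \<in> W r" "u \<in> W m" using Z by auto
      have "b p r u \<in> A" "b r m u \<in> A" "b p m u \<in> A" "a (fr p) (fr r) (fr m) u \<in> A"
        using b(1) hh_defect(1) p W by auto
      then show "\<exists>i\<in>I. u \<in> U i \<and> cech_pull F W fr a_sec p r m i u =
         (cech_pull F W ob defect p r m \<otimes>\<^bsub>sections F Z\<^esub>
         coboundary Z bs p r m) i u"
        using p W u cl a_b_defect[OF p W]
        by (intro bexI[of _ "fr p"])
          (simp_all add: cech_pull_def bs_def a_sec_def from_frame_apply)
    qed (intro mult_closed inv_closed pd cl)
  qed
  then show ?thesis
    unfolding cech_equiv_def using cover_W ob fr by blast
qed

lemma class_eq: "cech_class X F K V defect = cech_class X F I U a_sec"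
  using cech_class_eqI[OF a_sec_cocycle defect_cocycle cech_equiv_defect] by simp

end

section \<open>Independence of the choices\<close>

context gerbe_choice begin

text \<open>Around each point, a local section of the chosen object has some position relative to a frame;
  a smooth lift of that position to the extended group corrects it to a section over the frame.\<close>

lemma local_frame_lift:
  assumes lifts: "smooth_lifts_exist X Gh G q" and x0: "x0 \<in> points X"
  shows "\<exists>k i W e. k \<in> K \<and> i \<in> I \<and> D_open X W \<and> x0 \<in> W \<and> W \<subseteq> V k \<and> W \<subseteq> U i \<and>
    smooth_map (sub_space X W) (total_space (B k)) e \<and> (\<forall>u\<in>W. lp k (e u) = s i u)"
proof -
  have "open_cover X K V" using data by (simp add: gerbe_data_def)
  then obtain k where k: "k \<in> K" "x0 \<in> V k" "D_open X (V k)"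
    using x0 by (auto simp: open_cover_def)
  obtain i where i: "i \<in> I" "x0 \<in> U i" using cover_point[OF x0] by blast
  have Ui: "D_open X (U i)" using cover i by (simp add: open_cover_def)
  interpret L: local_lift X Gh G A q \<sigma> \<sigma>h P I U s g \<epsilon> gh "V k" "B k" "\<kappa> k"
    by (rule local_lift[OF k(1)])
  have "principal_bundle Hh (sub_space X (V k)) (B k)"
    using object[OF k(1)] by (auto simp: lift_objs_def)
  then interpret BP: diffeological_principal_bundle Hh "sub_space X (V k)" "B k"
    by unfold_locales (rule Gh.diffeological_group_semidirect diffeological_sub_space[OF space])+
  obtain V' s' where V': "D_open (sub_space X (V k)) V'" "x0 \<in> V'"
    and s': "smooth_map (sub_space (sub_space X (V k)) V') (total_space (B k)) s'"
      "\<And>u. u \<in> V' \<Longrightarrow> proj (B k) (s' u) = u"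
    using BP.local_section[of x0] x0 k(2) by auto
  have V'V: "V' \<subseteq> V k" using D_open_subset[OF V'(1)] by simp
  have V'X: "D_open X V'" by (rule D_open_sub_space[OF space k(3) V'(1)])
  have "V k \<inter> V' = V'" using V'V by blast
  with s'(1) have s'X: "smooth_map (sub_space X V') (total_space (B k)) s'" by simp
  define W0 where "W0 = V' \<inter> U i"
  have W0: "D_open X W0" "x0 \<in> W0"
    unfolding W0_def using D_open_Int[OF V'X Ui] V'(2) i(2) by auto
  have W0X: "u \<in> points X" if "u \<in> W0" for u using that D_open_subset[OF W0(1)] by blast
  have s'_in: "s' u \<in> tot (B k)" if "u \<in> W0" for u
    using smooth_map_point[OF s'X, of u] that W0X by (simp add: W0_def)
  define d where "d u = P.division (s i u) (lp k (s' u))" for u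
  have same: "proj P (s i u) = proj P (lp k (s' u))" if "u \<in> W0" for u
    using that L.proj_pt[OF s'_in[OF that]] s'(2) i(1) by (simp add: W0_def proj_s)
  have d: "d u \<in> carrier H" "act P (s i u) (d u) = lp k (s' u)" if "u \<in> W0" for u
    unfolding d_def using P.division[OF s_in[OF i(1)] L.pt_in[OF s'_in[OF that]] same[OF that]] that
    by (simp_all add: W0_def)
  have s'_plot: "(\<lambda>z. s' (c z)) \<in> plots (total_space (B k)) n Z"
    if "c \<in> plots X n Z" "\<And>z. z \<in> Z \<Longrightarrow> c z \<in> W0" for c n Z
    using smooth_map_plot[OF s'X, of c n Z] that by (simp add: plots_sub_space W0_def)
  have d_plot: "(\<lambda>z. d (c z)) \<in> plots (dsp H) n Z"
    if c: "c \<in> plots X n Z" "\<And>z. z \<in> Z \<Longrightarrow> c z \<in> W0" for c n Z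
  proof -
    have "(\<lambda>z. s i (c z)) \<in> plots (total_space P) n Z"
      using smooth_map_plot[OF section_s[OF i(1)], of c n Z] c by (simp add: plots_sub_space W0_def)
    then show ?thesis
      unfolding d_def by (intro P.division_plot L.pt_plot s'_plot same c)
  qed
  have "smooth_map (sub_space X W0) (dsp G) (\<lambda>u. fst (d u))"
  proof (rule smooth_mapI)
    fix u assume "u \<in> points (sub_space X W0)"
    then show "fst (d u) \<in> points (dsp G)" using d(1)[of u] by (auto simp: G.carrier_semidirect)
  next
    fix n Z c assume "c \<in> plots (sub_space X W0) n Z"
    then show "(\<lambda>z. fst (d (c z))) \<in> plots (dsp G) n Z"
      using d_plot[of c n Z] by (simp add: plots_sub_space G.plots_semidirect)
  qed
  then obtain W f where W: "D_open X W" "x0 \<in> W" "W \<subseteq> W0" and f: "smooth_map (sub_space X W) (dsp Gh) f"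
    "\<forall>u\<in>W. q (f u) = fst (d u)"
    using lifts W0 unfolding smooth_lifts_exist_def by blast
  define c where "c u = (f u, snd (d u))" for u
  have c: "c u \<in> carrier Hh" "\<rho> (c u) = d u" if "u \<in> W" for u
    using that W(3) W0X smooth_map_point[OF f(1), of u] f(2) d(1)[of u]
    by (auto simp: c_def Gh.carrier_semidirect G.carrier_semidirect prod_eq_iff mem_Times_iff)
  define e where "e u = act (B k) (s' u) (inv\<^bsub>Hh\<^esub> (c u))" for u
  have "smooth_map (sub_space X W) (total_space (B k)) e"
  proof (rule smooth_mapI)
    fix u assume "u \<in> points (sub_space X W)"
    then show "e u \<in> tot (B k)"
      unfolding e_def using c(1) W(3) by (intro L.act_in s'_in) auto
  next
    fix n Z r assume r: "r \<in> plots (sub_space X W) n Z"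
    then have r': "r \<in> plots X n Z" "\<And>z. z \<in> Z \<Longrightarrow> r z \<in> W0" using W(3) by (auto simp: plots_sub_space)
    have "(\<lambda>z. c (r z)) \<in> plots (dsp Hh) n Z"
      using d_plot[OF r'] smooth_map_plot[OF f(1) r]
      by (simp add: c_def Gh.plots_semidirect G.plots_semidirect)
    then show "(\<lambda>z. e (r z)) \<in> plots (total_space (B k)) n Z"
      unfolding e_def
      by (intro L.act_plot s'_plot r' plot_inv[OF Gh.diffeological_group_semidirect])
  qed
  moreover have "lp k (e u) = s i u" if u: "u \<in> W" for u
  proof -
    have u0: "u \<in> W0" using u W(3) by auto
    have si: "s i u \<in> tot P" using u0 i by (simp add: W0_def s_in)
    have "lp k (e u) = act P (lp k (s' u)) (inv\<^bsub>H\<^esub> (d u))"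
      unfolding e_def using L.pt_act[OF s'_in[OF u0] Hh.inv_closed[OF c(1)[OF u]]] c[OF u]
      by (simp add: \<rho>_inv)
    also have "\<dots> = act P (act P (s i u) (d u)) (inv\<^bsub>H\<^esub> (d u))"
      using d(2)[OF u0] by simp
    also have "\<dots> = s i u"
      using P.act_act[OF si d(1)[OF u0] H.inv_closed[OF d(1)[OF u0]]] d(1)[OF u0]
      by (simp add: P.act_one[OF si])
    finally show ?thesis .
  qed
  moreover have "W \<subseteq> V k" "W \<subseteq> U i"
    using W(3) V'V by (auto simp: W0_def)
  ultimately show ?thesis
    using k(1) i(1) W(1,2) by blast
qed

lemma class_eq_if_lifts:
  assumes "smooth_lifts_exist X Gh G q"
  shows "cech_class X F K V defect = cech_class X F I U a_sec"
proof -
  have "\<forall>y\<in>points X. \<exists>k i W e. k \<in> K \<and> i \<in> I \<and> D_open X W \<and> y \<in> W \<and> W \<subseteq> V k \<and> W \<subseteq> U i \<and>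
    smooth_map (sub_space X W) (total_space (B k)) e \<and> (\<forall>u\<in>W. lp k (e u) = s i u)"
    using local_frame_lift[OF assms] by blast
  then obtain ob fr W e where c: "\<And>y. y \<in> points X \<Longrightarrow> ob y \<in> K \<and> fr y \<in> I \<and> D_open X (W y) \<and> y \<in> W y \<and>
    W y \<subseteq> V (ob y) \<and> W y \<subseteq> U (fr y) \<and>
    smooth_map (sub_space X (W y)) (total_space (B (ob y))) (e y) \<and> (\<forall>u\<in>W y. lp (ob y) (e y u) = s (fr y) u)"
    by metis
  have "open_cover X (points X) W"
    using c D_open_subset unfolding open_cover_def by fast
  then interpret gerbe_sections X Gh G A q \<sigma> \<sigma>h P I U s g \<epsilon> gh K V x \<phi> "points X" W ob fr e
    by unfold_locales (use c in auto)
  show ?thesis by (rule class_eq)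
qed

end


section \<open>Trivial objects\<close>

text \<open>The space \<open>Y\<close> transported along an injection \<open>emb\<close> with left inverse \<open>dec\<close>.\<close>

definition transport_space :: "('a \<Rightarrow> 'e) \<Rightarrow> ('e \<Rightarrow> 'a) \<Rightarrow> 'a dspace \<Rightarrow> 'e dspace" where
  "transport_space emb dec Y = \<lparr>points = emb ` points Y,
     plots = (\<lambda>n U. {p. (\<forall>u\<in>U. p u \<in> emb ` points Y) \<and> (\<lambda>u. dec (p u)) \<in> plots Y n U})\<rparr>"

lemma diffeological_transport_space:
  assumes Y: "diffeological_space Y" and inv: "\<And>y. y \<in> points Y \<Longrightarrow> dec (emb y) = y"
  shows "diffeological_space (transport_space emb dec Y)"
proof (rule diffeological_spaceI)
  fix n U p
  assume U: "openin (Euclidean_space n) U" and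
    loc: "\<forall>u\<in>U. \<exists>V. openin (Euclidean_space n) V \<and> u \<in> V \<and> V \<subseteq> U \<and> p \<in> plots (transport_space emb dec Y) n V"
  have d: "(\<lambda>u. dec (p u)) \<in> plots Y n V" "\<forall>u\<in>V. p u \<in> emb ` points Y"
    if "p \<in> plots (transport_space emb dec Y) n V" for V
    using that by (simp_all add: transport_space_def)
  have "(\<lambda>u. dec (p u)) \<in> plots Y n U"
    using loc d(1) by (intro plot_locally_plot[OF Y U]) meson
  moreover have "\<forall>u\<in>U. p u \<in> emb ` points Y"
    using loc d(2) by meson
  ultimately show "p \<in> plots (transport_space emb dec Y) n U"
    by (simp add: transport_space_def)
next
  fix n U p m V f p'
  assume p: "p \<in> plots (transport_space emb dec Y) n U" and f: "smooth_euclidean m V n U f"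
    and eq: "\<forall>v\<in>V. p' v = p (f v)"
  then show "p' \<in> plots (transport_space emb dec Y) m V"
    using plot_compose[OF Y _ f, of "\<lambda>u. dec (p u)" "\<lambda>v. dec (p' v)"] smooth_euclideanD(3)[OF f]
    by (simp add: transport_space_def)
qed (use plot_openin[OF Y] plot_const[OF Y] inv in \<open>auto simp: transport_space_def\<close>)

lemma points_transport_space [simp]: "points (transport_space emb dec Y) = emb ` points Y"
  by (simp add: transport_space_def)

lemma transport_plot_decode:
  "p \<in> plots (transport_space emb dec Y) n U \<Longrightarrow> (\<lambda>u. dec (p u)) \<in> plots Y n U"
  by (simp add: transport_space_def)

lemma transport_plot_encode:
  assumes "diffeological_space Y" "\<And>y. y \<in> points Y \<Longrightarrow> dec (emb y) = y" "p \<in> plots Y n U"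
  shows "(\<lambda>u. emb (p u)) \<in> plots (transport_space emb dec Y) n U"
  using plot_cong[OF assms(1,3), of "\<lambda>u. dec (emb (p u))"] assms(2) plot_in_points[OF assms(1,3)]
  by (auto simp: transport_space_def)

context lifting_problem begin

lemma q_plot: assumes p: "p \<in> plots (dsp Gh) n V" shows "(\<lambda>v. q (p v)) \<in> plots (dsp G) n V"
proof -
  note o = plot_openin[OF diffeological_group_space[OF Gh.diffeological] p]
  have "(\<lambda>v. q (p v)) \<in> plots (quotient_space (dsp Gh) q) n V"
    unfolding quotient_space_def using o p plot_in_carrier[OF Gh.diffeological p] by auto
  then show ?thesis by (simp add: q_quotient)
qed

lemma q_plot_lift:
  assumes p: "p \<in> plots (dsp G) n V" and v: "v \<in> V"
  obtains V' r where "openin (Euclidean_space n) V'" "v \<in> V'" "V' \<subseteq> V" "r \<in> plots (dsp Gh) n V'"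
    "\<And>w. w \<in> V' \<Longrightarrow> p w = q (r w)"
proof -
  have "p \<in> plots (quotient_space (dsp Gh) q) n V"
    using p by (simp add: q_quotient)
  then have "\<forall>v\<in>V. \<exists>V'. openin (Euclidean_space n) V' \<and> v \<in> V' \<and> V' \<subseteq> V \<and>
      (\<exists>r\<in>plots (dsp Gh) n V'. \<forall>w\<in>V'. p w = q (r w))"
    unfolding quotient_space_def by simp
  from bspec[OF this v] show ?thesis using that by blast
qed

lemma \<rho>_plot: "k \<in> plots (dsp Hh) n V \<Longrightarrow> (\<lambda>v. \<rho> (k v)) \<in> plots (dsp H) n V"
  by (simp add: Gh.plots_semidirect G.plots_semidirect q_plot case_prod_unfold map_prod_def)

end

text \<open>The total space of the trivial bundle over \<open>U i\<close> is placed into the type of total spaces by \<open>emb\<close>.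
  Pulled back along \<open>dec\<close>, all its structure is that of the product of \<open>U i\<close> with the group.\<close>

locale trivial_objects = lifting_problem X Gh G A q \<sigma> \<sigma>h P I U s g \<epsilon> gh
  for X :: "'x dspace" and Gh :: "'k dgroup" and G :: "'g dgroup" and A q \<sigma> \<sigma>h
    and P :: "('p, 'x, 'g \<times> int) pbundle" and I :: "'i set" and U s g \<epsilon> gh +
  fixes emb :: "'x \<times> ('k \<times> int) \<Rightarrow> 'e"
  assumes emb_inj: "inj_on emb (points X \<times> carrier Hh)"
begin

definition dec :: "'e \<Rightarrow> 'x \<times> ('k \<times> int)" where "dec = inv_into (points X \<times> carrier Hh) emb"

lemma dec_emb [simp]: "u \<in> points X \<Longrightarrow> k \<in> carrier Hh \<Longrightarrow> dec (emb (u, k)) = (u, k)"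
  unfolding dec_def by (rule inv_into_f_f[OF emb_inj]) simp

definition TB :: "'i \<Rightarrow> ('e, 'x, 'k \<times> int) pbundle" where
  "TB i = \<lparr>total_space = transport_space emb dec (prod_space (sub_space X (U i)) (dsp Hh)),
     proj = (\<lambda>y. fst (dec y)),
     act = (\<lambda>y k. emb (fst (dec y), snd (dec y) \<otimes>\<^bsub>Hh\<^esub> k))\<rparr>"

text \<open>The trivialisation of \<open>P\<close> by \<open>s i\<close>, which does not depend on the point chosen in the orbit.\<close>

definition T\<kappa> :: "'i \<Rightarrow> 'e set \<Rightarrow> 'p" where
  "T\<kappa> i Y = (let (u, k) = dec (SOME y. y \<in> Y) in act P (s i u) (\<rho> k))"

lemma model_space: "diffeological_space (prod_space (sub_space X (U i)) (dsp Hh))"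
  by (intro diffeological_prod_space diffeological_sub_space space
      diffeological_group_space[OF Gh.diffeological_group_semidirect])

lemma dec_model: "y \<in> points (prod_space (sub_space X V) (dsp Hh)) \<Longrightarrow> dec (emb y) = y"
  by auto

lemma TB_space: "diffeological_space (total_space (TB i))"
  unfolding TB_def by (simp, rule diffeological_transport_space[OF model_space]) auto

lemma tot_TB: "i \<in> I \<Longrightarrow> y \<in> tot (TB i) \<longleftrightarrow> (\<exists>u\<in>U i. \<exists>k\<in>carrier Hh. y = emb (u, k))"
  using U_subset[of i] by (auto simp: TB_def)

lemma emb_in_TB: "i \<in> I \<Longrightarrow> u \<in> U i \<Longrightarrow> k \<in> carrier Hh \<Longrightarrow> emb (u, k) \<in> tot (TB i)"
  by (rule iffD2[OF tot_TB], assumption, rule bexI, rule bexI, rule refl; assumption)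

lemma proj_TB [simp]: "u \<in> points X \<Longrightarrow> k \<in> carrier Hh \<Longrightarrow> proj (TB i) (emb (u, k)) = u"
  by (simp add: TB_def)

lemma act_TB [simp]: "u \<in> points X \<Longrightarrow> k \<in> carrier Hh \<Longrightarrow> act (TB i) (emb (u, k)) k' = emb (u, k \<otimes>\<^bsub>Hh\<^esub> k')"
  by (simp add: TB_def)

lemma TB_plotI:
  assumes "i \<in> I" "c \<in> plots X n Z" "\<And>z. z \<in> Z \<Longrightarrow> c z \<in> U i" "k \<in> plots (dsp Hh) n Z"
  shows "(\<lambda>z. emb (c z, k z)) \<in> plots (total_space (TB i)) n Z"
proof -
  have "(\<lambda>z. (c z, k z)) \<in> plots (prod_space (sub_space X (U i)) (dsp Hh)) n Z"
    using assms by (simp add: plots_prod_space plots_sub_space)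
  from transport_plot_encode[where emb = emb and dec = dec, OF model_space dec_model this] show ?thesis
    by (simp add: TB_def)
qed

lemma TB_plotE:
  assumes i: "i \<in> I" and p: "p \<in> plots (total_space (TB i)) n Z"
  obtains c k where "c \<in> plots X n Z" "\<And>z. z \<in> Z \<Longrightarrow> c z \<in> U i" "k \<in> plots (dsp Hh) n Z"
    "\<And>z. z \<in> Z \<Longrightarrow> p z = emb (c z, k z)"
proof
  have "(\<lambda>z. dec (p z)) \<in> plots (prod_space (sub_space X (U i)) (dsp Hh)) n Z"
    using p by (simp add: TB_def transport_plot_decode)
  then show "(\<lambda>z. fst (dec (p z))) \<in> plots X n Z" "(\<lambda>z. snd (dec (p z))) \<in> plots (dsp Hh) n Z"
    and "\<And>z. z \<in> Z \<Longrightarrow> fst (dec (p z)) \<in> U i"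
    by (simp_all add: plots_prod_space plots_sub_space)
  fix z assume "z \<in> Z"
  then obtain u k where "u \<in> U i" "k \<in> carrier Hh" "p z = emb (u, k)"
    using plot_in_points[OF TB_space p] tot_TB[OF i] by blast
  then show "p z = emb (fst (dec (p z)), snd (dec (p z)))"
    using U_subset[OF i] by auto
qed

lemma orb_TB:
  assumes i: "i \<in> I" and u: "u \<in> U i" and k: "k \<in> carrier Hh"
  shows "orb (A \<times> {1}) (TB i) (emb (u, k)) = {emb (u, k \<otimes>\<^bsub>Hh\<^esub> \<iota> c) | c. c \<in> A}"
proof -
  have "u \<in> points X" using U_subset[OF i] u by blast
  then show ?thesis
    using k by (simp add: orb_def \<iota>_kernel image_image Setcompr_eq_image)
qed

lemma pt_TB:
  assumes i: "i \<in> I" and u: "u \<in> U i" and k: "k \<in> carrier Hh"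
  shows "pt (T\<kappa> i) (TB i) (emb (u, k)) = act P (s i u) (\<rho> k)"
proof -
  let ?O = "orb (A \<times> {1}) (TB i) (emb (u, k))"
  have "emb (u, k \<otimes>\<^bsub>Hh\<^esub> \<iota> \<one>\<^bsub>Gh\<^esub>) \<in> ?O"
    unfolding orb_TB[OF assms] using A_one by blast
  then have "(SOME y. y \<in> ?O) \<in> ?O" by (rule someI)
  then obtain c where c: "c \<in> A" "(SOME y. y \<in> ?O) = emb (u, k \<otimes>\<^bsub>Hh\<^esub> \<iota> c)"
    unfolding orb_TB[OF assms] by blast
  have "dec (emb (u, k \<otimes>\<^bsub>Hh\<^esub> \<iota> c)) = (u, k \<otimes>\<^bsub>Hh\<^esub> \<iota> c)"
    using u k c(1) U_subset[OF i] by (intro dec_emb) auto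
  moreover have "\<rho> (k \<otimes>\<^bsub>Hh\<^esub> \<iota> c) = \<rho> k"
    using k c(1) by (simp add: \<rho>_mult \<rho>_\<iota> H.r_one[OF \<rho>_closed[OF k]])
  ultimately show ?thesis
    by (simp add: T\<kappa>_def c(2))
qed

lemma principal_TB:
  assumes i: "i \<in> I" shows "principal_bundle Hh (sub_space X (U i)) (TB i)"
  unfolding principal_bundle_def
proof (intro conjI ballI)
  have UX: "u \<in> points X" if "u \<in> U i" for u using that U_subset[OF i] by blast
  note tB = tot_TB[OF i]
  show "diffeological_space (total_space (TB i))" by (rule TB_space)
  show "smooth_map (total_space (TB i)) (sub_space X (U i)) (proj (TB i))"
  proof (rule smooth_mapI)
    fix n Z p assume "p \<in> plots (total_space (TB i)) n Z"
    then have "(\<lambda>z. dec (p z)) \<in> plots (prod_space (sub_space X (U i)) (dsp Hh)) n Z"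
      by (simp add: TB_def transport_plot_decode)
    then show "(\<lambda>z. proj (TB i) (p z)) \<in> plots (sub_space X (U i)) n Z"
      by (simp add: TB_def plots_prod_space)
  qed (auto simp: tB UX)
  show "smooth_map (prod_space (total_space (TB i)) (dsp Hh)) (total_space (TB i)) (\<lambda>(y, k). act (TB i) y k)"
  proof (rule smooth_mapI)
    fix n Z p assume "p \<in> plots (prod_space (total_space (TB i)) (dsp Hh)) n Z"
    then have p: "(\<lambda>z. fst (p z)) \<in> plots (total_space (TB i)) n Z" "(\<lambda>z. snd (p z)) \<in> plots (dsp Hh) n Z"
      by (simp_all add: plots_prod_space)
    obtain c k where c: "c \<in> plots X n Z" "\<And>z. z \<in> Z \<Longrightarrow> c z \<in> U i" "k \<in> plots (dsp Hh) n Z"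
      "\<And>z. z \<in> Z \<Longrightarrow> fst (p z) = emb (c z, k z)"
      using TB_plotE[OF i p(1)] by metis
    have "(\<lambda>z. emb (c z, k z \<otimes>\<^bsub>Hh\<^esub> snd (p z))) \<in> plots (total_space (TB i)) n Z"
      by (intro TB_plotI i c plot_mult[OF Gh.diffeological_group_semidirect] p(2))
    then show "(\<lambda>z. case p z of (y, k) \<Rightarrow> act (TB i) y k) \<in> plots (total_space (TB i)) n Z"
      by (rule plot_cong[OF TB_space])
        (simp add: case_prod_unfold c(2,4) UX plot_in_carrier[OF Gh.diffeological_group_semidirect c(3)])
  next
    fix m assume "m \<in> points (prod_space (total_space (TB i)) (dsp Hh))"
    then obtain y k' where m: "m = (y, k')" "y \<in> tot (TB i)" "k' \<in> carrier Hh" by auto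
    obtain u k where "u \<in> U i" "k \<in> carrier Hh" "y = emb (u, k)"
      using iffD1[OF tB m(2)] by (elim bexE)
    then show "(case m of (y, k) \<Rightarrow> act (TB i) y k) \<in> tot (TB i)"
      using m i by (simp add: UX emb_in_TB)
  qed
next
  fix y assume "y \<in> tot (TB i)"
  then show "act (TB i) y \<one>\<^bsub>Hh\<^esub> = y"
    using U_subset[OF i] by (auto simp: tot_TB[OF i])
next
  fix y k k' assume "y \<in> tot (TB i)" "k \<in> carrier Hh" "k' \<in> carrier Hh"
  then show "act (TB i) (act (TB i) y k) k' = act (TB i) y (k \<otimes>\<^bsub>Hh\<^esub> k')"
    using U_subset[OF i] by (auto simp: tot_TB[OF i] subset_iff Hh.m_assoc)
next
  fix y k assume "y \<in> tot (TB i)" "k \<in> carrier Hh"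
  then show "proj (TB i) (act (TB i) y k) = proj (TB i) y"
    using U_subset[OF i] by (auto simp: tot_TB[OF i] subset_iff)
next
  fix u0 assume u0: "u0 \<in> points (sub_space X (U i))"
  have UX: "u \<in> points X" if "u \<in> U i" for u using that U_subset[OF i] by blast
  let ?M = "prod_space (sub_space X (U i)) (dsp Hh)"
  have "D_open (sub_space X (U i)) (U i)"
  proof -
    have "openin (Euclidean_space n) {z \<in> Z. p z \<in> U i}" if "p \<in> plots (sub_space X (U i)) n Z" for n Z p
    proof -
      have "{z \<in> Z. p z \<in> U i} = Z" using that by (auto simp: plots_sub_space)
      then show ?thesis using plot_openin[OF diffeological_sub_space[OF space] that] by simp
    qed
    then show ?thesis using UX by (auto simp: D_open_def)
  qed
  moreover have "diffeomorphism ?M (total_space (bundle_res (U i) (TB i))) emb"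
  proof (rule diffeomorphismI[where f' = dec])
    show "diffeological_space ?M" by (rule model_space)
    show "diffeological_space (total_space (bundle_res (U i) (TB i)))"
      by (simp add: bundle_res_def diffeological_sub_space TB_space)
    show "smooth_map ?M (total_space (bundle_res (U i) (TB i))) emb"
    proof (rule smooth_mapI)
      fix m assume "m \<in> points ?M"
      then show "emb m \<in> tot (bundle_res (U i) (TB i))"
        by (cases m) (auto simp: tot_TB[OF i])
    next
      fix n Z p assume p: "p \<in> plots ?M n Z"
      have "(\<lambda>z. emb (p z)) \<in> plots (total_space (TB i)) n Z"
        unfolding TB_def using transport_plot_encode[OF model_space _ p, of dec emb] by auto
      moreover have "proj (TB i) (emb (p z)) \<in> U i" if "z \<in> Z" for z
        using plot_in_points[OF model_space p that] by (cases "p z") auto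
      ultimately show "(\<lambda>z. emb (p z)) \<in> plots (total_space (bundle_res (U i) (TB i))) n Z"
        by (simp add: plots_bundle_res)
    qed
    show "smooth_map (total_space (bundle_res (U i) (TB i))) ?M dec"
    proof (rule smooth_mapI)
      fix y assume "y \<in> tot (bundle_res (U i) (TB i))"
      then show "dec y \<in> points ?M" by (auto simp: tot_TB[OF i] UX)
    next
      fix n Z p assume "p \<in> plots (total_space (bundle_res (U i) (TB i))) n Z"
      then have "p \<in> plots (total_space (TB i)) n Z"
        by (simp add: plots_bundle_res)
      then show "(\<lambda>z. dec (p z)) \<in> plots ?M n Z"
        by (simp add: TB_def transport_plot_decode)
    qed
    show "dec (emb m) = m" if "m \<in> points ?M" for m using that by auto
    show "emb (dec y) = y" if "y \<in> tot (bundle_res (U i) (TB i))" for y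
      using that by (auto simp: tot_TB[OF i] UX)
  qed
  ultimately show "\<exists>V \<Phi>. D_open (sub_space X (U i)) V \<and> u0 \<in> V \<and>
      diffeomorphism (prod_space (sub_space (sub_space X (U i)) V) (dsp Hh)) (total_space (bundle_res V (TB i))) \<Phi> \<and>
      (\<forall>u\<in>V. \<forall>k\<in>carrier Hh. proj (TB i) (\<Phi> (u, k)) = u) \<and>
      (\<forall>u\<in>V. \<forall>k\<in>carrier Hh. \<forall>k'\<in>carrier Hh. \<Phi> (u, k \<otimes>\<^bsub>Hh\<^esub> k') = act (TB i) (\<Phi> (u, k)) k')"
    using u0 UX by (intro exI[of _ "U i"] exI[of _ emb]) simp
qed

text \<open>In the trivialisation \<open>s i\<close> the isomorphism with \<open>P\<close> is the bijection from \<open>Hh / A\<close> to \<open>H\<close> induced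
  by \<open>\<rho>\<close>. It is smooth because \<open>q\<close> is, and its inverse is smooth because \<open>q\<close> is a subduction, so
  that plots of \<open>H\<close> lift locally to \<open>Hh\<close>.\<close>

lemma object_TB:
  assumes i: "i \<in> I" shows "(TB i, T\<kappa> i) \<in> lift_objs X A Hh H q P (U i)"
proof -
  let ?Q = "bundle_quot (A \<times> {1}) Hh \<rho> (TB i)" and ?orb = "orb (A \<times> {1}) (TB i)"
  have UX: "u \<in> points X" if "u \<in> U i" for u using that U_subset[OF i] by blast
  interpret T: diffeological_principal_bundle Hh "sub_space X (U i)" "TB i"
    by unfold_locales (rule Gh.diffeological_group_semidirect diffeological_sub_space[OF space] principal_TB[OF i])+
  have dpb: "diffeological_principal_bundle Hh (sub_space X (U i)) (TB i)" by unfold_locales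
  have spQ: "total_space ?Q = quotient_space (total_space (TB i)) ?orb"
    by (simp add: bundle_quot_def)
  have totQ: "tot ?Q = ?orb ` tot (TB i)"
    by (simp add: bundle_quot_def quotient_space_def)
  have totQE: "\<exists>u\<in>U i. \<exists>k\<in>carrier Hh. Y = ?orb (emb (u, k))" if Y: "Y \<in> tot ?Q" for Y
  proof -
    obtain y where y: "y \<in> tot (TB i)" "Y = ?orb y" using Y unfolding totQ by blast
    obtain u k where "u \<in> U i" "k \<in> carrier Hh" "y = emb (u, k)"
      using iffD1[OF tot_TB[OF i] y(1)] by (elim bexE)
    then show ?thesis using y(2) by blast
  qed
  have emb_Q: "?orb (emb (u, k)) \<in> tot ?Q" if "u \<in> U i" "k \<in> carrier Hh" for u k
    unfolding totQ by (rule imageI[OF emb_in_TB[OF i that]])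
  note pt = pt_TB[OF i]
  have pt_in: "act P (s i u) (\<rho> k) \<in> tot (bundle_res (U i) P)" if "u \<in> U i" "k \<in> carrier Hh" for u k
    using that i by (simp add: P.act_in s_in P.proj_act proj_s)
  have bij: "bij_betw (T\<kappa> i) (tot ?Q) (tot (bundle_res (U i) P))"
    unfolding bij_betw_def
  proof (rule conjI, rule inj_onI, goal_cases)
    case (1 Y Y')
    note Y = this
    obtain u k u' k' where Yu: "Y = ?orb (emb (u, k))" "u \<in> U i" "k \<in> carrier Hh"
      "Y' = ?orb (emb (u', k'))" "u' \<in> U i" "k' \<in> carrier Hh"
      using totQE[OF Y(1)] totQE[OF Y(2)] by blast
    have eq: "act P (s i u) (\<rho> k) = act P (s i u') (\<rho> k')"
      using Y(3) Yu by (simp add: pt)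
    from arg_cong[OF eq, of "proj P"] have u: "u = u'"
      using Yu i by (simp add: P.proj_act s_in proj_s)
    have "\<rho> k = \<rho> k'"
      using eq u Yu by (intro P.act_free[OF s_in[OF i Yu(2)] \<rho>_closed \<rho>_closed]) auto
    then obtain c where c: "c \<in> A" "k' = k \<otimes>\<^bsub>Hh\<^esub> \<iota> c"
      using same_image_right[OF Yu(3,6)] by metis
    have "k' \<otimes>\<^bsub>Hh\<^esub> \<iota> d = k \<otimes>\<^bsub>Hh\<^esub> \<iota> (c \<otimes>\<^bsub>Gh\<^esub> d)" if "d \<in> A" for d
      using that c Yu(3) by (simp add: Hh.m_assoc \<iota>_mult)
    then have "Y' = {emb (u, k \<otimes>\<^bsub>Hh\<^esub> \<iota> (c \<otimes>\<^bsub>Gh\<^esub> d)) | d. d \<in> A}"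
      unfolding Yu(4) u[symmetric] orb_TB[OF i Yu(5)[folded u] Yu(6)] u[symmetric] Setcompr_eq_image by (intro image_cong) simp_all
    also have "\<dots> = Y"
      unfolding Yu(1) orb_TB[OF i Yu(2,3)]
    proof (intro equalityI subsetI)
      fix z assume "z \<in> {emb (u, k \<otimes>\<^bsub>Hh\<^esub> \<iota> d) | d. d \<in> A}"
      then obtain d where d: "d \<in> A" "z = emb (u, k \<otimes>\<^bsub>Hh\<^esub> \<iota> d)" by blast
      have "c \<otimes>\<^bsub>Gh\<^esub> (inv\<^bsub>Gh\<^esub> c \<otimes>\<^bsub>Gh\<^esub> d) = d" "inv\<^bsub>Gh\<^esub> c \<otimes>\<^bsub>Gh\<^esub> d \<in> A" using c d by simp_all
      then show "z \<in> {emb (u, k \<otimes>\<^bsub>Hh\<^esub> \<iota> (c \<otimes>\<^bsub>Gh\<^esub> d)) | d. d \<in> A}"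
        using d(2) by (metis (mono_tags, lifting) mem_Collect_eq)
    qed (use c in auto)
    finally show "Y = Y'" by simp
  next
    case 2
    show ?case
    proof (intro equalityI subsetI)
      fix z assume "z \<in> T\<kappa> i ` tot ?Q"
      then obtain Y where Y: "Y \<in> tot ?Q" "z = T\<kappa> i Y" by blast
      then obtain u k where "u \<in> U i" "k \<in> carrier Hh" "Y = ?orb (emb (u, k))"
        using totQE by blast
      then show "z \<in> tot (bundle_res (U i) P)"
        using Y(2) pt pt_in by simp
    next
      fix z assume z: "z \<in> tot (bundle_res (U i) P)"
      then obtain d where d: "d \<in> carrier H" "z = act P (s i (proj P z)) d"
        using P.act_transitive[OF s_in[OF i], of "proj P z" z] i by (auto simp: proj_s)
      obtain k where "k \<in> carrier Hh" "\<rho> k = d" using \<rho>_surj[OF d(1)] .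
      then have "z = T\<kappa> i (?orb (emb (proj P z, k)))" "?orb (emb (proj P z, k)) \<in> tot ?Q"
        using d z pt emb_Q by auto
      then show "z \<in> T\<kappa> i ` tot ?Q" by blast
    qed
  qed
  have sm: "smooth_map (total_space ?Q) (total_space (bundle_res (U i) P)) (T\<kappa> i)"
  proof (rule smooth_mapI)
    fix Y assume "Y \<in> tot ?Q"
    then show "T\<kappa> i Y \<in> tot (bundle_res (U i) P)" by (rule bij_betw_apply[OF bij])
  next
    fix n Z p assume p: "p \<in> plots (total_space ?Q) n Z"
    note pQ' = p[unfolded spQ plots_quotient_space]
    note Z = pQ'[THEN conjunct1] and loc = pQ'[THEN conjunct2, THEN conjunct2]
    have pQ: "p z \<in> tot ?Q" if "z \<in> Z" for z
      unfolding totQ by (rule bspec[OF pQ'[THEN conjunct2, THEN conjunct1] that])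
    have "(\<lambda>z. T\<kappa> i (p z)) \<in> plots (total_space P) n Z"
    proof (rule plot_local[OF P.total Z])
      fix z assume z: "z \<in> Z"
      obtain V r where V: "openin (Euclidean_space n) V" "z \<in> V" "V \<subseteq> Z"
        and r: "r \<in> plots (total_space (TB i)) n V" "\<forall>v\<in>V. p v = ?orb (r v)"
        using bspec[OF loc z] by blast
      obtain c k where c: "c \<in> plots X n V" "\<And>v. v \<in> V \<Longrightarrow> c v \<in> U i" "k \<in> plots (dsp Hh) n V"
        "\<And>v. v \<in> V \<Longrightarrow> r v = emb (c v, k v)"
        using TB_plotE[OF i r(1)] by metis
      have "(\<lambda>v. s i (c v)) \<in> plots (total_space P) n V"
        using smooth_map_plot[OF section_s[OF i], of c n V] c by (simp add: plots_sub_space)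
      then have "(\<lambda>v. act P (s i (c v)) (\<rho> (k v))) \<in> plots (total_space P) n V"
        by (rule P.act_plot[OF _ \<rho>_plot[OF c(3)]])
      moreover have "\<forall>v\<in>V. T\<kappa> i (p v) = act P (s i (c v)) (\<rho> (k v))"
        using r(2) c(2,4) plot_in_carrier[OF Gh.diffeological_group_semidirect c(3)] pt by simp
      ultimately show "\<exists>V r. openin (Euclidean_space n) V \<and> z \<in> V \<and> V \<subseteq> Z \<and>
          r \<in> plots (total_space P) n V \<and> (\<forall>v\<in>V. T\<kappa> i (p v) = r v)"
        using V by blast
    qed
    moreover have "proj P (T\<kappa> i (p z)) \<in> U i" if "z \<in> Z" for z
      using bij_betw_apply[OF bij pQ[OF that]] by simp
    ultimately show "(\<lambda>z. T\<kappa> i (p z)) \<in> plots (total_space (bundle_res (U i) P)) n Z"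
      by (simp add: plots_bundle_res)
  qed
  let ?j = "inv_into (tot ?Q) (T\<kappa> i)"
  have j_in: "?j z \<in> tot ?Q" if "z \<in> tot (bundle_res (U i) P)" for z
  proof -
    have "z \<in> T\<kappa> i ` tot ?Q" using that by (simp only: bij_betw_imp_surj_on[OF bij])
    then show ?thesis by (rule inv_into_into)
  qed
  have sm': "smooth_map (total_space (bundle_res (U i) P)) (total_space ?Q) ?j"
  proof (rule smooth_mapI)
    fix z assume "z \<in> tot (bundle_res (U i) P)"
    then show "?j z \<in> tot ?Q" by (rule j_in)
  next
    fix n Z p assume p: "p \<in> plots (total_space (bundle_res (U i) P)) n Z"
    then have pP: "p \<in> plots (total_space P) n Z" "\<And>z. z \<in> Z \<Longrightarrow> proj P (p z) \<in> U i"
      by (simp_all add: plots_bundle_res)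
    have pr: "p z \<in> tot (bundle_res (U i) P)" if "z \<in> Z" for z
      using plot_in_points[OF P.total pP(1) that] pP(2)[OF that] by simp
    note cp = P.proj_plot[OF pP(1)]
    define d where "d z = P.division (s i (proj P (p z))) (p z)" for z
    have d: "d z \<in> carrier H" "act P (s i (proj P (p z))) (d z) = p z" if "z \<in> Z" for z
      unfolding d_def using P.division[OF s_in[OF i pP(2)[OF that]] plot_in_points[OF P.total pP(1) that]]
        i pP(2)[OF that] by (simp_all add: proj_s)
    have "(\<lambda>z. s i (proj P (p z))) \<in> plots (total_space P) n Z"
      using smooth_map_plot[OF section_s[OF i], of "\<lambda>z. proj P (p z)"] cp pP(2) by (simp add: plots_sub_space)
    then have "d \<in> plots (dsp H) n Z"
      unfolding d_def by (rule P.division_plot[OF _ pP(1)]) (simp add: proj_s i pP(2))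
    then have d12: "(\<lambda>z. fst (d z)) \<in> plots (dsp G) n Z" "(\<lambda>z. snd (d z)) \<in> plots (discrete_space Z2) n Z"
      by (simp_all add: G.plots_semidirect)
    have loc: "\<exists>V. openin (Euclidean_space n) V \<and> z \<in> V \<and> V \<subseteq> Z \<and>
         (\<exists>r\<in>plots (total_space (TB i)) n V. \<forall>v\<in>V. ?j (p v) = ?orb (r v))" if z: "z \<in> Z" for z
    proof -
      obtain V f where V: "openin (Euclidean_space n) V" "z \<in> V" "V \<subseteq> Z" and f: "f \<in> plots (dsp Gh) n V"
        "\<And>w. w \<in> V \<Longrightarrow> fst (d w) = q (f w)"
        using q_plot_lift[OF d12(1) z] by blast
      define k where "k v = (f v, snd (d v))" for v
      have k: "k \<in> plots (dsp Hh) n V"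
        using f(1) plot_restrict[OF diffeological_discrete_space d12(2) V(1,3) refl]
        by (simp add: k_def Gh.plots_semidirect)
      have \<rho>k: "\<rho> (k v) = d v" if "v \<in> V" for v
        using f(2)[OF that] by (simp add: k_def prod_eq_iff)
      have r: "(\<lambda>v. emb (proj P (p v), k v)) \<in> plots (total_space (TB i)) n V"
        by (rule TB_plotI[OF i plot_restrict[OF space cp V(1,3) refl] _ k]) (use V(3) pP(2) in auto)
      have "?j (p v) = ?orb (emb (proj P (p v), k v))" if v: "v \<in> V" for v
      proof -
        have vZ: "v \<in> Z" using v V(3) by blast
        have kv: "k v \<in> carrier Hh" by (rule plot_in_carrier[OF Gh.diffeological_group_semidirect k v])
        have "T\<kappa> i (?orb (emb (proj P (p v), k v))) = p v"
          using pt[OF pP(2)[OF vZ] kv] \<rho>k[OF v] d(2)[OF vZ] by simp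
        then show ?thesis
          using inv_into_f_f[OF bij_betw_imp_inj_on[OF bij] emb_Q[OF pP(2)[OF vZ] kv]] by simp
      qed
      then show ?thesis by (intro exI[of _ V] conjI V bexI[OF _ r]) simp
    qed
    have jQ: "?j (p z) \<in> tot ?Q" if "z \<in> Z" for z
      by (rule j_in[OF pr[OF that]])
    have "(\<lambda>z. ?j (p z)) \<in> plots (quotient_space (total_space (TB i)) ?orb) n Z"
      by (intro plots_quotient_space[THEN iffD2] conjI ballI plot_openin[OF P.total pP(1)] loc)
        (use jQ totQ in \<open>simp only:\<close>)
    then show "(\<lambda>z. ?j (p z)) \<in> plots (total_space ?Q) n Z"
      by (simp only: spQ)
  qed
  have "bundle_iso H ?Q (bundle_res (U i) P) (T\<kappa> i)"
    unfolding bundle_iso_def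
  proof (intro conjI ballI)
    show "diffeomorphism (total_space ?Q) (total_space (bundle_res (U i) P)) (T\<kappa> i)"
      using bij sm sm' by (simp add: diffeomorphism_def)
  next
    fix Y assume "Y \<in> tot ?Q"
    then obtain u k where Y: "Y = ?orb (emb (u, k))" "u \<in> U i" "k \<in> carrier Hh"
      using totQE by blast
    have "emb (u, k \<otimes>\<^bsub>Hh\<^esub> \<iota> \<one>\<^bsub>Gh\<^esub>) \<in> Y"
      unfolding Y(1) orb_TB[OF i Y(2,3)] using A_one by blast
    moreover have "proj (TB i) y = u" if "y \<in> Y" for y
      using that Y(2,3) unfolding Y(1) orb_TB[OF i Y(2,3)] by (auto simp: UX)
    ultimately have "proj (TB i) ` Y = {u}" by auto
    then have "proj ?Q Y = u" by (simp add: bundle_quot_def)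
    moreover have "proj P (T\<kappa> i Y) = u"
      unfolding Y(1) using Y(2,3) i by (simp add: pt P.proj_act s_in proj_s)
    ultimately show "proj (bundle_res (U i) P) (T\<kappa> i Y) = proj ?Q Y" by simp
    fix d assume "d \<in> carrier H"
    then obtain k' where k': "k' \<in> carrier Hh" "\<rho> k' = d" using \<rho>_surj by blast
    have y: "emb (u, k) \<in> tot (TB i)" using Y(2,3) by (auto simp: tot_TB[OF i])
    have "act ?Q Y d = ?orb (emb (u, k \<otimes>\<^bsub>Hh\<^esub> k'))"
      using orb_act[OF dpb y k'(1)] Y UX k'(2) by simp
    then have "T\<kappa> i (act ?Q Y d) = act P (s i u) (\<rho> k \<otimes>\<^bsub>H\<^esub> \<rho> k')"
      using pt[OF Y(2), of "k \<otimes>\<^bsub>Hh\<^esub> k'"] Y(3) k'(1) by (simp add: \<rho>_mult)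
    also have "\<dots> = act P (T\<kappa> i Y) d"
      unfolding Y(1) pt[OF Y(2,3)]
      using P.act_act[OF s_in[OF i Y(2)] \<rho>_closed[OF Y(3)] \<rho>_closed[OF k'(1)]] k'(2) by simp
    finally show "T\<kappa> i (act ?Q Y d) = act (bundle_res (U i) P) (T\<kappa> i Y) d" by simp
  qed
  moreover have "D_open X (U i)" using cover i by (simp add: open_cover_def)
  ultimately show ?thesis
    using principal_TB[OF i] by (simp add: lift_objs_def)
qed

text \<open>Left multiplication by \<open>hh i j\<close> commutes with the right action, and it covers the identity of \<open>P\<close>
  because \<open>hh i j\<close> lifts the transition function from \<open>s i\<close> to \<open>s j\<close>.\<close>

definition T\<phi> :: "'i \<Rightarrow> 'i \<Rightarrow> 'e \<Rightarrow> 'e" where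
  "T\<phi> i j = (\<lambda>y\<in>tot (bundle_res (U i \<inter> U j) (TB j)).
     emb (fst (dec y), hh i j (fst (dec y)) \<otimes>\<^bsub>Hh\<^esub> snd (dec y)))"

lemma tot_res_TB:
  assumes "i \<in> I" "j \<in> I"
  shows "y \<in> tot (bundle_res (U i \<inter> U j) (TB j)) \<longleftrightarrow> (\<exists>u\<in>U i \<inter> U j. \<exists>k\<in>carrier Hh. y = emb (u, k))"
    and "y \<in> tot (bundle_res (U i \<inter> U j) (TB i)) \<longleftrightarrow> (\<exists>u\<in>U i \<inter> U j. \<exists>k\<in>carrier Hh. y = emb (u, k))"
  using U_subset[OF assms(1)] U_subset[OF assms(2)]
  by (auto simp: tot_TB[OF assms(1)] tot_TB[OF assms(2)] subset_iff)

lemma left_mult_smooth: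
  assumes ij: "i \<in> I" "j \<in> I" "i' \<in> I" and sub: "U i' \<inter> W = W" "U j \<inter> W = W"
    and f_in: "\<And>u. u \<in> W \<Longrightarrow> f u \<in> carrier Hh"
    and f_plot: "\<And>n Z c. c \<in> plots X n Z \<Longrightarrow> (\<And>z. z \<in> Z \<Longrightarrow> c z \<in> W) \<Longrightarrow> (\<lambda>z. f (c z)) \<in> plots (dsp Hh) n Z"
  shows "smooth_map (total_space (bundle_res W (TB j))) (total_space (bundle_res W (TB i')))
     (\<lambda>y. emb (fst (dec y), f (fst (dec y)) \<otimes>\<^bsub>Hh\<^esub> snd (dec y)))"
proof (rule smooth_mapI)
  have UX: "u \<in> points X" if "u \<in> W" for u using that U_subset[OF ij(2)] sub(2) by blast
  have WU: "u \<in> U j" "u \<in> U i'" if "u \<in> W" for u using that sub by blast+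
  fix y assume "y \<in> tot (bundle_res W (TB j))"
  then obtain u k where y: "y = emb (u, k)" "u \<in> W" "k \<in> carrier Hh"
    using U_subset[OF ij(2)] by (auto simp: tot_TB[OF ij(2)])
  then show "emb (fst (dec y), f (fst (dec y)) \<otimes>\<^bsub>Hh\<^esub> snd (dec y)) \<in> tot (bundle_res W (TB i'))"
    using UX f_in WU by (simp add: emb_in_TB ij(3))
next
  have UX: "u \<in> points X" if "u \<in> W" for u using that U_subset[OF ij(2)] sub(2) by blast
  fix n Z p assume "p \<in> plots (total_space (bundle_res W (TB j))) n Z"
  then have p: "p \<in> plots (total_space (TB j)) n Z" "\<And>z. z \<in> Z \<Longrightarrow> proj (TB j) (p z) \<in> W"
    by (simp_all add: plots_bundle_res)
  obtain c k where c: "c \<in> plots X n Z" "\<And>z. z \<in> Z \<Longrightarrow> c z \<in> U j" "k \<in> plots (dsp Hh) n Z"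
    "\<And>z. z \<in> Z \<Longrightarrow> p z = emb (c z, k z)"
    using TB_plotE[OF ij(2) p(1)] by metis
  have kz: "k z \<in> carrier Hh" if "z \<in> Z" for z
    by (rule plot_in_carrier[OF Gh.diffeological_group_semidirect c(3) that])
  have cW: "c z \<in> W" if "z \<in> Z" for z
    using p(2)[OF that] c(2,4)[OF that] kz[OF that] U_subset[OF ij(2)] by auto
  have val: "emb (fst (dec (p z)), f (fst (dec (p z))) \<otimes>\<^bsub>Hh\<^esub> snd (dec (p z))) = emb (c z, f (c z) \<otimes>\<^bsub>Hh\<^esub> k z)"
    if "z \<in> Z" for z
    using c(4)[OF that] cW[OF that] UX kz[OF that] by simp
  have "(\<lambda>z. emb (c z, f (c z) \<otimes>\<^bsub>Hh\<^esub> k z)) \<in> plots (total_space (TB i')) n Z"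
    by (intro TB_plotI ij c(1,3) plot_mult[OF Gh.diffeological_group_semidirect] f_plot cW) (use cW sub in blast)
  from plot_cong[OF TB_space this val]
  have "(\<lambda>z. emb (fst (dec (p z)), f (fst (dec (p z))) \<otimes>\<^bsub>Hh\<^esub> snd (dec (p z)))) \<in> plots (total_space (TB i')) n Z" .
  moreover have "proj (TB i') (emb (fst (dec (p z)), f (fst (dec (p z))) \<otimes>\<^bsub>Hh\<^esub> snd (dec (p z)))) \<in> W"
    if "z \<in> Z" for z
    unfolding val[OF that] using cW[OF that] UX kz[OF that] f_in by simp
  ultimately show "(\<lambda>z. emb (fst (dec (p z)), f (fst (dec (p z))) \<otimes>\<^bsub>Hh\<^esub> snd (dec (p z))))
      \<in> plots (total_space (bundle_res W (TB i'))) n Z"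
    by (simp add: plots_bundle_res)
qed

lemma T\<phi>_emb:
  assumes "i \<in> I" "j \<in> I" "u \<in> U i" "u \<in> U j" "k \<in> carrier Hh"
  shows "T\<phi> i j (emb (u, k)) = emb (u, hh i j u \<otimes>\<^bsub>Hh\<^esub> k)"
proof -
  have "u \<in> points X" using U_subset[OF assms(1)] assms by blast
  moreover have "emb (u, k) \<in> tot (bundle_res (U i \<inter> U j) (TB j))"
    using tot_res_TB(1)[OF assms(1,2)] assms by blast
  ultimately show ?thesis
    using assms(5) unfolding T\<phi>_def by (simp only: restrict_apply' dec_emb fst_conv snd_conv)
qed

lemma T\<phi>_mor:
  assumes ij: "i \<in> I" "j \<in> I"
  shows "T\<phi> i j \<in> lift_mors A Hh (bundle_res (U i \<inter> U j) (TB j), T\<kappa> j) (bundle_res (U i \<inter> U j) (TB i), T\<kappa> i)"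
proof -
  let ?W = "U i \<inter> U j"
  let ?Bj = "bundle_res ?W (TB j)" and ?Bi = "bundle_res ?W (TB i)"
  let ?f = "\<lambda>y. emb (fst (dec y), hh i j (fst (dec y)) \<otimes>\<^bsub>Hh\<^esub> snd (dec y))"
  let ?f' = "\<lambda>y. emb (fst (dec y), inv\<^bsub>Hh\<^esub> (hh i j (fst (dec y))) \<otimes>\<^bsub>Hh\<^esub> snd (dec y))"
  have UX: "u \<in> points X" if "u \<in> ?W" for u using that U_subset[OF ij(1)] by blast
  note t = tot_res_TB[OF ij]
  have sp: "diffeological_space (total_space (bundle_res ?W (TB l)))" for l
    by (simp add: bundle_res_def diffeological_sub_space TB_space)
  have f: "smooth_map (total_space ?Bj) (total_space ?Bi) ?f"
    by (rule left_mult_smooth[OF ij ij(1)]) (use ij hh_plot in auto)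
  have f': "smooth_map (total_space ?Bi) (total_space ?Bj) ?f'"
    by (rule left_mult_smooth[OF ij(2,1,2)])
      (use ij in \<open>auto intro!: plot_inv[OF Gh.diffeological_group_semidirect] hh_plot\<close>)
  have "smooth_map (total_space ?Bj) (total_space ?Bi) (T\<phi> i j)"
    unfolding T\<phi>_def by (rule smooth_map_cong[OF sp sp f]) (simp only: restrict_apply')
  then have "diffeomorphism (total_space ?Bj) (total_space ?Bi) (T\<phi> i j)"
  proof (rule diffeomorphismI[OF sp sp _ f'])
    fix y assume "y \<in> tot ?Bj"
    then obtain u k where y: "u \<in> ?W" "k \<in> carrier Hh" "y = emb (u, k)" unfolding t(1) by (elim bexE)
    then show "?f' (T\<phi> i j y) = y"
      using T\<phi>_emb[OF ij, of u k] UX[OF y(1)] ij by simp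
  next
    fix y assume "y \<in> tot ?Bi"
    then obtain u k where y: "u \<in> ?W" "k \<in> carrier Hh" "y = emb (u, k)" unfolding t(2) by (elim bexE)
    then show "T\<phi> i j (?f' y) = y"
      using T\<phi>_emb[OF ij, of u "inv\<^bsub>Hh\<^esub> (hh i j u) \<otimes>\<^bsub>Hh\<^esub> k"] UX[OF y(1)] ij by simp
  qed
  moreover have "proj ?Bi (T\<phi> i j y) = proj ?Bj y \<and>
      (\<forall>k'\<in>carrier Hh. T\<phi> i j (act ?Bj y k') = act ?Bi (T\<phi> i j y) k') \<and>
      pt (T\<kappa> i) ?Bi (T\<phi> i j y) = pt (T\<kappa> j) ?Bj y"
    if yj: "y \<in> tot ?Bj" for y
  proof -
    obtain u k where y: "u \<in> ?W" "k \<in> carrier Hh" "y = emb (u, k)" using iffD1[OF t(1) yj] by (elim bexE)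
    have u: "u \<in> U i" "u \<in> U j" using y(1) by auto
    have hk: "hh i j u \<otimes>\<^bsub>Hh\<^esub> k \<in> carrier Hh" using ij u y(2) by simp
    have "act P (s i u) (\<rho> (hh i j u \<otimes>\<^bsub>Hh\<^esub> k)) = act P (act P (s i u) (h i j u)) (\<rho> k)"
      using P.act_act[OF s_in[OF ij(1) u(1)] h_in[OF ij u] \<rho>_closed[OF y(2)]] ij u y(2)
      by (simp add: \<rho>_mult \<rho>_hh)
    then have "pt (T\<kappa> i) ?Bi (T\<phi> i j y) = pt (T\<kappa> j) ?Bj y"
      using T\<phi>_emb[OF ij u y(2)] pt_TB[OF ij(1) u(1) hk] pt_TB[OF ij(2) u(2) y(2)] s_h[OF ij u] y(3) by simp
    then show ?thesis
      using UX[OF y(1)] T\<phi>_emb[OF ij u y(2)] T\<phi>_emb[OF ij u] y hk ij u by (simp add: Hh.m_assoc)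
  qed
  moreover have "T\<phi> i j \<in> extensional (tot ?Bj)" by (simp only: T\<phi>_def restrict_extensional)
  ultimately show ?thesis
    unfolding lift_mors_def split mem_Collect_eq bundle_iso_def by blast
qed

text \<open>The unit sections of the trivial bundles lie over the frames, and the isomorphisms between the
  bundles carry them to each other up to \<open>hh\<close>, so the comparison of sections applies.\<close>

lemma class_in_gerbe_classes:
  "cech_class X F I U a_sec \<in> gerbe_classes X F (lifting_gerbe X A Hh H q P I U s ::
      ('x, ('e, 'x, 'k, 'p) lift_obj, 'e \<Rightarrow> 'e, 'i \<Rightarrow> 'x \<Rightarrow> 'k) banded_stack)"
proof -
  let ?G = "lifting_gerbe X A Hh H q P I U s ::
      ('x, ('e, 'x, 'k, 'p) lift_obj, 'e \<Rightarrow> 'e, 'i \<Rightarrow> 'x \<Rightarrow> 'k) banded_stack"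
  obtain fr where fr: "\<And>y. y \<in> points X \<Longrightarrow> fr y \<in> I \<and> y \<in> U (fr y)"
    using cover_point by metis
  have cov: "open_cover X (points X) (\<lambda>y. U (fr y))"
    using fr cover U_subset unfolding open_cover_def by fast
  define x where "x y = (TB (fr y), T\<kappa> (fr y))" for y
  define \<phi> where "\<phi> y z = T\<phi> (fr y) (fr z)" for y z
  have data: "gerbe_data X ?G (points X) (\<lambda>y. U (fr y)) x \<phi>"
    unfolding gerbe_data_def using cov fr
    by (simp add: lifting_gerbe_def x_def \<phi>_def object_TB T\<phi>_mor)
  interpret C: gerbe_choice X Gh G A q \<sigma> \<sigma>h P I U s g \<epsilon> gh "points X" "\<lambda>y. U (fr y)" x \<phi>
    by unfold_locales (rule data)
  interpret C: gerbe_sections X Gh G A q \<sigma> \<sigma>h P I U s g \<epsilon> gh "points X" "\<lambda>y. U (fr y)" x \<phi>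
    "points X" "\<lambda>y. U (fr y)" "\<lambda>y. y" fr "\<lambda>y u. emb (u, \<one>\<^bsub>Hh\<^esub>)"
  proof unfold_locales
    show "open_cover X (points X) (\<lambda>y. U (fr y))" by (rule cov)
  next
    fix y assume y: "y \<in> points X"
    have i: "fr y \<in> I" using fr y by blast
    show "smooth_map (sub_space X (U (fr y))) (total_space (fst (x y))) (\<lambda>u. emb (u, \<one>\<^bsub>Hh\<^esub>))"
    proof (rule smooth_mapI)
      fix n Z c assume "c \<in> plots (sub_space X (U (fr y))) n Z"
      then have c: "c \<in> plots X n Z" "\<And>z. z \<in> Z \<Longrightarrow> c z \<in> U (fr y)" by (simp_all add: plots_sub_space)
      have "(\<lambda>_. \<one>\<^bsub>Hh\<^esub>) \<in> plots (dsp Hh) n Z"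
        by (rule plot_const[OF diffeological_group_space[OF Gh.diffeological_group_semidirect] plot_openin[OF space c(1)]])
          simp
      then show "(\<lambda>z. emb (c z, \<one>\<^bsub>Hh\<^esub>)) \<in> plots (total_space (fst (x y))) n Z"
        unfolding x_def fst_conv by (intro TB_plotI i c)
    qed (use i in \<open>auto simp: x_def tot_TB\<close>)
    fix u assume u: "u \<in> U (fr y)"
    show "C.lp y (emb (u, \<one>\<^bsub>Hh\<^esub>)) = s (fr y) u"
      using pt_TB[OF i u Hh.one_closed] i u by (simp add: x_def \<rho>_one P.act_one s_in)
  qed (use fr in auto)
  show ?thesis
    unfolding gerbe_classes_def using data C.class_eq by blast
qed

end

theorem theorem6p10:
  fixes X :: "'x dspace"
    and Gh :: "'k dgroup" and G :: "'g dgroup" and A :: "'k set" and q :: "'k \<Rightarrow> 'g"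
    and \<sigma> :: "int \<Rightarrow> 'g \<Rightarrow> 'g" and \<sigma>h :: "int \<Rightarrow> 'k \<Rightarrow> 'k"
    and H :: "('g \<times> int) dgroup" and Hh :: "('k \<times> int) dgroup"
    and P :: "('p, 'x, 'g \<times> int) pbundle"
    and I :: "'i set" and U :: "'i \<Rightarrow> 'x set" and s :: "'i \<Rightarrow> 'x \<Rightarrow> 'p"
    and g :: "'i \<Rightarrow> 'i \<Rightarrow> 'x \<Rightarrow> 'g" and \<epsilon> :: "'i \<Rightarrow> 'i \<Rightarrow> 'x \<Rightarrow> int"
    and gh :: "'i \<Rightarrow> 'i \<Rightarrow> 'x \<Rightarrow> 'k" and a :: "'i \<Rightarrow> 'i \<Rightarrow> 'i \<Rightarrow> 'x \<Rightarrow> 'k"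
    and A\<^sub>\<alpha> :: "('x, 'i \<Rightarrow> 'x \<Rightarrow> 'k) ab_presheaf"
    and \<G> :: "('x, ('e, 'x, 'k, 'p) lift_obj, 'e \<Rightarrow> 'e, 'i \<Rightarrow> 'x \<Rightarrow> 'k) banded_stack"
  defines "H \<equiv> semidirect G \<sigma>"
    and "Hh \<equiv> semidirect Gh \<sigma>h"
    and "a \<equiv> (\<lambda>i j k u. gh i j u \<otimes>\<^bsub>Gh\<^esub> \<sigma>h (\<epsilon> i j u) (gh j k u) \<otimes>\<^bsub>Gh\<^esub> inv\<^bsub>Gh\<^esub> (gh i k u))"
    and "A\<^sub>\<alpha> \<equiv> local_system X Gh A \<sigma>h I U \<epsilon>"
    and "\<G> \<equiv> lifting_gerbe X A Hh H q P I U s"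
  assumes extension: "central_extension A Gh G q"
    and action: "Z2_action G \<sigma>"
    and action_hat: "Z2_action Gh \<sigma>h"
    and compatible: "\<forall>e\<in>Z2. \<forall>x\<in>carrier Gh. q (\<sigma>h e x) = \<sigma> e (q x)"
    and space: "diffeological_space X"
    and principal: "principal_bundle H X P"
    and cover: "open_cover X I U"
    and transition: "transition_functions H X P I U s (\<lambda>i j u. (g i j u, \<epsilon> i j u))"
    and lifts: "\<forall>i\<in>I. \<forall>j\<in>I. smooth_map (sub_space X (U i \<inter> U j)) (dsp Gh) (gh i j) \<and>
                  (\<forall>u\<in>U i \<inter> U j. q (gh i j u) = g i j u)"
    and universe: "\<exists>emb :: 'x \<times> ('k \<times> int) \<Rightarrow> 'e. inj_on emb (points X \<times> carrier Hh)"
  shows "twisted_cocycle X Gh A \<sigma>h I U \<epsilon> a \<and>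
    twisted_class X Gh A \<sigma>h I U \<epsilon> a \<in> cech_H2 X A\<^sub>\<alpha> \<and>
    twisted_class X Gh A \<sigma>h I U \<epsilon> a \<in> gerbe_classes X A\<^sub>\<alpha> \<G> \<and>
    (smooth_lifts_exist X Gh G q \<longrightarrow>
       gerbe_classes X A\<^sub>\<alpha> \<G> = {twisted_class X Gh A \<sigma>h I U \<epsilon> a})"
proof -
  interpret L: lifting_problem X Gh G A q \<sigma> \<sigma>h P I U s g \<epsilon> gh
    using extension action action_hat compatible space principal cover transition lifts
    unfolding H_def by unfold_locales
  have a: "a = L.a"
    by (simp add: a_def L.a_def fun_eq_iff)
  have cls: "twisted_class X Gh A \<sigma>h I U \<epsilon> a = cech_class X A\<^sub>\<alpha> I U L.a_sec"
    unfolding twisted_class_def a A\<^sub>\<alpha>_def L.a_sec_def[abs_def] ..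
  obtain emb :: "'x \<times> ('k \<times> int) \<Rightarrow> 'e" where emb: "inj_on emb (points X \<times> carrier Hh)"
    using universe by blast
  interpret T: trivial_objects X Gh G A q \<sigma> \<sigma>h P I U s g \<epsilon> gh emb
    by unfold_locales (use emb in \<open>simp add: Hh_def\<close>)
  have mem: "twisted_class X Gh A \<sigma>h I U \<epsilon> a \<in> gerbe_classes X A\<^sub>\<alpha> \<G>"
    unfolding cls A\<^sub>\<alpha>_def \<G>_def H_def Hh_def by (rule T.class_in_gerbe_classes)
  have unique: "c = twisted_class X Gh A \<sigma>h I U \<epsilon> a"
    if sl: "smooth_lifts_exist X Gh G q" and c: "c \<in> gerbe_classes X A\<^sub>\<alpha> \<G>" for c
  proof -
    obtain K :: "'x set" and V x \<phi> where K: "c = cech_class X A\<^sub>\<alpha> K V (gerbe_defect A\<^sub>\<alpha> \<G> V x \<phi>)"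
      "gerbe_data X \<G> K V x \<phi>"
      using c unfolding gerbe_classes_def by blast
    interpret C: gerbe_choice X Gh G A q \<sigma> \<sigma>h P I U s g \<epsilon> gh K V x \<phi>
      by unfold_locales (use K(2) in \<open>simp add: \<G>_def H_def Hh_def\<close>)
    show ?thesis
      using C.class_eq_if_lifts[OF sl] unfolding K(1) cls A\<^sub>\<alpha>_def \<G>_def H_def Hh_def .
  qed
  have "twisted_cocycle X Gh A \<sigma>h I U \<epsilon> a"
    unfolding a by (rule L.twisted_cocycle_a)
  moreover have "twisted_class X Gh A \<sigma>h I U \<epsilon> a \<in> cech_H2 X A\<^sub>\<alpha>"
    unfolding cls A\<^sub>\<alpha>_def by (rule L.cech_class_in_H2[OF cover L.a_sec_cocycle])
  ultimately show ?thesis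
    using mem unique by blast
qed

end
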